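(* Let $n\ge 3$ be odd, let $B=\{x\in\mathbb{R}^n:|x|<1\}$, and let $f\in C^\infty(\mathbb{R}^n)$ be supported in $B$ (so that $\operatorname{supp} f$ is a compact subset of the open ball $B$). For $\theta\in S^{n-1}$ and $t>0$ put $$\varphi_\theta(t)=(Mf)(\theta,t)=\frac{1}{\sigma_{n-1}}\int_{S^{n-1}} f(\theta-t\sigma)\,d\sigma .$$ Then for every $x\in B$, $$f(x)=c_n\,\Delta\int_{S^{n-1}}\big[D^{n-3}\,t^{n-2}\varphi_\theta\big]\Big|_{t=|x-\theta|}\,d\theta,\qquad c_n=\frac{(-1)^{(n-1)/2}}{4\pi^{n/2-1}\,\Gamma(n/2)} ,$$ where $D=\frac{1}{2t}\frac{d}{dt}$ and $\Delta=\sum_{k=1}^n \partial^2/\partial x_k^2$ acts in the variable $x$.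
   Context: $S^{n-1}$ is the unit sphere in $\mathbb{R}^n$, $d\sigma$ and $d\theta$ denote the usual (unnormalized) surface measure on $S^{n-1}$, and $\sigma_{n-1}=2\pi^{n/2}/\Gamma(n/2)$ is its total area. The expression $D^{n-3}t^{n-2}\varphi_\theta$ means the function of $t>0$ obtained by applying the differential operator $D=\frac{1}{2t}\frac{d}{dt}$ to $t^{n-2}\varphi_\theta(t)$ exactly $n-3$ times; it is then evaluated at $t=|x-\theta|$. *)

theory Defs
  imports "HOL-Analysis.Analysis"
begin

text \<open>
  The unnormalized surface measure on the unit sphere, by polar coordinates: the area of
  \<open>A\<close> is \<open>n\<close> times the Lebesgue measure of the cone \<open>{r *\<^sub>R a | 0 < r < 1, a \<in> A}\<close>.
  The definition pushes Lebesgue measure on the punctured unit ball forward along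
  \<open>x \<mapsto> x / norm x\<close>; \<open>emeasure_sphere_measure\<close> and \<open>measure_sphere_measure_space\<close> below
  give the cone formula and the total area.
\<close>

definition sphere_measure :: "'a::euclidean_space measure" where
  "sphere_measure =
     scale_measure (of_nat DIM('a))
       (distr (restrict_space lborel (ball 0 1 - {0})) (restrict_space borel (sphere 0 1)) sgn)"

definition sphere_area :: "nat \<Rightarrow> real" where
  "sphere_area n = 2 * pi powr (real n / 2) / Gamma (real n / 2)"

lemma sgn_measurable_sphere:
  "sgn \<in> measurable (restrict_space lborel (ball 0 1 - {0 :: 'a::euclidean_space}))
     (restrict_space borel (sphere 0 1))"
proof (rule measurable_restrict_space2)
  show "sgn \<in> space (restrict_space lborel (ball 0 1 - {0 :: 'a})) \<rightarrow> sphere 0 1"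
    by (auto simp: space_restrict_space norm_sgn)
  have "(sgn :: 'a \<Rightarrow> 'a) \<in> borel_measurable borel"
    unfolding sgn_div_norm by measurable
  then show "sgn \<in> borel_measurable (restrict_space lborel (ball 0 1 - {0 :: 'a}))"
    by (auto intro: measurable_restrict_space1)
qed

lemma emeasure_sphere_measure:
  fixes A :: "'a::euclidean_space set"
  assumes "A \<in> sets borel" "A \<subseteq> sphere 0 1"
  shows "emeasure sphere_measure A =
    of_nat DIM('a) * emeasure lborel {r *\<^sub>R a | r a. 0 < r \<and> r < 1 \<and> a \<in> A}"
proof -
  have A: "A \<in> sets (restrict_space borel (sphere 0 1))"
    using assms by (auto simp: sets_restrict_space)
  have eq: "sgn -` A \<inter> (ball 0 1 - {0}) = {r *\<^sub>R a | r a. 0 < r \<and> r < 1 \<and> a \<in> A}"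
  proof (intro equalityI subsetI)
    fix x :: 'a assume x: "x \<in> sgn -` A \<inter> (ball 0 1 - {0})"
    then have "x = norm x *\<^sub>R sgn x" by (simp add: sgn_div_norm)
    with x show "x \<in> {r *\<^sub>R a | r a. 0 < r \<and> r < 1 \<and> a \<in> A}"
      by (auto intro!: exI[of _ "norm x"] exI[of _ "sgn x"])
  next
    fix x :: 'a assume "x \<in> {r *\<^sub>R a | r a. 0 < r \<and> r < 1 \<and> a \<in> A}"
    then obtain r a where x: "x = r *\<^sub>R a" "0 < r" "r < 1" "a \<in> A" by auto
    with assms have "norm a = 1" by auto
    with x show "x \<in> sgn -` A \<inter> (ball 0 1 - {0})"
      by (auto simp: sgn_div_norm)
  qed
  have "{r *\<^sub>R a | r a. 0 < r \<and> r < 1 \<and> a \<in> A} \<subseteq> ball 0 1 - {0}"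
    unfolding eq[symmetric] by blast
  then have "emeasure (restrict_space lborel (ball 0 1 - {0})) {r *\<^sub>R a | r a. 0 < r \<and> r < 1 \<and> a \<in> A}
      = emeasure lborel {r *\<^sub>R a | r a. 0 < r \<and> r < 1 \<and> a \<in> A}"
    by (intro emeasure_restrict_space) auto
  then show ?thesis
    unfolding sphere_measure_def
    by (simp add: emeasure_distr[OF sgn_measurable_sphere A] space_restrict_space eq)
qed

lemma measure_sphere_measure_space:
  "measure (sphere_measure :: 'a::euclidean_space measure) (sphere 0 1) = sphere_area DIM('a)"
proof -
  have "{r *\<^sub>R a | r a. 0 < r \<and> r < 1 \<and> a \<in> sphere 0 1} = ball 0 1 - {0 :: 'a}"
  proof (intro equalityI subsetI)
    fix x :: 'a assume x: "x \<in> ball 0 1 - {0}"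
    then have "x = norm x *\<^sub>R sgn x" by (simp add: sgn_div_norm)
    with x show "x \<in> {r *\<^sub>R a | r a. 0 < r \<and> r < 1 \<and> a \<in> sphere 0 1}"
      by (auto intro!: exI[of _ "norm x"] exI[of _ "sgn x"] simp: norm_sgn)
  qed auto
  moreover have "emeasure lborel (ball 0 1 - {0 :: 'a}) = emeasure lborel (ball 0 1 :: 'a set)"
    by (subst emeasure_Diff) auto
  ultimately have "emeasure sphere_measure (sphere 0 1 :: 'a set) =
      of_nat DIM('a) * ennreal (unit_ball_vol DIM('a))"
    by (subst emeasure_sphere_measure) (auto simp: emeasure_ball)
  then have "measure sphere_measure (sphere 0 1 :: 'a set) = DIM('a) * unit_ball_vol DIM('a)"
    by (simp add: measure_def enn2real_mult)
  also have "\<dots> = sphere_area DIM('a)"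
  proof -
    have pos: "real DIM('a) / 2 > 0" by simp
    then have "real DIM('a) / 2 \<notin> \<int>\<^sub>\<le>\<^sub>0" using nonpos_Ints_nonpos not_le by blast
    then have G: "Gamma (real DIM('a) / 2 + 1) = real DIM('a) / 2 * Gamma (real DIM('a) / 2)"
      by (rule Gamma_plus1)
    show ?thesis
      unfolding unit_ball_vol_def sphere_area_def G by simp
  qed
  finally show ?thesis .
qed

fun C_k :: "nat \<Rightarrow> ('a::euclidean_space \<Rightarrow> real) \<Rightarrow> bool" where
  "C_k 0 f \<longleftrightarrow> continuous_on UNIV f"
| "C_k (Suc k) f \<longleftrightarrow>
     (\<forall>x. f differentiable (at x)) \<and> (\<forall>v. C_k k (\<lambda>x. frechet_derivative f (at x) v))"

definition C_infinity :: "('a::euclidean_space \<Rightarrow> real) \<Rightarrow> bool" where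
  "C_infinity f \<longleftrightarrow> (\<forall>k. C_k k f)"

definition spherical_mean :: "('a::euclidean_space \<Rightarrow> real) \<Rightarrow> 'a \<Rightarrow> real \<Rightarrow> real" where
  "spherical_mean f \<theta> t =
     1 / sphere_area DIM('a) * (\<integral>\<sigma>. f (\<theta> - t *\<^sub>R \<sigma>) \<partial>sphere_measure)"

definition D_op :: "(real \<Rightarrow> real) \<Rightarrow> real \<Rightarrow> real" where
  "D_op g t = 1 / (2 * t) * deriv g t"

definition partial_deriv :: "'a::euclidean_space \<Rightarrow> ('a \<Rightarrow> real) \<Rightarrow> 'a \<Rightarrow> real" where
  "partial_deriv b u x = deriv (\<lambda>s. u (x + s *\<^sub>R b)) 0"

definition has_partial_deriv :: "'a::euclidean_space \<Rightarrow> ('a \<Rightarrow> real) \<Rightarrow> 'a \<Rightarrow> bool" where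
  "has_partial_deriv b u x \<longleftrightarrow> (\<lambda>s. u (x + s *\<^sub>R b)) differentiable (at 0)"

definition laplacian :: "('a::euclidean_space \<Rightarrow> real) \<Rightarrow> 'a \<Rightarrow> real" where
  "laplacian u x = (\<Sum>b\<in>Basis. partial_deriv b (partial_deriv b u) x)"

text \<open>
  Since \<open>deriv\<close> and the Bochner integral are total functions, the following predicates
  record that the expressions formed with them exist.
\<close>

definition D_iterable_on :: "real set \<Rightarrow> nat \<Rightarrow> (real \<Rightarrow> real) \<Rightarrow> bool" where
  "D_iterable_on T m g \<longleftrightarrow> (\<forall>k<m. \<forall>t\<in>T. (D_op ^^ k) g differentiable (at t))"

definition has_laplacian_on :: "'a::euclidean_space set \<Rightarrow> ('a \<Rightarrow> real) \<Rightarrow> bool" where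
  "has_laplacian_on U u \<longleftrightarrow>
     (\<forall>b\<in>Basis. \<forall>x\<in>U. has_partial_deriv b u x \<and> has_partial_deriv b (partial_deriv b u) x)"

end

(*
  In the variable s = t^2 the operator D is d/ds, and t^(n-2) phi_theta(t) is, up to the factor
  2 / sigma_(n-1), the derivative of E_theta(s), the integral of f over |y - theta|^2 < s.
  Integrating E_theta(|x - theta|^2 + tau) over theta and exchanging the integrals leaves the
  integral of f(y) times the area of the cap of those theta with
  |y - theta|^2 < |x - theta|^2 + tau, i.e. theta . omega > p for omega = (y - x) / |y - x| and
  p = (|y|^2 - |x|^2 - tau) / (2 |y - x|).  For odd n the cap area is a polynomial of degree n - 2
  in p on [-1, 1], so its (n-2)nd derivative in tau is a multiple of |y - x|^(2-n): the
  backprojection is a Newtonian potential of f, and the Laplacian recovers f.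

  The cap area is polynomial only for |tau| < (1 - |x|) |y - x|, which shrinks as y approaches x.
  Replacing the (n-2)nd derivative in tau by the forward difference quotient of step a makes the
  exchange of limits a dominated convergence: the quotient is exact where a is small compared with
  |y - x|, and elsewhere the trivial bound of order a^(2-n) is itself of order |y - x|^(2-n).
*)
theory Submission
  imports Defs "HOL-Computational_Algebra.Polynomial"
begin

subsection \<open>Differentiation under the integral and forward differences\<close>

text \<open>Write n = 2 m + 3. The orders in the formula are forced: D^(n-3) and the one derivative
  from \<open>ball_integral\<close> to the spherical mean make 2 m + 1 derivatives in s, just enough
  to turn the cap polynomial into a constant, so that nothing but the factor (2 |y - x|)^(2-n) from
  the affine p depends on x and y. Parity enters through the slope of the cap area, minus the area
  of S^(n-2) times (1 - p^2)^((n-3)/2).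

  Since the surface measure is a cone volume, integrals over spheres arise as radial derivatives of
  integrals over balls. Zonal integrals, integrability of the Newton kernel and the mass of the
  approximate identity are all found by differentiating in the radius, so only that one
  infinitesimal form of polar coordinates is needed.

  The singular kernel is never differentiated. The potential is a convolution, both derivatives fall
  on f, and they are then moved to the smooth kernel (|z|^2 + eps^2)^((2-n)/2), whose Laplacian is
  an approximate identity as eps tends to 0.\<close>

lemma has_real_derivative_eventually_cong:
  fixes f g :: "real \<Rightarrow> real"
  assumes "(f has_real_derivative D) (at x)" "\<forall>\<^sub>F y in nhds x. f y = g y"
  shows "(g has_real_derivative D) (at x)"
  using assms DERIV_cong_ev by blast

text \<open>Dominated convergence for difference quotients along sequences. Differentiability is
  asked for only at the one point \<open>t\<close> and almost everywhere, because truncated powers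
  such as \<open>max 0 (s\<^sup>2 - q\<^sup>2)\<close> have corners; a Lipschitz bound then takes
  the place of a bound on the derivative.\<close>

lemma has_real_derivative_integral_lipschitz:
  fixes q :: "real \<Rightarrow> 'b \<Rightarrow> real"
  assumes t: "a < t" "t < b"
    and int: "\<And>s. a < s \<Longrightarrow> s < b \<Longrightarrow> integrable M (q s)"
    and der: "AE x in M. ((\<lambda>s. q s x) has_real_derivative q' x) (at t)"
    and q': "q' \<in> borel_measurable M"
    and lip: "\<And>s x. a < s \<Longrightarrow> s < b \<Longrightarrow> x \<in> space M \<Longrightarrow> \<bar>q s x - q t x\<bar> \<le> w x * \<bar>s - t\<bar>"
    and w: "integrable M w"
  shows "((\<lambda>s. \<integral>x. q s x \<partial>M) has_real_derivative (\<integral>x. q' x \<partial>M)) (at t)"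
  unfolding has_field_derivative_iff tendsto_at_iff_sequentially comp_def
proof (intro allI impI)
  fix X :: "nat \<Rightarrow> real"
  assume X: "\<forall>i. X i \<in> UNIV - {t}" "X \<longlonglongrightarrow> t"
  have "\<forall>\<^sub>F i in sequentially. a < X i \<and> X i < b"
    using order_tendstoD[OF X(2)] t by (auto intro: eventually_conj)
  then obtain N where N: "\<And>i. i \<ge> N \<Longrightarrow> a < X i \<and> X i < b"
    by (auto simp: eventually_sequentially)
  define Y where "Y = (\<lambda>i. X (i + N))"
  have Y: "a < Y i" "Y i < b" "Y i \<noteq> t" for i
    using N[of "i + N"] X(1) by (auto simp: Y_def)
  have Ylim: "Y \<longlonglongrightarrow> t" unfolding Y_def using X(2) by (rule LIMSEQ_ignore_initial_segment)
  have "(\<lambda>i. \<integral>x. (q (Y i) x - q t x) / (Y i - t) \<partial>M) \<longlonglongrightarrow> (\<integral>x. q' x \<partial>M)"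
  proof (rule integral_dominated_convergence[where w = w])
    show "(\<lambda>x. (q (Y i) x - q t x) / (Y i - t)) \<in> borel_measurable M" for i
      using int[of "Y i"] int[of t] Y t by (auto intro!: borel_measurable_divide borel_measurable_diff)
    show "AE x in M. (\<lambda>i. (q (Y i) x - q t x) / (Y i - t)) \<longlonglongrightarrow> q' x"
      using der
    proof eventually_elim
      case (elim x)
      then show ?case
        using Y Ylim unfolding has_field_derivative_iff tendsto_at_iff_sequentially comp_def by auto
    qed
    show "AE x in M. norm ((q (Y i) x - q t x) / (Y i - t)) \<le> w x" for i
      using lip[of "Y i"] Y by (intro AE_I2) (simp add: abs_divide divide_le_eq)
  qed (use q' w in auto)
  also have "(\<lambda>i. \<integral>x. (q (Y i) x - q t x) / (Y i - t) \<partial>M) =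
      (\<lambda>i. ((\<integral>x. q (Y i) x \<partial>M) - (\<integral>x. q t x \<partial>M)) / (Y i - t))"
    using int Y t by auto
  finally have "(\<lambda>i. ((\<integral>x. q (X (i + N)) x \<partial>M) - (\<integral>x. q t x \<partial>M)) / (X (i + N) - t)) \<longlonglongrightarrow> (\<integral>x. q' x \<partial>M)"
    unfolding Y_def .
  then show "(\<lambda>i. ((\<integral>x. q (X i) x \<partial>M) - (\<integral>x. q t x \<partial>M)) / (X i - t)) \<longlonglongrightarrow> (\<integral>x. q' x \<partial>M)"
    by (rule LIMSEQ_offset)
qed

text \<open>The everyday version: the mean value inequality turns a bound on the derivative into the
  Lipschitz domination.\<close>

lemma has_real_derivative_integral:
  fixes q :: "real \<Rightarrow> 'b \<Rightarrow> real"
  assumes t: "a < t" "t < b"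
    and int: "\<And>s. a < s \<Longrightarrow> s < b \<Longrightarrow> integrable M (q s)"
    and der: "\<And>s x. a < s \<Longrightarrow> s < b \<Longrightarrow> x \<in> space M \<Longrightarrow>
                 ((\<lambda>s. q s x) has_real_derivative q' s x) (at s)"
    and q': "q' t \<in> borel_measurable M"
    and bd: "\<And>s x. a < s \<Longrightarrow> s < b \<Longrightarrow> x \<in> space M \<Longrightarrow> \<bar>q' s x\<bar> \<le> w x"
    and w: "integrable M w"
  shows "((\<lambda>s. \<integral>x. q s x \<partial>M) has_real_derivative (\<integral>x. q' t x \<partial>M)) (at t)"
proof (rule has_real_derivative_integral_lipschitz[where a = a and b = b and w = w])
  show "\<bar>q s x - q t x\<bar> \<le> w x * \<bar>s - t\<bar>" if s: "a < s" "s < b" and x: "x \<in> space M" for s x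
  proof -
    have "norm (q s x - q t x) \<le> w x * norm (s - t)"
    proof (rule field_differentiable_bound[where S = "{a<..<b}" and f = "\<lambda>s. q s x"])
      show "((\<lambda>s. q s x) has_field_derivative q' z x) (at z within {a<..<b})" if "z \<in> {a<..<b}" for z
        using der[of z x] that x by (auto intro: has_field_derivative_at_within)
      show "norm (q' z x) \<le> w x" if "z \<in> {a<..<b}" for z
        using bd[of z x] that x by auto
    qed (use s t in auto)
    then show ?thesis by simp
  qed
qed (use assms in auto)

section \<open>Iterated forward differences\<close>

definition forward_diff :: "real \<Rightarrow> (real \<Rightarrow> real) \<Rightarrow> real \<Rightarrow> real" where
  "forward_diff a g s = g (s + a) - g s"

text \<open>The differences \<open>forward_diff a (g i)\<close> again form a chain of derivatives,
  on an interval shorter by \<open>a\<close>, so the induction peels off the innermost difference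
  and ends with one mean value step. If the last member of the chain is constant the result is an
  exact value; if it is bounded and continuous the result gives domination and convergence of the
  difference quotients. Both uses occur below.\<close>

lemma forward_diff_mean_value:
  assumes a: "a > 0"
    and "\<And>i s. i < m \<Longrightarrow> s0 \<le> s \<Longrightarrow> s \<le> s0 + m * a \<Longrightarrow> (g i has_real_derivative g (Suc i) s) (at s)"
  shows "\<exists>\<xi>. s0 \<le> \<xi> \<and> \<xi> \<le> s0 + m * a \<and> (forward_diff a ^^ m) (g 0) s0 = a ^ m * g m \<xi>"
  using assms(2)
proof (induction m arbitrary: g)
  case 0
  show ?case by (auto intro!: exI[of _ s0])
next
  case (Suc m)
  have "\<exists>\<xi>. s0 \<le> \<xi> \<and> \<xi> \<le> s0 + m * a \<and>
      (forward_diff a ^^ m) (forward_diff a (g 0)) s0 = a ^ m * forward_diff a (g m) \<xi>"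
  proof (rule Suc.IH[of "\<lambda>i. forward_diff a (g i)"])
    fix i s assume *: "i < m" "s0 \<le> s" "s \<le> s0 + m * a"
    have "(g i has_real_derivative g (Suc i) (s + a)) (at (s + a))"
      using * a by (intro Suc.prems) (auto simp: algebra_simps)
    moreover have "(g i has_real_derivative g (Suc i) s) (at s)"
      using * a by (intro Suc.prems) (auto simp: algebra_simps intro: order_trans)
    ultimately show "(forward_diff a (g i) has_real_derivative forward_diff a (g (Suc i)) s) (at s)"
      unfolding forward_diff_def[abs_def] by (auto intro!: derivative_intros simp: DERIV_shift)
  qed
  then obtain \<xi> where \<xi>: "s0 \<le> \<xi>" "\<xi> \<le> s0 + m * a"
      "(forward_diff a ^^ m) (forward_diff a (g 0)) s0 = a ^ m * forward_diff a (g m) \<xi>" by blast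
  have "\<exists>z. \<xi> < z \<and> z < \<xi> + a \<and> g m (\<xi> + a) - g m \<xi> = (\<xi> + a - \<xi>) * g (Suc m) z"
    using \<xi> a by (intro MVT2 Suc.prems) (auto simp: algebra_simps)
  then obtain z where "\<xi> < z" "z < \<xi> + a" "g m (\<xi> + a) - g m \<xi> = a * g (Suc m) z" by auto
  moreover have "(forward_diff a ^^ Suc m) (g 0) s0 = a ^ Suc m * g (Suc m) z"
    using \<xi>(3) calculation(3) by (simp add: funpow_Suc_right forward_diff_def del: funpow.simps)
  ultimately show ?case
    using \<xi>(1,2) by (intro exI[of _ z]) (auto simp: algebra_simps)
qed

lemma abs_forward_diff_funpow_le:
  assumes "\<And>s. \<bar>g s\<bar> \<le> B"
  shows "\<bar>(forward_diff a ^^ m) g s\<bar> \<le> 2 ^ m * B"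
proof (induction m arbitrary: s)
  case 0 show ?case using assms by simp
next
  case (Suc m)
  from Suc[of s] Suc[of "s + a"] show ?case by (simp add: forward_diff_def)
qed

lemma integral_forward_diff_funpow:
  assumes "\<And>s. integrable M (\<lambda>x. q x s)"
  shows "integrable M (\<lambda>x. (forward_diff a ^^ m) (q x) s)"
    and "(\<integral>x. (forward_diff a ^^ m) (q x) s \<partial>M) = (forward_diff a ^^ m) (\<lambda>s. \<integral>x. q x s \<partial>M) s"
proof -
  have "integrable M (\<lambda>x. (forward_diff a ^^ m) (q x) s) \<and>
     (\<integral>x. (forward_diff a ^^ m) (q x) s \<partial>M) = (forward_diff a ^^ m) (\<lambda>s. \<integral>x. q x s \<partial>M) s"
  proof (induction m arbitrary: s)
    case 0 show ?case using assms by simp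
  next
    case (Suc m)
    from Suc[of s] Suc[of "s + a"] show ?case by (simp add: forward_diff_def)
  qed
  then show "integrable M (\<lambda>x. (forward_diff a ^^ m) (q x) s)"
    and "(\<integral>x. (forward_diff a ^^ m) (q x) s \<partial>M) = (forward_diff a ^^ m) (\<lambda>s. \<integral>x. q x s \<partial>M) s" by auto
qed

subsection \<open>Surface measure and polar coordinates\<close>

lemma space_sphere_measure [simp]:
  "space (sphere_measure :: 'a::euclidean_space measure) = sphere 0 1"
  by (simp add: sphere_measure_def space_scale_measure space_restrict_space)

lemma sets_sphere_measure [measurable_cong]:
  "sets (sphere_measure :: 'a::euclidean_space measure) = sets (restrict_space borel (sphere 0 1))"
  by (simp add: sphere_measure_def)

lemma sphere_area_nonneg: "n > 0 \<Longrightarrow> sphere_area n \<ge> 0"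
  by (simp add: sphere_area_def)

lemma sphere_area_pos: "n > 0 \<Longrightarrow> sphere_area n > 0"
  by (simp add: sphere_area_def)

lemma finite_measure_sphere_measure: "finite_measure (sphere_measure :: 'a::euclidean_space measure)"
proof
  have "emeasure (sphere_measure :: 'a measure) (sphere 0 1) \<noteq> \<infinity>"
  proof
    assume "emeasure (sphere_measure :: 'a measure) (sphere 0 1) = \<infinity>"
    then have "measure (sphere_measure :: 'a measure) (sphere 0 1) = 0" by (simp add: measure_def)
    then show False using sphere_area_pos[of "DIM('a)"] by (simp add: measure_sphere_measure_space)
  qed
  then show "emeasure sphere_measure (space (sphere_measure :: 'a measure)) \<noteq> \<infinity>" by simp
qed

interpretation sphere: finite_measure "sphere_measure :: 'a::euclidean_space measure"
  by (rule finite_measure_sphere_measure)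

lemma sphere_area_eq_unit_ball_vol: "n > 0 \<Longrightarrow> sphere_area n = n * unit_ball_vol n"
proof -
  assume n: "n > 0"
  then have "real n / 2 \<notin> \<int>\<^sub>\<le>\<^sub>0" using nonpos_Ints_nonpos[of "real n / 2"] by auto
  then show ?thesis using n by (simp add: sphere_area_def unit_ball_vol_def Gamma_plus1)
qed

lemma integrable_sphere_measure_continuous:
  fixes g :: "'a::euclidean_space \<Rightarrow> real"
  assumes "continuous_on (sphere 0 1) g"
  shows "integrable sphere_measure g"
proof -
  have "compact (g ` sphere 0 1)"
    using assms by (intro compact_continuous_image) auto
  then obtain B where B: "\<forall>x\<in>sphere 0 1. \<bar>g x\<bar> \<le> B"
    by (auto dest!: compact_imp_bounded simp: bounded_iff)
  show ?thesis
  proof (rule sphere.integrable_const_bound[where B = B])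
    show "AE x in sphere_measure. norm (g x) \<le> B" using B by (auto intro!: AE_I2)
    show "g \<in> borel_measurable sphere_measure"
      using borel_measurable_continuous_on_restrict[OF assms]
      by (simp cong: measurable_cong_sets add: sets_sphere_measure)
  qed
qed

lemma integral_sphere_measure:
  fixes g :: "'a::euclidean_space \<Rightarrow> real"
  assumes "g \<in> borel_measurable sphere_measure"
  shows "(\<integral>\<sigma>. g \<sigma> \<partial>sphere_measure) =
           DIM('a) * (\<integral>z. indicator (ball 0 1 - {0}) z * g (sgn z) \<partial>lborel)"
proof -
  let ?D = "distr (restrict_space lborel (ball 0 1 - {0})) (restrict_space borel (sphere 0 1)) sgn :: 'a measure"
  have g: "g \<in> borel_measurable (restrict_space borel (sphere 0 1))"
    using assms by (simp cong: measurable_cong_sets add: sets_sphere_measure)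
  \<comment> \<open>The scaling factor becomes a constant density, which can be pulled out of a
    Bochner integral.\<close>
  have eq: "sphere_measure = density ?D (\<lambda>_. ennreal (real DIM('a)))"
    unfolding sphere_measure_def
    by (rule measure_eqI) (auto simp: emeasure_density_const ennreal_of_nat_eq_real_of_nat)
  have "(\<integral>\<sigma>. g \<sigma> \<partial>sphere_measure) = (\<integral>\<sigma>. DIM('a) * g \<sigma> \<partial>?D)"
    unfolding eq using g by (subst integral_density) auto
  also have "\<dots> = DIM('a) * (\<integral>\<sigma>. g \<sigma> \<partial>?D)" by simp
  also have "(\<integral>\<sigma>. g \<sigma> \<partial>?D) = (\<integral>z. g (sgn z) \<partial>restrict_space lborel (ball 0 1 - {0}))"
    by (rule integral_distr[OF sgn_measurable_sphere g])
  also have "\<dots> = (\<integral>z. indicator (ball 0 1 - {0}) z * g (sgn z) \<partial>lborel)"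
    by (subst integral_restrict_space) auto
  finally show ?thesis .
qed

lemma integral_lborel_affine:
  fixes F :: "'a::euclidean_space \<Rightarrow> real"
  assumes [measurable]: "F \<in> borel_measurable borel" and c: "c \<noteq> 0"
  shows "(\<integral>z. F z \<partial>lborel) = \<bar>c\<bar> ^ DIM('a) * (\<integral>z. F (t + c *\<^sub>R z) \<partial>lborel)"
  by (subst lborel_affine[OF c, of t]) (simp add: integral_density integral_distr)

lemma integrable_lborel_affine:
  fixes F :: "'a::euclidean_space \<Rightarrow> real"
  assumes [measurable]: "F \<in> borel_measurable borel" and c: "c \<noteq> 0"
    and "integrable lborel F"
  shows "integrable lborel (\<lambda>z. F (t + c *\<^sub>R z))"
proof -
  have "integrable (density (distr lborel borel (\<lambda>x. t + c *\<^sub>R x)) (\<lambda>_. \<bar>c\<bar> ^ DIM('a))) F"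
    using assms(3) lborel_affine[OF c, of t] by simp
  then have "integrable lborel (\<lambda>x. \<bar>c\<bar> ^ DIM('a) * F (t + c *\<^sub>R x))"
    by (simp add: integrable_density integrable_distr_eq)
  then show ?thesis using c by simp
qed

lemma integrable_bounded_on_ball:
  fixes F :: "'a::euclidean_space \<Rightarrow> real"
  assumes [measurable]: "F \<in> borel_measurable borel" and B: "\<And>z. z \<in> cball 0 r \<Longrightarrow> \<bar>F z\<bar> \<le> B"
    and A[measurable]: "A \<in> sets borel" "A \<subseteq> cball 0 r"
  shows "integrable lborel (\<lambda>z. indicator A z * F z)"
proof (rule Bochner_Integration.integrable_bound[where f = "\<lambda>z. indicator (cball 0 r) z * B"])
  show "integrable lborel (\<lambda>z. indicator (cball 0 r) z * B :: real)"
    by (intro integrable_mult_left integrable_real_indicator) (auto simp: emeasure_lborel_cball_finite[unfolded infinity_ennreal_def])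
  show "AE x in lborel. norm (indicator A x * F x) \<le> norm (indicator (cball 0 r) x * B)"
    using A(2) B by (intro AE_I2) (auto simp: indicator_def split: if_splits intro: order_trans[OF _ abs_ge_self])
qed simp

text \<open>The integrand is homogeneous of degree 0, so scaling by \<open>r\<close> only produces
  the factor \<open>r ^ DIM('a)\<close>; on the unit ball the claim is the definition of the surface
  measure.\<close>

lemma integral_ball_compose_sgn:
  fixes G :: "'a::euclidean_space \<Rightarrow> real"
  assumes G: "G \<in> borel_measurable sphere_measure" and r: "r > 0"
  shows "(\<integral>z. indicator (ball 0 r - {0}) z * G (sgn z) \<partial>lborel) =
           r ^ DIM('a) / DIM('a) * (\<integral>\<sigma>. G \<sigma> \<partial>sphere_measure)"
proof -
  have G': "G \<in> borel_measurable (restrict_space borel (sphere 0 1))"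
    using G by (simp cong: measurable_cong_sets add: sets_sphere_measure)
  have sgn1: "sgn \<in> measurable (restrict_space borel (- {0::'a})) (restrict_space borel (sphere 0 1))"
  proof (rule measurable_restrict_space2)
    have "(sgn :: 'a \<Rightarrow> 'a) \<in> borel_measurable borel" unfolding sgn_div_norm by measurable
    then show "sgn \<in> borel_measurable (restrict_space borel (- {0::'a}))"
      by (rule measurable_restrict_space1)
  qed (auto simp: space_restrict_space norm_sgn)
  \<comment> \<open>\<open>G\<close> is controlled on the sphere only, and \<open>sgn 0 = 0\<close>
    is not on it. Measurability is therefore shown off the origin and extended by zero.\<close>
  have "(\<lambda>z. G (sgn z)) \<in> borel_measurable (restrict_space borel (- {0::'a}))"
    using measurable_comp[OF sgn1 G'] by (simp add: comp_def)
  then have m1: "(\<lambda>z. indicator (- {0}) z *\<^sub>R G (sgn z)) \<in> borel_measurable borel"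
    by (subst (asm) borel_measurable_restrict_space_iff) auto
  have "(\<lambda>z. indicator (ball 0 r) z * (indicator (- {0}) z *\<^sub>R G (sgn z))) \<in> borel_measurable borel"
    using m1 by (intro borel_measurable_times borel_measurable_indicator) auto
  also have "(\<lambda>z. indicator (ball 0 r) z * (indicator (- {0}) z *\<^sub>R G (sgn z))) =
      (\<lambda>z. indicator (ball 0 r - {0}) z * G (sgn z))" by (auto simp: indicator_def)
  finally have m: "(\<lambda>z. indicator (ball 0 r - {0}) z * G (sgn z)) \<in> borel_measurable borel" .
  have "(\<integral>z. indicator (ball 0 r - {0}) z * G (sgn z) \<partial>lborel) =
      r ^ DIM('a) * (\<integral>z. indicator (ball 0 r - {0}) (0 + r *\<^sub>R z) * G (sgn (0 + r *\<^sub>R z)) \<partial>lborel)"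
    using r by (subst integral_lborel_affine[OF m, of r 0]) auto
  also have "(\<integral>z. indicator (ball 0 r - {0}) (0 + r *\<^sub>R z) * G (sgn (0 + r *\<^sub>R z)) \<partial>lborel) =
      (\<integral>z. indicator (ball 0 1 - {0}) z * G (sgn z) \<partial>lborel)"
    using r by (intro Bochner_Integration.integral_cong)
      (auto simp: indicator_def sgn_scaleR mult_less_cancel_left2)
  also have "\<dots> = (\<integral>\<sigma>. G \<sigma> \<partial>sphere_measure) / DIM('a)"
    using integral_sphere_measure[OF G] by simp
  finally show ?thesis by simp
qed

lemma integral_ball_minus_origin:
  fixes F :: "'a::euclidean_space \<Rightarrow> real"
  assumes [measurable]: "F \<in> borel_measurable borel"
  shows "(\<integral>z. indicator (ball 0 r - {0}) z * F z \<partial>lborel) = (\<integral>z. indicator (ball 0 r) z * F z \<partial>lborel)"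
proof (rule integral_cong_AE)
  have "AE z in lborel. z \<noteq> (0::'a)" by (rule AE_lborel_singleton)
  then show "AE x in lborel. indicator (ball 0 r - {0}) x * F x = indicator (ball 0 r) x * F x"
    by eventually_elim (auto simp: indicator_def)
qed (auto intro!: borel_measurable_times borel_measurable_indicator)

lemma abs_power_diff_le:
  fixes x y B :: real
  assumes "0 \<le> x" "x \<le> B" "0 \<le> y" "y \<le> B"
  shows "\<bar>x ^ k - y ^ k\<bar> \<le> k * B ^ (k - 1) * \<bar>x - y\<bar>"
proof -
  have "norm (x ^ k - y ^ k) \<le> (k * B ^ (k - 1)) * norm (x - y)"
  proof (rule field_differentiable_bound[where S = "{0..B}" and f = "\<lambda>x. x ^ k"])
    show "((\<lambda>x. x ^ k) has_field_derivative k * z ^ (k - 1)) (at z within {0..B})" for z :: real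
      by (auto intro!: derivative_eq_intros)
    show "norm (k * z ^ (k - 1)) \<le> k * B ^ (k - 1)" if "z \<in> {0..B}" for z :: real
      using that power_mono[of z B "k - 1"] by (auto simp: abs_mult intro!: mult_left_mono)
  qed (use assms in auto)
  then show ?thesis by simp
qed

text \<open>Polar coordinates in differential form: on a thin shell around radius \<open>t\<close>,
  \<open>g z\<close> is uniformly close to \<open>g (t *\<^sub>R sgn z)\<close>, whose integral is an explicit multiple of \<open>r ^ n\<close>.\<close>

lemma has_real_derivative_integral_ball:
  fixes g :: "'a::euclidean_space \<Rightarrow> real"
  assumes g: "continuous_on UNIV g" and t: "t > 0"
  shows "((\<lambda>r. \<integral>z. indicator (ball 0 r) z * g z \<partial>lborel) has_real_derivative
            t ^ (DIM('a) - 1) * (\<integral>\<sigma>. g (t *\<^sub>R \<sigma>) \<partial>sphere_measure)) (at t)"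
proof -
  let ?n = "DIM('a)"
  define A where "A = (\<integral>\<sigma>. g (t *\<^sub>R \<sigma>) \<partial>(sphere_measure :: 'a measure))"
  define J where "J = (\<lambda>r. \<integral>z. indicator (ball 0 r) z * g z \<partial>lborel)"
  define h where "h = (\<lambda>z. g z - g (t *\<^sub>R sgn z))"
  define R where "R = (\<lambda>r. \<integral>z. indicator (ball 0 r - {0}) z * h z \<partial>lborel)"
  define v where "v = unit_ball_vol (real ?n)"
  have v: "v > 0" by (simp add: v_def)
  have gm[measurable]: "g \<in> borel_measurable borel" using g by (rule borel_measurable_continuous_onI)
  have sm[measurable]: "(sgn :: 'a \<Rightarrow> 'a) \<in> borel_measurable borel" unfolding sgn_div_norm by measurable
  have hm[measurable]: "h \<in> borel_measurable borel" unfolding h_def by measurable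
  define M where "M = cball (0::'a) (2 * t)"
  have "compact (g ` M)" unfolding M_def
    by (intro compact_continuous_image continuous_on_subset[OF g]) auto
  then have "bounded (g ` M)" by (rule compact_imp_bounded)
  then obtain B where B: "\<And>x. x \<in> M \<Longrightarrow> \<bar>g x\<bar> \<le> B"
    unfolding bounded_iff by (metis imageI real_norm_def)
  have sgnM: "t *\<^sub>R sgn z \<in> M" for z
    using t by (auto simp: M_def norm_sgn)
  have gint: "integrable lborel (\<lambda>z. indicator S z * g z)" if "S \<in> sets borel" "S \<subseteq> M" for S
    using that B by (intro integrable_bounded_on_ball[where r = "2*t" and B = B]) (auto simp: M_def)
  have gsint: "integrable lborel (\<lambda>z. indicator S z * g (t *\<^sub>R sgn z))" if "S \<in> sets borel" "S \<subseteq> M" for S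
    using that B sgnM by (intro integrable_bounded_on_ball[where r = "2*t" and B = B]) (auto simp: M_def)
  have hint: "integrable lborel (\<lambda>z. indicator S z * h z)" if "S \<in> sets borel" "S \<subseteq> M" for S
    using Bochner_Integration.integrable_diff[OF gint[OF that] gsint[OF that]] by (simp add: h_def algebra_simps)
  have J: "J r = R r + r ^ ?n / ?n * A" if r: "0 < r" "r < 2 * t" for r
  proof -
    have S: "ball 0 r - {0} \<in> sets borel" "ball 0 r - {0} \<subseteq> M" using r by (auto simp: M_def)
    have "(\<lambda>\<sigma>. g (t *\<^sub>R \<sigma>)) \<in> borel_measurable (sphere_measure :: 'a measure)"
      by (intro borel_measurable_integrable integrable_sphere_measure_continuous continuous_on_compose2[OF g])
         (auto intro!: continuous_intros)
    from integral_ball_compose_sgn[OF this r(1)]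
    have "(\<integral>z. indicator (ball 0 r - {0}) z * g (t *\<^sub>R sgn z) \<partial>lborel) = r ^ ?n / ?n * A"
      by (simp add: A_def)
    moreover have "J r = (\<integral>z. indicator (ball 0 r - {0}) z * g z \<partial>lborel)"
      unfolding J_def by (rule integral_ball_minus_origin[symmetric]) simp
    moreover have "R r = (\<integral>z. indicator (ball 0 r - {0}) z * g z \<partial>lborel) -
       (\<integral>z. indicator (ball 0 r - {0}) z * g (t *\<^sub>R sgn z) \<partial>lborel)"
      unfolding R_def h_def using gint[OF S] gsint[OF S]
      by (simp add: algebra_simps)
    ultimately show ?thesis by simp
  qed
  \<comment> \<open>Only increments of \<open>R\<close> matter. Between two radii they are bounded
    by the size of \<open>h\<close> on the shell times the volume of the shell, and
    \<open>pw\<close> below makes that volume of first order in the thickness.\<close>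
  have Rdiff: "\<bar>R s - R r\<bar> \<le> \<eta> * (v * (s ^ ?n - r ^ ?n))"
    if rs: "0 < r" "r \<le> s" "s < 2 * t" and \<eta>: "\<And>z. r \<le> norm z \<Longrightarrow> norm z < s \<Longrightarrow> \<bar>h z\<bar> \<le> \<eta>" for r s \<eta>
  proof -
    let ?S = "ball 0 s - ball (0::'a) r"
    have "R s - R r = (\<integral>z. indicator (ball 0 s - {0}) z * h z - indicator (ball 0 r - {0}) z * h z \<partial>lborel)"
      unfolding R_def using rs by (intro Bochner_Integration.integral_diff[symmetric] hint) (auto simp: M_def)
    also have "\<dots> = (\<integral>z. indicator ?S z * h z \<partial>lborel)"
      using rs by (intro Bochner_Integration.integral_cong) (auto simp: indicator_def)
    also have "\<bar>\<dots>\<bar> \<le> (\<integral>z. indicator ?S z * \<eta> \<partial>lborel)"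
    proof -
      have "emeasure lborel ?S < \<infinity>"
        by (rule le_less_trans[OF emeasure_mono[of _ "ball 0 s"] emeasure_lborel_ball_finite]) auto
      then show ?thesis
        using rs \<eta> by (intro integral_abs_bound[THEN order_trans] integral_mono hint integrable_abs
           integrable_mult_left integrable_real_indicator) (auto simp: M_def indicator_def)
    qed
    also have "\<dots> = \<eta> * measure lborel ?S" by simp
    also have "measure lborel ?S = measure lborel (ball (0::'a) s) - measure lborel (ball (0::'a) r)"
      using rs by (intro measure_Diff) (auto simp: emeasure_lborel_ball_finite[THEN less_imp_neq, unfolded infinity_ennreal_def])
    also have "\<dots> = v * (s ^ ?n - r ^ ?n)"
      using rs by (simp add: content_ball v_def algebra_simps)
    finally show ?thesis .
  qed
  define C where "C = ?n * (2 * t) ^ (?n - 1)"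
  have C: "C > 0" using t by (simp add: C_def)
  have pw: "\<bar>s ^ ?n - t ^ ?n\<bar> \<le> C * \<bar>s - t\<bar>" if "0 < s" "s < 2 * t" for s
    using abs_power_diff_le[of s "2 * t" t ?n] that t by (simp add: C_def)
  have "(R has_real_derivative 0) (at t)"
    unfolding has_field_derivative_iff
  proof (rule tendstoI)
    fix e :: real assume e: "e > 0"
    \<comment> \<open>Chosen so that \<open>\<eta> * v * C = e / 2\<close>, which leaves room for a
      strict inequality.\<close>
    define \<eta> where "\<eta> = e / (2 * v * C)"
    have \<eta>: "\<eta> > 0" using e v C by (simp add: \<eta>_def)
    have "uniformly_continuous_on M g" unfolding M_def
      by (intro compact_uniformly_continuous continuous_on_subset[OF g]) auto
    then obtain d where d: "d > 0" "\<And>x y. x \<in> M \<Longrightarrow> y \<in> M \<Longrightarrow> dist y x < d \<Longrightarrow> dist (g y) (g x) < \<eta>"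
      unfolding uniformly_continuous_on_def using \<eta> by metis
    \<comment> \<open>\<open>z\<close> and \<open>t *\<^sub>R sgn z\<close> lie on one ray, so their
      distance is the difference of their radii and uniform continuity applies.\<close>
    have hb: "\<bar>h z\<bar> \<le> \<eta>" if "z \<in> M" "\<bar>norm z - t\<bar> < d" "z \<noteq> 0" for z
    proof -
      have "z - t *\<^sub>R sgn z = (norm z - t) *\<^sub>R sgn z"
        using that by (simp add: sgn_div_norm algebra_simps)
      then have "dist z (t *\<^sub>R sgn z) < d"
        using that by (simp add: dist_norm norm_sgn)
      from d(2)[OF sgnM that(1) this] show ?thesis by (simp add: h_def dist_real_def)
    qed
    have ev: "\<forall>\<^sub>F s in at t. s \<in> {max 0 (t - d)<..<min (2*t) (t+d)} \<and> s \<noteq> t"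
      using t d by (intro eventually_conj eventually_at_in_open' eventually_neq_at_within) auto
    then show "\<forall>\<^sub>F s in at t. dist ((R s - R t) / (s - t)) 0 < e"
    proof eventually_elim
      case (elim s)
      have "\<bar>R s - R t\<bar> \<le> \<eta> * (v * \<bar>s ^ ?n - t ^ ?n\<bar>)"
      proof (cases "t \<le> s")
        case True
        have "\<bar>R s - R t\<bar> \<le> \<eta> * (v * (s ^ ?n - t ^ ?n))"
          using elim t True by (intro Rdiff hb) (auto simp: M_def)
        moreover have "t ^ ?n \<le> s ^ ?n" using True t by (intro power_mono) auto
        ultimately show ?thesis by simp
      next
        case False
        have "\<bar>R t - R s\<bar> \<le> \<eta> * (v * (t ^ ?n - s ^ ?n))"
          using elim t False by (intro Rdiff hb) (auto simp: M_def)
        moreover have "s ^ ?n \<le> t ^ ?n" using False elim by (intro power_mono) auto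
        ultimately show ?thesis by (simp add: abs_minus_commute)
      qed
      also have "\<dots> \<le> \<eta> * (v * (C * \<bar>s - t\<bar>))"
        using elim \<eta> v by (intro mult_left_mono pw) auto
      also have "\<dots> = e / 2 * \<bar>s - t\<bar>" using v C by (simp add: \<eta>_def)
      also have "\<dots> < e * \<bar>s - t\<bar>" using elim e by simp
      finally have "\<bar>R s - R t\<bar> < e * \<bar>s - t\<bar>" .
      then show ?case using elim by (simp add: divide_less_eq)
    qed
  qed
  then have "((\<lambda>r. R r + r ^ ?n / ?n * A) has_real_derivative t ^ (?n - 1) * A) (at t)"
    by (auto intro!: derivative_eq_intros)
  moreover have "\<forall>\<^sub>F r in nhds t. J r = R r + r ^ ?n / ?n * A"
    using t by (intro eventually_mono[OF eventually_nhds_in_open[of "{0<..<2*t}" t]]) (auto simp: J)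
  ultimately have "(J has_real_derivative t ^ (?n - 1) * A) (at t)"
    by (subst DERIV_cong_ev[OF refl _ refl]) auto
  then show ?thesis by (simp add: J_def A_def)
qed

subsection \<open>Spherical caps\<close>

text \<open>Fubini with the coordinate along \<open>b\<close> singled out: the slice at height
  \<open>q\<close> is a ball of radius \<open>sqrt (r\<^sup>2 - q\<^sup>2)\<close> in dimension 2 m
  + 2. This dimension is even, so the volume of the slice is a polynomial in \<open>q\<close>; here
  the odd dimension of the space is used.\<close>

lemma nn_integral_cball_slices:
  fixes b :: "'a::euclidean_space" and G :: "real \<Rightarrow> real"
  assumes b: "b \<in> Basis" and [measurable]: "G \<in> borel_measurable borel" and G: "\<And>q. G q \<ge> 0" and r: "r > 0"
    and n: "DIM('a) = 2 * m + 3"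
  shows "(\<integral>\<^sup>+z. ennreal (indicator (cball 0 r) z * G (z \<bullet> b)) \<partial>lborel) =
    (\<integral>\<^sup>+q. ennreal (indicator {-r..r} q * G q * (unit_ball_vol (2 * m + 2) * (r\<^sup>2 - q\<^sup>2) ^ (m + 1))) \<partial>lborel)"
proof -
  define A where "A = Basis - {b}"
  have A: "finite A" "b \<notin> A" "Basis = insert b A" using b by (auto simp: A_def)
  have cardA: "card A = 2 * m + 2" using n b by (simp add: A_def)
  interpret product_sigma_finite "\<lambda>_. lborel :: real measure" by standard
  let ?P = "\<lambda>I. Pi\<^sub>M I (\<lambda>_. lborel :: real measure)"
  let ?F = "\<lambda>z::'a. ennreal (indicator (cball 0 r) z * G (z \<bullet> b))"
  have [measurable]: "(\<lambda>z. indicator (cball 0 r) z * G (z \<bullet> b)) \<in> borel_measurable borel"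
    by (intro borel_measurable_times borel_measurable_indicator) simp_all
  let ?S = "\<lambda>s. {f. sqrt (\<Sum>i\<in>A. (f i)\<^sup>2) \<le> s} \<inter> space (?P A)"
  have "(\<integral>\<^sup>+z. ?F z \<partial>lborel) = (\<integral>\<^sup>+f. ?F (\<Sum>b\<in>Basis. f b *\<^sub>R b) \<partial>?P Basis)"
    by (subst lborel_eq, subst nn_integral_distr) auto
  also have "\<dots> = (\<integral>\<^sup>+f. ?F (\<Sum>c\<in>insert b A. f c *\<^sub>R c) \<partial>?P (insert b A))"
    unfolding A(3) ..
  also have "\<dots> = (\<integral>\<^sup>+y. \<integral>\<^sup>+f. ?F (\<Sum>c\<in>insert b A. (f(b := y)) c *\<^sub>R c) \<partial>?P A \<partial>lborel)"
    using A by (subst product_nn_integral_insert_rev) auto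
  also have "\<dots> = (\<integral>\<^sup>+y. \<integral>\<^sup>+f. ennreal (indicator {-r..r} y * G y) * indicator (?S (sqrt (r\<^sup>2 - y\<^sup>2))) f \<partial>?P A \<partial>lborel)"
  proof (intro nn_integral_cong)
    fix y :: real and f :: "'a \<Rightarrow> real" assume f: "f \<in> space (?P A)"
    let ?z = "\<Sum>c\<in>insert b A. (f(b := y)) c *\<^sub>R c"
    have zb: "?z \<bullet> b = y"
      using inner_sum_left_Basis[OF b, of "f(b := y)"] unfolding A(3) by simp
    have "(\<Sum>c\<in>A. ((f(b := y)) c)\<^sup>2) = (\<Sum>c\<in>A. (f c)\<^sup>2)"
      using A by (intro sum.cong) auto
    then have nz: "(norm ?z)\<^sup>2 = y\<^sup>2 + (\<Sum>c\<in>A. (f c)\<^sup>2)"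
    proof -
      have "(norm ?z)\<^sup>2 = (\<Sum>c\<in>Basis. (?z \<bullet> c)\<^sup>2)"
        unfolding power2_norm_eq_inner by (subst euclidean_inner) (simp add: power2_eq_square)
      also have "\<dots> = (\<Sum>c\<in>Basis. ((f(b := y)) c)\<^sup>2)"
        unfolding A(3)[symmetric] by (intro sum.cong refl) (simp only: inner_sum_left_Basis)
      also have "\<dots> = y\<^sup>2 + (\<Sum>c\<in>A. ((f(b := y)) c)\<^sup>2)"
        unfolding A(3) using A(1,2) by simp
      finally show ?thesis using \<open>(\<Sum>c\<in>A. ((f(b := y)) c)\<^sup>2) = (\<Sum>c\<in>A. (f c)\<^sup>2)\<close> by simp
    qed
    have s0: "(\<Sum>c\<in>A. (f c)\<^sup>2) \<ge> 0" by (intro sum_nonneg) auto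
    have "norm ?z \<le> r \<longleftrightarrow> y\<^sup>2 + (\<Sum>c\<in>A. (f c)\<^sup>2) \<le> r\<^sup>2"
      unfolding nz[symmetric] using r by (simp add: abs_le_square_iff[symmetric])
    also have "\<dots> \<longleftrightarrow> (-r \<le> y \<and> y \<le> r) \<and> sqrt (\<Sum>c\<in>A. (f c)\<^sup>2) \<le> sqrt (r\<^sup>2 - y\<^sup>2)"
    proof -
      have "y\<^sup>2 \<le> r\<^sup>2 \<longleftrightarrow> -r \<le> y \<and> y \<le> r" using r by (auto simp: abs_le_square_iff[symmetric])
      then show ?thesis using s0 by auto
    qed
    finally show "?F ?z = ennreal (indicator {-r..r} y * G y) * indicator (?S (sqrt (r\<^sup>2 - y\<^sup>2))) f"
      using zb f by (simp add: indicator_def)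
  qed
  also have "\<dots> = (\<integral>\<^sup>+y. ennreal (indicator {-r..r} y * G y) * emeasure (?P A) (?S (sqrt (r\<^sup>2 - y\<^sup>2))) \<partial>lborel)"
    using A(1) by (intro nn_integral_cong, subst nn_integral_cmult_indicator) auto
  also have "\<dots> = (\<integral>\<^sup>+q. ennreal (indicator {-r..r} q * G q * (unit_ball_vol (2 * m + 2) * (r\<^sup>2 - q\<^sup>2) ^ (m + 1))) \<partial>lborel)"
  proof (intro nn_integral_cong_AE)
    \<comment> \<open>At the two poles the slice has radius 0, which the volume formula for balls
      does not cover.\<close>
    have "AE y in lborel. y \<notin> {-r, r}"
      by (intro AE_not_in countable_imp_null_set_lborel) auto
    then show "AE y in lborel. ennreal (indicator {-r..r} y * G y) * emeasure (?P A) (?S (sqrt (r\<^sup>2 - y\<^sup>2))) =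
      ennreal (indicator {-r..r} y * G y * (unit_ball_vol (2 * m + 2) * (r\<^sup>2 - y\<^sup>2) ^ (m + 1)))"
    proof eventually_elim
      case (elim y)
      show ?case
      proof (cases "y \<in> {-r..r}")
        case True
        then have y: "y\<^sup>2 < r\<^sup>2" using elim r abs_square_less_1 by (intro power2_strict_mono) auto
        have "sqrt (r\<^sup>2 - y\<^sup>2) ^ (2 * m + 2) = (sqrt (r\<^sup>2 - y\<^sup>2))\<^sup>2 ^ (m + 1)"
          unfolding power_mult[symmetric] by (simp add: algebra_simps)
        then have "sqrt (r\<^sup>2 - y\<^sup>2) ^ (2 * m + 2) = (r\<^sup>2 - y\<^sup>2) ^ (m + 1)"
          using y by (simp only: real_sqrt_pow2)
        with y A(1) have "emeasure (?P A) (?S (sqrt (r\<^sup>2 - y\<^sup>2))) = ennreal (unit_ball_vol (2 * m + 2) * (r\<^sup>2 - y\<^sup>2) ^ (m + 1))"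
          by (subst emeasure_cball_aux) (simp_all add: cardA del: power_Suc)
        then show ?thesis using G by (simp only: ennreal_mult'[symmetric] indicator_pos_le mult_nonneg_nonneg)
      qed auto
    qed
  qed
  finally show ?thesis .
qed

text \<open>The truncation \<open>max 0\<close> stands for the restriction to [-r, r]. The radius
  then occurs in the integrand alone, on which it acts in a Lipschitz way, and can be differentiated
  under the integral.\<close>

lemma integral_ball_slices:
  fixes b :: "'a::euclidean_space" and G :: "real \<Rightarrow> real"
  assumes b: "b \<in> Basis" and [measurable]: "G \<in> borel_measurable borel" and G: "\<And>q. G q \<ge> 0" and r: "r > 0"
    and n: "DIM('a) = 2 * m + 3"
  shows "(\<integral>z. indicator (ball 0 r) z * G (z \<bullet> b) \<partial>lborel) =
    (\<integral>q. G q * (unit_ball_vol (2 * m + 2) * max 0 (r\<^sup>2 - q\<^sup>2) ^ (m + 1)) \<partial>lborel)"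
proof -
  have [measurable]: "(\<lambda>z. indicator S z * G (z \<bullet> b)) \<in> borel_measurable borel" if "S \<in> sets borel" for S
    using that by (intro borel_measurable_times borel_measurable_indicator) simp_all
  have "sphere (0::'a) r \<in> null_sets lborel"
    using negligible_sphere[of "0::'a" r]
    by (auto simp: null_sets_completion_iff negligible_iff_null_sets negligible_convex_frontier)
  then have "AE z in lborel. z \<notin> sphere (0::'a) r" by (rule AE_not_in)
  then have "(\<integral>z. indicator (ball 0 r) z * G (z \<bullet> b) \<partial>lborel) = (\<integral>z. indicator (cball (0::'a) r) z * G (z \<bullet> b) \<partial>lborel)"
    by (intro integral_cong_AE) (auto elim!: eventually_mono simp: indicator_def)
  also have "\<dots> = enn2real (\<integral>\<^sup>+z. ennreal (indicator (cball (0::'a) r) z * G (z \<bullet> b)) \<partial>lborel)"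
    using G by (intro integral_eq_nn_integral) auto
  also have "\<dots> = enn2real (\<integral>\<^sup>+q. ennreal (indicator {-r..r} q * G q * (unit_ball_vol (2 * m + 2) * (r\<^sup>2 - q\<^sup>2) ^ (m + 1))) \<partial>lborel)"
    by (subst nn_integral_cball_slices[OF b _ G r n]) auto
  also have "\<dots> = enn2real (\<integral>\<^sup>+q. ennreal (G q * (unit_ball_vol (2 * m + 2) * max 0 (r\<^sup>2 - q\<^sup>2) ^ (m + 1))) \<partial>lborel)"
  proof (intro arg_cong[where f = enn2real] nn_integral_cong arg_cong[where f = ennreal])
    fix q
    have "q\<^sup>2 \<le> r\<^sup>2 \<longleftrightarrow> -r \<le> q \<and> q \<le> r" using r by (auto simp: abs_le_square_iff[symmetric])
    then show "indicator {-r..r} q * G q * (unit_ball_vol (2 * m + 2) * (r\<^sup>2 - q\<^sup>2) ^ (m + 1)) =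
       G q * (unit_ball_vol (2 * m + 2) * max 0 (r\<^sup>2 - q\<^sup>2) ^ (m + 1))"
      by (auto simp: indicator_def max_def)
  qed
  also have "\<dots> = (\<integral>q. G q * (unit_ball_vol (2 * m + 2) * max 0 (r\<^sup>2 - q\<^sup>2) ^ (m + 1)) \<partial>lborel)"
    using G by (intro integral_eq_nn_integral[symmetric]) auto
  finally show ?thesis .
qed

text \<open>Both sides are the derivative at radius 1 of the integral of
  \<open>G (z \<bullet> b)\<close> over a ball, once by polar coordinates and once by slices.
  Differentiating the slice volume gives \<open>2 * (m + 1) * unit_ball_vol (2 * m + 2)\<close>,
  which is \<open>sphere_area (2 * m + 2)\<close>. Continuity of \<open>G\<close> is what the polar
  derivative asks for.\<close>

lemma integral_sphere_zonal:
  fixes b :: "'a::euclidean_space" and G :: "real \<Rightarrow> real"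
  assumes b: "b \<in> Basis" and cont: "continuous_on UNIV G" and G: "\<And>q. G q \<ge> 0" "\<And>q. G q \<le> 1"
    and n: "DIM('a) = 2 * m + 3"
  shows "(\<integral>\<sigma>. G (\<sigma> \<bullet> b) \<partial>sphere_measure) =
    (\<integral>q. indicator {-1..1} q * G q * (sphere_area (2 * m + 2) * (1 - q\<^sup>2) ^ m) \<partial>lborel)"
proof -
  define v where "v = unit_ball_vol (2 * m + 2)"
  have v: "v \<ge> 0" by (simp add: v_def)
  have [measurable]: "G \<in> borel_measurable borel" using cont by (rule borel_measurable_continuous_onI)
  define q' where "q' = (\<lambda>q. indicator {-1..1} q * G q * (sphere_area (2 * m + 2) * (1 - q\<^sup>2) ^ m))"
  let ?J = "\<lambda>r. \<integral>q. G q * (v * max 0 (r\<^sup>2 - q\<^sup>2) ^ (m + 1)) \<partial>lborel"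
  \<comment> \<open>Lipschitz constant on 0 < s < 2: the power contributes
    \<open>(m + 1) * 4 ^ m\<close>, and \<bar>s^2 - 1\<bar> \<le> 3 \<bar>s - 1\<bar> contributes
    the 3.\<close>
  define C where "C = v * (real (m + 1) * 4 ^ m) * 3"
  have "(?J has_real_derivative (\<integral>q. q' q \<partial>lborel)) (at 1)"
  proof (rule has_real_derivative_integral_lipschitz[where a = 0 and b = 2 and w = "\<lambda>q. indicator {-2..2} q * C"])
    show "integrable lborel (\<lambda>q. G q * (v * max 0 (s\<^sup>2 - q\<^sup>2) ^ (m + 1)))" if s: "0 < s" "s < 2" for s
    proof (rule Bochner_Integration.integrable_bound[where f = "\<lambda>q. indicator {-2..2} q * (v * 4 ^ (m + 1))"])
      show "integrable lborel (\<lambda>q. indicator {-2..2::real} q * (v * 4 ^ (m + 1)) :: real)"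
        by (intro integrable_mult_left integrable_real_indicator) auto
      show "AE q in lborel. norm (G q * (v * max 0 (s\<^sup>2 - q\<^sup>2) ^ (m + 1))) \<le> norm (indicator {-2..2} q * (v * 4 ^ (m + 1)))"
      proof (rule AE_I2)
        fix q :: real
        have s2: "s\<^sup>2 \<le> 4" using s power_mono[of s 2 2] by simp
        show "norm (G q * (v * max 0 (s\<^sup>2 - q\<^sup>2) ^ (m + 1))) \<le> norm (indicator {-2..2} q * (v * 4 ^ (m + 1)))"
        proof (cases "q \<in> {-2..2}")
          case True
          have s2q: "s\<^sup>2 - q\<^sup>2 \<le> 4" using s2 zero_le_power2[of q] by linarith
          have "max 0 (s\<^sup>2 - q\<^sup>2) ^ (m + 1) \<le> 4 ^ (m + 1)" using s2q by (intro power_mono) auto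
          then have "G q * (v * max 0 (s\<^sup>2 - q\<^sup>2) ^ (m + 1)) \<le> 1 * (v * 4 ^ (m + 1))"
            using G v by (intro mult_mono) (auto intro!: mult_nonneg_nonneg)
          then show ?thesis using True G v by (simp add: abs_mult)
        next
          case False
          then have "q\<^sup>2 \<ge> 2\<^sup>2" by (intro abs_le_square_iff[THEN iffD1]) auto
          then have "max 0 (s\<^sup>2 - q\<^sup>2) = 0" using s2 by simp
          then show ?thesis by simp
        qed
      qed
    qed simp
    \<comment> \<open>For \<open>m = 0\<close> the truncated power has a corner at
      \<open>s = 1\<close> when \<open>q\<close> is 1 or -1.\<close>
    have "AE q in lborel. q \<notin> {-1, 1::real}"
      by (intro AE_not_in countable_imp_null_set_lborel) auto
    then show "AE q in lborel. ((\<lambda>s. G q * (v * max 0 (s\<^sup>2 - q\<^sup>2) ^ (m + 1))) has_real_derivative q' q) (at 1)"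
    proof eventually_elim
      case (elim q)
      show ?case
      proof (cases "\<bar>q\<bar> < 1")
        case True
        have "((\<lambda>s. G q * (v * (s\<^sup>2 - q\<^sup>2) ^ (m + 1))) has_real_derivative G q * (v * ((m + 1) * (1 - q\<^sup>2) ^ m * 2))) (at 1)"
          by (rule derivative_eq_intros refl)+ simp
        moreover have "\<forall>\<^sub>F s in nhds 1. s\<^sup>2 > q\<^sup>2"
        proof -
          have "1 \<in> {\<bar>q\<bar><..}" using True by simp
          from eventually_nhds_in_open[OF open_greaterThan this]
          show ?thesis by eventually_elim (auto intro: power2_strict_mono)
        qed
        then have "\<forall>\<^sub>F s in nhds 1. G q * (v * (s\<^sup>2 - q\<^sup>2) ^ (m + 1)) = G q * (v * max 0 (s\<^sup>2 - q\<^sup>2) ^ (m + 1))"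
          by eventually_elim auto
        moreover have "G q * (v * ((m + 1) * (1 - q\<^sup>2) ^ m * 2)) = q' q"
          using True by (simp add: q'_def sphere_area_eq_unit_ball_vol v_def abs_less_iff algebra_simps)
        ultimately show ?thesis using has_real_derivative_eventually_cong by simp
      next
        case False
        then have q: "\<bar>q\<bar> > 1" using elim by (auto simp: abs_if split: if_splits)
        have "\<forall>\<^sub>F s in nhds 1. s\<^sup>2 < q\<^sup>2"
        proof -
          have "1 \<in> {0<..<\<bar>q\<bar>}" using q by simp
          from eventually_nhds_in_open[OF open_greaterThanLessThan this]
          show ?thesis by eventually_elim (auto intro: power2_strict_mono)
        qed
        then have "\<forall>\<^sub>F s in nhds 1. 0 = G q * (v * max 0 (s\<^sup>2 - q\<^sup>2) ^ (m + 1))"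
          by eventually_elim auto
        moreover have "q' q = 0" using q by (auto simp: q'_def indicator_def abs_if split: if_splits)
        ultimately show ?thesis by (auto intro: has_real_derivative_eventually_cong[where f = "\<lambda>_. 0"])
      qed
    qed
    show "q' \<in> borel_measurable lborel" unfolding q'_def by simp
    show "\<bar>G q * (v * max 0 (s\<^sup>2 - q\<^sup>2) ^ (m + 1)) - G q * (v * max 0 (1\<^sup>2 - q\<^sup>2) ^ (m + 1))\<bar>
        \<le> indicator {-2..2} q * C * \<bar>s - 1\<bar>" if s: "0 < s" "s < 2" for s q
    proof (cases "q \<in> {-2..2}")
      case True
      have s2: "s\<^sup>2 \<le> 4" using s power_mono[of s 2 2] by simp
      have "\<bar>max 0 (s\<^sup>2 - q\<^sup>2) ^ (m + 1) - max 0 (1\<^sup>2 - q\<^sup>2) ^ (m + 1)\<bar>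
          \<le> real (m + 1) * 4 ^ (m + 1 - 1) * \<bar>max 0 (s\<^sup>2 - q\<^sup>2) - max 0 (1\<^sup>2 - q\<^sup>2)\<bar>"
      proof (rule abs_power_diff_le)
        show "max 0 (s\<^sup>2 - q\<^sup>2) \<le> 4" "max 0 (1\<^sup>2 - q\<^sup>2) \<le> 4"
          using s2 zero_le_power2[of q] by (intro max.boundedI; simp; linarith)+
      qed auto
      also have "\<dots> \<le> real (m + 1) * 4 ^ m * (3 * \<bar>s - 1\<bar>)"
      proof -
        have "\<bar>max 0 (s\<^sup>2 - q\<^sup>2) - max 0 (1\<^sup>2 - q\<^sup>2)\<bar> \<le> \<bar>s\<^sup>2 - 1\<bar>" by (auto simp: max_def)
        also have "s\<^sup>2 - 1 = (s + 1) * (s - 1)" by (simp add: power2_eq_square algebra_simps)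
        also have "\<bar>\<dots>\<bar> \<le> 3 * \<bar>s - 1\<bar>" using s by (auto simp: abs_mult intro!: mult_right_mono)
        finally show ?thesis by (auto intro!: mult_left_mono)
      qed
      finally have *: "\<bar>max 0 (s\<^sup>2 - q\<^sup>2) ^ (m + 1) - max 0 (1\<^sup>2 - q\<^sup>2) ^ (m + 1)\<bar> \<le> real (m + 1) * 4 ^ m * (3 * \<bar>s - 1\<bar>)" .
      have "\<bar>G q * (v * max 0 (s\<^sup>2 - q\<^sup>2) ^ (m + 1)) - G q * (v * max 0 (1\<^sup>2 - q\<^sup>2) ^ (m + 1))\<bar>
         = G q * (v * \<bar>max 0 (s\<^sup>2 - q\<^sup>2) ^ (m + 1) - max 0 (1\<^sup>2 - q\<^sup>2) ^ (m + 1)\<bar>)"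
        using G v by (simp add: right_diff_distrib[symmetric] abs_mult del: power_Suc)
      also have "\<dots> \<le> 1 * (v * (real (m + 1) * 4 ^ m * (3 * \<bar>s - 1\<bar>)))"
        using * G v by (intro mult_mono) (auto intro!: mult_nonneg_nonneg)
      finally show ?thesis using True by (simp add: C_def algebra_simps)
    next
      case False
      then have q: "q\<^sup>2 \<ge> 2\<^sup>2" by (intro abs_le_square_iff[THEN iffD1]) auto
      moreover have "s\<^sup>2 \<le> 4" using s power_mono[of s 2 2] by simp
      ultimately have "max 0 (s\<^sup>2 - q\<^sup>2) = 0" "max 0 (1\<^sup>2 - q\<^sup>2) = 0" by auto
      then show ?thesis using False by simp
    qed
    show "integrable lborel (\<lambda>q. indicator {-2..2::real} q * C)"
      by (intro integrable_mult_left integrable_real_indicator) auto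
  qed auto
  moreover have "((\<lambda>r. \<integral>z. indicator (ball 0 r) z * G (z \<bullet> b) \<partial>lborel) has_real_derivative
       1 ^ (DIM('a) - 1) * (\<integral>\<sigma>. G ((1 *\<^sub>R \<sigma>) \<bullet> b) \<partial>sphere_measure)) (at 1)"
    by (intro has_real_derivative_integral_ball continuous_on_compose2[OF cont]) (auto intro!: continuous_intros)
  moreover have "\<forall>\<^sub>F r in nhds 1. (\<integral>z. indicator (ball (0::'a) r) z * G (z \<bullet> b) \<partial>lborel) = ?J r"
    by (intro eventually_mono[OF eventually_nhds_in_open[of "{0<..}"]])
       (simp, simp, subst integral_ball_slices[OF b _ G(1) _ n], simp_all only: v_def greaterThan_iff, measurable)
  ultimately have "(?J has_real_derivative (\<integral>q. q' q \<partial>lborel)) (at 1)"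
    and "(?J has_real_derivative (\<integral>\<sigma>. G (\<sigma> \<bullet> b) \<partial>(sphere_measure :: 'a measure))) (at 1)"
    using has_real_derivative_eventually_cong[where g = ?J] by (simp, simp only: power_one mult_1 scaleR_one)
  then show ?thesis unfolding q'_def using DERIV_unique by blast
qed

text \<open>The indicator of a half line is not continuous, so the zonal formula is applied to the
  ramps \<open>G j\<close>, which rise from 0 to 1 on an interval of length 1 / j to the right of
  \<open>p\<close>, followed by dominated convergence on both sides. Ramps starting at
  \<open>p\<close> converge to the open half line at every point.\<close>

lemma measure_cap_basis:
  fixes b :: "'a::euclidean_space"
  assumes b: "b \<in> Basis" and n: "DIM('a) = 2 * m + 3"
  shows "measure sphere_measure {\<sigma> \<in> sphere 0 1. \<sigma> \<bullet> b > p} =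
    (\<integral>q. indicator {-1..1} q * indicator {p<..} q * (sphere_area (2 * m + 2) * (1 - q\<^sup>2) ^ m) \<partial>lborel)"
proof -
  define G where "G = (\<lambda>(j::nat) q. min 1 (max 0 (real j * (q - p))))"
  have Gcont: "continuous_on UNIV (G j)" for j
    unfolding G_def by (intro continuous_intros)
  have [measurable]: "G j \<in> borel_measurable borel" for j
    using Gcont by (rule borel_measurable_continuous_onI)
  have G: "0 \<le> G j q" "G j q \<le> 1" for j q by (auto simp: G_def)
  have Glim: "(\<lambda>j. G j q) \<longlonglongrightarrow> indicator {p<..} q" for q
  proof (cases "q > p")
    case True
    obtain N :: nat where N: "N > 1 / (q - p)" using reals_Archimedean2 by blast
    have "G j q = 1" if "j \<ge> N" for j
    proof -
      have "1 / (q - p) \<le> j" using N that by linarith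
      then have "1 \<le> j * (q - p)" using True by (simp add: field_simps)
      then show ?thesis by (simp add: G_def)
    qed
    then have "\<forall>\<^sub>F j in sequentially. G j q = indicator {p<..} q"
      using True by (auto simp: eventually_sequentially)
    then show ?thesis by (rule tendsto_eventually)
  next
    case False
    then have "G j q = 0" for j by (auto simp: G_def mult_nonneg_nonpos)
    then show ?thesis using False by simp
  qed
  let ?w = "\<lambda>q. sphere_area (2 * m + 2) * (1 - q\<^sup>2) ^ m :: real"
  let ?c = "\<lambda>\<sigma>::'a. indicator {p<..} (\<sigma> \<bullet> b) :: real"
  have "(\<lambda>j. \<integral>\<sigma>. G j (\<sigma> \<bullet> b) \<partial>(sphere_measure :: 'a measure)) \<longlonglongrightarrow> (\<integral>\<sigma>. ?c \<sigma> \<partial>sphere_measure)"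
  proof (rule integral_dominated_convergence[where w = "\<lambda>_. 1"])
    show "?c \<in> borel_measurable sphere_measure" "\<And>j. (\<lambda>\<sigma>. G j (\<sigma> \<bullet> b)) \<in> borel_measurable (sphere_measure :: 'a measure)"
      by (auto cong: measurable_cong_sets simp: sets_sphere_measure intro!: measurable_restrict_space1)
  qed (use Glim G in auto)
  moreover have "(\<integral>\<sigma>. ?c \<sigma> \<partial>sphere_measure) = measure sphere_measure {\<sigma> \<in> sphere 0 1. \<sigma> \<bullet> b > p}"
  proof -
    have "(\<integral>\<sigma>. ?c \<sigma> \<partial>sphere_measure) = (\<integral>\<sigma>. indicator {\<sigma> \<in> sphere 0 1. \<sigma> \<bullet> b > p} \<sigma> \<partial>sphere_measure)"
      by (intro Bochner_Integration.integral_cong) (auto simp: indicator_def)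
    then show ?thesis by (simp add: Int_absorb2 subset_iff Int_def cong: conj_cong)
  qed
  moreover have "(\<lambda>j. \<integral>q. indicator {-1..1} q * G j q * ?w q \<partial>lborel) \<longlonglongrightarrow>
     (\<integral>q. indicator {-1..1} q * indicator {p<..} q * ?w q \<partial>lborel)"
  proof (rule integral_dominated_convergence[where w = "\<lambda>q. indicator {-1..1} q * ?w q"])
    have "set_integrable lborel {-1..1} ?w"
      by (intro borel_integrable_atLeastAtMost') (auto intro!: continuous_intros)
    then show "integrable lborel (\<lambda>q. indicator {-1..1} q * ?w q)"
      by (simp add: set_integrable_def)
    show "AE q in lborel. (\<lambda>j. indicator {-1..1} q * G j q * ?w q) \<longlonglongrightarrow> indicator {-1..1} q * indicator {p<..} q * ?w q"
      by (intro AE_I2 tendsto_intros Glim)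
    show "AE q in lborel. norm (indicator {-1..1} q * G j q * ?w q) \<le> indicator {-1..1} q * ?w q" for j
    proof (rule AE_I2)
      fix q :: real
      have "?w q \<ge> 0" if "q \<in> {-1..1}"
        using that sphere_area_nonneg[of "2*m+2"] by (auto intro!: mult_nonneg_nonneg simp: abs_square_le_1 abs_le_iff)
      then show "norm (indicator {-1..1} q * G j q * ?w q) \<le> indicator {-1..1} q * ?w q"
        using G[of j q] mult_left_le_one_le[of "?w q" "G j q"]
        by (cases "q \<in> {-1..1}") (simp_all add: abs_mult del: power_mult_distrib, metis abs_mult abs_of_nonneg)
    qed
  qed auto
  moreover have "(\<integral>\<sigma>. G j (\<sigma> \<bullet> b) \<partial>(sphere_measure :: 'a measure)) = (\<integral>q. indicator {-1..1} q * G j q * ?w q \<partial>lborel)" for j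
    by (rule integral_sphere_zonal[OF b Gcont G n])
  ultimately show ?thesis using LIMSEQ_unique by auto
qed

text \<open>Haar uniqueness in a nutshell: integrating \<open>f (T x + y) * indicator (cball 0 1) y\<close> over \<open>x\<close> and \<open>y\<close>
  in both orders compares \<open>\<integral>f (T x)\<close> with \<open>\<integral>f\<close>.\<close>

lemma nn_integral_lborel_isometry:
  fixes T :: "'a::euclidean_space \<Rightarrow> 'a" and f :: "'a \<Rightarrow> ennreal"
  assumes T: "linear T" "\<And>x. norm (T x) = norm x" "surj T" and [measurable]: "f \<in> borel_measurable borel"
  shows "(\<integral>\<^sup>+x. f (T x) \<partial>lborel) = (\<integral>\<^sup>+x. f x \<partial>lborel)"
proof -
  have [measurable]: "T \<in> borel_measurable borel"
    using T(1) by (intro borel_measurable_continuous_onI linear_continuous_on linear_conv_bounded_linear[THEN iffD1])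
  define V where "V = emeasure lborel (cball (0::'a) 1)"
  \<comment> \<open>\<open>V\<close> is cancelled at the end, so it has to be nonzero and
    finite.\<close>
  have V: "V \<noteq> 0" "V \<noteq> \<infinity>" using unit_ball_vol_pos[of "real DIM('a)"] by (auto simp: V_def emeasure_cball simp del: unit_ball_vol_pos)
  let ?g = "\<lambda>y::'a. indicator (cball 0 1) y :: ennreal"
  have [measurable]: "?g \<in> borel_measurable borel" by (rule borel_measurable_indicator) simp
  have transl: "(\<integral>\<^sup>+x. F (x + z) \<partial>lborel) = (\<integral>\<^sup>+x. F x \<partial>lborel)"
    if [measurable]: "F \<in> borel_measurable borel" for F :: "'a \<Rightarrow> ennreal" and z
  proof -
    have "(lborel :: 'a measure) = distr lborel borel (\<lambda>x. z + x)"
      using lborel_affine[of 1 z] by (simp add: density_1)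
    then have "(\<integral>\<^sup>+x. F x \<partial>lborel) = (\<integral>\<^sup>+x. F x \<partial>distr lborel borel (\<lambda>x. z + x))" by simp
    also have "\<dots> = (\<integral>\<^sup>+x. F (z + x) \<partial>lborel)" by (rule nn_integral_distr) auto
    finally show ?thesis by (simp add: add.commute)
  qed
  have "(\<integral>\<^sup>+x. f (T x) \<partial>lborel) * V = (\<integral>\<^sup>+y. (\<integral>\<^sup>+x. f (T x) \<partial>lborel) * ?g y \<partial>lborel)"
    by (subst nn_integral_cmult) (auto simp: V_def)
  also have "\<dots> = (\<integral>\<^sup>+y. \<integral>\<^sup>+x. f (T x + y) * ?g y \<partial>lborel \<partial>lborel)"
  proof (intro nn_integral_cong)
    fix y :: 'a
    \<comment> \<open>Surjectivity turns a translation after \<open>T\<close> into a translation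
      before \<open>T\<close>, which leaves the integral unchanged.\<close>
    obtain z where z: "T z = y" using T(3) by (metis surjD)
    have "(\<integral>\<^sup>+x. f (T x) \<partial>lborel) = (\<integral>\<^sup>+x. f (T (x + z)) \<partial>lborel)"
      by (subst transl[of "\<lambda>x. f (T x)"]) auto
    also have "\<dots> = (\<integral>\<^sup>+x. f (T x + y) \<partial>lborel)"
      using z by (simp add: linear_add[OF T(1)])
    finally show "(\<integral>\<^sup>+x. f (T x) \<partial>lborel) * ?g y = (\<integral>\<^sup>+x. f (T x + y) * ?g y \<partial>lborel)"
      by (simp add: nn_integral_multc)
  qed
  also have "\<dots> = (\<integral>\<^sup>+x. \<integral>\<^sup>+y. f (T x + y) * ?g y \<partial>lborel \<partial>lborel)"
    by (rule lborel_pair.Fubini') measurable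
  also have "\<dots> = (\<integral>\<^sup>+x. \<integral>\<^sup>+y. f y * ?g (y - T x) \<partial>lborel \<partial>lborel)"
  proof (rule nn_integral_cong)
    fix x :: 'a
    show "(\<integral>\<^sup>+y. f (T x + y) * ?g y \<partial>lborel) = (\<integral>\<^sup>+y. f y * ?g (y - T x) \<partial>lborel)"
      using transl[of "\<lambda>y. f y * ?g (y - T x)" "T x"] by (simp add: add.commute)
  qed
  also have "\<dots> = (\<integral>\<^sup>+y. \<integral>\<^sup>+x. f y * ?g (y - T x) \<partial>lborel \<partial>lborel)"
    by (rule lborel_pair.Fubini') measurable
  also have "\<dots> = (\<integral>\<^sup>+y. f y * V \<partial>lborel)"
  proof (intro nn_integral_cong)
    fix y :: 'a
    obtain z where z: "T z = y" using T(3) by (metis surjD)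
    have "y - T x = T (z - x)" for x using z by (simp add: linear_diff[OF T(1)])
    then have "?g (y - T x) = indicator (cball z 1) x" for x
      using T(2) by (simp add: indicator_def dist_norm)
    then have "(\<integral>\<^sup>+x. ?g (y - T x) \<partial>lborel) = V" by (simp add: V_def emeasure_cball)
    then show "(\<integral>\<^sup>+x. f y * ?g (y - T x) \<partial>lborel) = f y * V"
      by (subst nn_integral_cmult) auto
  qed
  also have "\<dots> = (\<integral>\<^sup>+y. f y \<partial>lborel) * V" by (simp add: nn_integral_multc)
  finally show ?thesis using V by (metis ennreal_mult_divide_eq infinity_ennreal_def)
qed

text \<open>The reflection in the hyperplane orthogonal to \<open>b - w\<close> exchanges two
  different vectors of equal length.\<close>

lemma isometry_exists:
  fixes b w :: "'a::euclidean_space"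
  assumes "norm b = norm w"
  obtains T :: "'a \<Rightarrow> 'a" where "linear T" "\<And>x y. T x \<bullet> T y = x \<bullet> y" "surj T" "T b = w"
proof (cases "b = w")
  case True
  then show ?thesis by (intro that[of id]) (auto simp: linear_id)
next
  case False
  define u where "u = sgn (b - w)"
  have u: "u \<bullet> u = 1" using False by (simp add: u_def dot_square_norm norm_sgn)
  define T where "T = (\<lambda>x. x - (2 * (x \<bullet> u)) *\<^sub>R u)"
  have lin: "linear T" by (rule linearI) (simp_all add: T_def inner_add_left algebra_simps)
  have TT: "T (T x) = x" for x
    by (simp add: T_def inner_diff_left u)
  have iso: "T x \<bullet> T y = x \<bullet> y" for x y
    by (simp add: T_def inner_diff_left inner_diff_right u inner_commute)
  have "(b - w) \<bullet> (b - w) = 2 * (b \<bullet> (b - w))"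
    using assms by (simp add: inner_diff_left inner_diff_right inner_commute norm_eq)
  moreover have "(2 * (b \<bullet> u)) *\<^sub>R u = (2 * (b \<bullet> (b - w)) / (norm (b - w))\<^sup>2) *\<^sub>R (b - w)"
    by (simp add: u_def sgn_div_norm power2_eq_square divide_inverse mult_ac)
  ultimately have "(2 * (b \<bullet> u)) *\<^sub>R u = b - w"
    using False inner_eq_zero_iff[of "b - w"] by (auto simp: power2_norm_eq_inner)
  then have "T b = w" by (simp add: T_def)
  moreover have "surj T" using TT by (metis surjI)
  ultimately show ?thesis using lin iso that by blast
qed

text \<open>By the cone formula a cap area is \<open>DIM('a)\<close> times the volume of the solid
  cone \<open>K\<close>, and an isometry sending \<open>b\<close> to \<open>w\<close> carries one
  cone to the other.\<close>

lemma measure_cap_rotate: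
  fixes w b :: "'a::euclidean_space"
  assumes "norm w = 1" "norm b = 1"
  shows "measure sphere_measure {\<sigma> \<in> sphere 0 1. \<sigma> \<bullet> w > p} = measure sphere_measure {\<sigma> \<in> sphere 0 1. \<sigma> \<bullet> b > p}"
proof -
  obtain T where T: "linear T" "\<And>x y. T x \<bullet> T y = x \<bullet> y" "surj T" "T b = w"
    using isometry_exists[of b w] assms by metis
  have Tn: "norm (T x) = norm x" for x using T(2)[of x x] by (simp add: norm_eq)
  \<comment> \<open>The cap condition on \<open>sgn z\<close> is multiplied by
    \<open>norm z\<close>, which makes the cone visibly Borel.\<close>
  define K where "K = (\<lambda>w::'a. {z. z \<in> ball 0 1 - {0} \<and> z \<bullet> w > p * norm z})"
  have Kb: "K w \<in> sets borel" for w unfolding K_def by measurable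
  have cone: "{r *\<^sub>R a | r a. 0 < r \<and> r < 1 \<and> a \<in> {\<sigma> \<in> sphere 0 1. \<sigma> \<bullet> w > p}} = K w" for w
  proof (intro equalityI subsetI)
    fix z assume z: "z \<in> K w"
    then have "z = norm z *\<^sub>R sgn z" "0 < norm z" "norm z < 1" "norm (sgn z) = 1" by (auto simp: K_def sgn_div_norm)
    moreover have "sgn z \<bullet> w > p" using z by (auto simp: K_def sgn_div_norm field_simps)
    ultimately show "z \<in> {r *\<^sub>R a | r a. 0 < r \<and> r < 1 \<and> a \<in> {\<sigma> \<in> sphere 0 1. \<sigma> \<bullet> w > p}}" by force
  qed (auto simp: K_def mult.commute)
  have meas: "measure sphere_measure {\<sigma> \<in> sphere 0 1. \<sigma> \<bullet> w > p} = DIM('a) * measure lborel (K w)" for w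
  proof -
    have "{\<sigma> \<in> sphere 0 1. \<sigma> \<bullet> w > p} \<in> sets borel" by measurable
    moreover have "{\<sigma> \<in> sphere 0 1. \<sigma> \<bullet> w > p} \<subseteq> sphere 0 1" by auto
    ultimately have "emeasure sphere_measure {\<sigma> \<in> sphere 0 1. \<sigma> \<bullet> w > p} =
        of_nat DIM('a) * emeasure lborel (K w)"
      unfolding cone[symmetric] by (rule emeasure_sphere_measure)
    then show ?thesis by (simp add: measure_def enn2real_mult)
  qed
  have "T z \<in> K w \<longleftrightarrow> z \<in> K b" for z
    using T(2)[of z b] Tn[of z] norm_eq_zero[of z] norm_eq_zero[of "T z"] unfolding T(4) by (auto simp: K_def)
  then have "(\<lambda>z. indicator (K b) z) = (\<lambda>z. indicator (K w) (T z) :: ennreal)"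
    by (auto simp: indicator_def)
  then have "(\<integral>\<^sup>+z. indicator (K b) z \<partial>lborel) = (\<integral>\<^sup>+z. indicator (K w) z \<partial>lborel)"
    using nn_integral_lborel_isometry[OF T(1) Tn T(3), of "indicator (K w)"] Kb by simp
  then show ?thesis unfolding meas using Kb by (simp add: measure_def)
qed

text \<open>The type argument only carries the dimension. The pole is a basis vector because slicing
  needs a coordinate direction; by rotation invariance the choice does not matter.\<close>

definition cap_measure :: "'a::euclidean_space itself \<Rightarrow> real \<Rightarrow> real" where
  "cap_measure _ p = measure (sphere_measure :: 'a measure) {\<sigma> \<in> sphere 0 1. \<sigma> \<bullet> (SOME b. b \<in> Basis) > p}"

lemma measure_cap:
  fixes w :: "'a::euclidean_space"
  assumes "norm w = 1"
  shows "measure sphere_measure {\<sigma> \<in> sphere 0 1. \<sigma> \<bullet> w > p} = cap_measure TYPE('a) p"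
  unfolding cap_measure_def using assms by (intro measure_cap_rotate) (auto intro: norm_Basis SOME_Basis)

text \<open>The latitude at height \<open>p\<close> sweeps area at the rate of the zonal density,
  whose constant is the area of the unit sphere one dimension lower.\<close>

lemma cap_measure_has_derivative:
  assumes n: "DIM('a::euclidean_space) = 2 * m + 3" and p: "-1 < p" "p < 1"
  shows "(cap_measure TYPE('a) has_real_derivative - sphere_area (2 * m + 2) * (1 - p\<^sup>2) ^ m) (at p)"
proof -
  let ?w = "\<lambda>q. sphere_area (2 * m + 2) * (1 - q\<^sup>2) ^ m :: real"
  \<comment> \<open>The antiderivative is taken on [-2, 2] so that it is differentiable from both
    sides at the end point 1 as well.\<close>
  obtain F where F: "\<And>x. x \<in> {-2..2} \<Longrightarrow> (F has_vector_derivative ?w x) (at x within {-2..2})"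
    by (rule antiderivative_continuous[of "-2" 2 ?w]) (auto intro!: continuous_intros)
  have F': "(F has_real_derivative ?w x) (at x)" if "-2 < x" "x < 2" for x
    using F[of x] that by (simp add: has_real_derivative_iff_has_vector_derivative at_within_Icc_at)
  have "cap_measure TYPE('a) s = F 1 - F s" if s: "-1 < s" "s < 1" for s
  proof -
    have "cap_measure TYPE('a) s = (\<integral>q. indicator {-1..1} q * indicator {s<..} q * ?w q \<partial>lborel)"
      unfolding cap_measure_def by (rule measure_cap_basis) (use n in \<open>auto intro: SOME_Basis\<close>)
    also have "\<dots> = (\<integral>q. ?w q * indicator {s..1} q \<partial>lborel)"
    proof (rule integral_cong_AE)
      have "AE q in lborel. q \<noteq> s" by (rule AE_lborel_singleton)
      then show "AE q in lborel. indicator {-1..1} q * indicator {s<..} q * ?w q = ?w q * indicator {s..1} q"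
        by eventually_elim (use s in \<open>auto simp: indicator_def\<close>)
    qed auto
    also have "\<dots> = F 1 - F s"
      using s by (intro integral_FTC_Icc_real F') (auto intro!: continuous_intros)
    finally show ?thesis .
  qed
  then have "\<forall>\<^sub>F s in nhds p. cap_measure TYPE('a) s = F 1 - F s"
    using p by (intro eventually_mono[OF eventually_nhds_in_open[of "{-1<..<1}"]]) auto
  moreover have "((\<lambda>s. F 1 - F s) has_real_derivative - sphere_area (2 * m + 2) * (1 - p\<^sup>2) ^ m) (at p)"
    using p F'[of p] by (auto intro!: derivative_eq_intros)
  ultimately show ?thesis using has_real_derivative_eventually_cong by (simp add: eq_commute)
qed

subsection \<open>Smoothness of spherical means\<close>

text \<open>Smoothness in \<open>t > 0\<close> of a family with parameter \<open>x\<close>, every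
  derivative being jointly continuous in both. Joint continuity is what survives integration over
  part of the parameter. The derivative is an existential witness rather than \<open>deriv\<close>,
  so closure properties are proved by exhibiting formulas.\<close>

fun Ck_family :: "nat \<Rightarrow> ('x::topological_space \<Rightarrow> real \<Rightarrow> real) \<Rightarrow> bool" where
  "Ck_family 0 q \<longleftrightarrow> continuous_on (UNIV \<times> {0<..}) (\<lambda>(x, t). q x t)"
| "Ck_family (Suc k) q \<longleftrightarrow> continuous_on (UNIV \<times> {0<..}) (\<lambda>(x, t). q x t) \<and>
     (\<exists>q'. (\<forall>x. \<forall>t>0. (q x has_real_derivative q' x t) (at t)) \<and> Ck_family k q')"

lemma Ck_family_continuous: "Ck_family k q \<Longrightarrow> continuous_on (UNIV \<times> {0<..}) (\<lambda>(x, t). q x t)"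
  by (cases k) auto

lemma Ck_family_SucI:
  assumes "continuous_on (UNIV \<times> {0<..}) (\<lambda>(x, t). q x t)"
    and "\<And>x t. t > 0 \<Longrightarrow> (q x has_real_derivative q' x t) (at t)" "Ck_family k q'"
  shows "Ck_family (Suc k) q"
  using assms by auto

text \<open>Agreement for \<open>t > 0\<close> suffices. This is needed for \<open>D_op\<close>,
  since \<open>deriv\<close> is identified with the witness only there.\<close>

lemma Ck_family_cong:
  assumes "Ck_family k q" "\<And>x t. t > 0 \<Longrightarrow> q x t = r x t"
  shows "Ck_family k r"
proof -
  have c: "continuous_on (UNIV \<times> {0<..}) (\<lambda>(x, t). r x t)"
    using Ck_family_continuous[OF assms(1)] assms(2) by (subst continuous_on_cong[OF refl, of _ _ "\<lambda>(x, t). q x t"]) auto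
  show ?thesis
  proof (cases k)
    case 0 then show ?thesis using c by simp
  next
    case (Suc j)
    then obtain q' where q': "\<And>x t. t > 0 \<Longrightarrow> (q x has_real_derivative q' x t) (at t)" "Ck_family j q'"
      using assms(1) by auto
    have "(r x has_real_derivative q' x t) (at t)" if "t > 0" for x t
      using q'(1)[OF that, of x] eventually_nhds_in_open[of "{0<..}" t] that
      by (elim has_real_derivative_eventually_cong) (auto elim!: eventually_mono simp: assms(2))
    then show ?thesis using c q' Suc by auto
  qed
qed

lemma Ck_family_Suc_imp: "Ck_family (Suc k) q \<Longrightarrow> Ck_family k q"
  by (induction k arbitrary: q) (simp, metis Ck_family.simps(2))

lemma Ck_family_const: "continuous_on UNIV c \<Longrightarrow> Ck_family k (\<lambda>x t. c x)"
proof (induction k arbitrary: c)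
  case 0
  then show ?case by (auto simp: split_beta intro!: continuous_on_compose2[of UNIV c _ fst] continuous_intros)
next
  case (Suc k)
  have "Ck_family k (\<lambda>(x::'a) (t::real). 0)" by (rule Suc.IH) simp
  moreover have "continuous_on (UNIV \<times> {0<..}) (\<lambda>(x, t::real). c x)"
    using Suc.prems by (auto simp: split_beta intro!: continuous_on_compose2[of UNIV c _ fst] continuous_intros)
  ultimately show ?case by (auto intro!: exI[of _ "\<lambda>x t. 0"])
qed

lemma Ck_family_add: "Ck_family k q \<Longrightarrow> Ck_family k r \<Longrightarrow> Ck_family k (\<lambda>x t. q x t + r x t)"
proof (induction k arbitrary: q r)
  case 0
  then show ?case by (auto simp: split_beta intro: continuous_on_add)
next
  case (Suc k)
  obtain q' r' where "\<And>x t. t > 0 \<Longrightarrow> (q x has_real_derivative q' x t) (at t)" "Ck_family k q'"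
     "\<And>x t. t > 0 \<Longrightarrow> (r x has_real_derivative r' x t) (at t)" "Ck_family k r'"
    using Suc.prems by auto
  then show ?case using Suc
    by (auto simp: split_beta intro!: continuous_on_add exI[of _ "\<lambda>x t. q' x t + r' x t"] derivative_eq_intros)
qed

lemma Ck_family_mult: "Ck_family k q \<Longrightarrow> Ck_family k r \<Longrightarrow> Ck_family k (\<lambda>x t. q x t * r x t)"
proof (induction k arbitrary: q r)
  case 0
  then show ?case by (auto simp: split_beta intro: continuous_on_mult)
next
  case (Suc k)
  obtain q' r' where 1: "\<And>x t. t > 0 \<Longrightarrow> (q x has_real_derivative q' x t) (at t)" "Ck_family k q'"
     "\<And>x t. t > 0 \<Longrightarrow> (r x has_real_derivative r' x t) (at t)" "Ck_family k r'"
    using Suc.prems by auto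
  have "Ck_family k (\<lambda>x t. q' x t * r x t + r' x t * q x t)"
    using 1(2,4) Suc.prems[THEN Ck_family_Suc_imp] by (intro Ck_family_add Suc.IH)
  moreover have "((\<lambda>t. q x t * r x t) has_real_derivative q' x t * r x t + r' x t * q x t) (at t)" if "t > 0" for x t
    using 1 that by (intro DERIV_mult)
  moreover have "continuous_on (UNIV \<times> {0<..}) (\<lambda>(x, t). q x t * r x t)"
    using Suc.prems by (auto simp: split_beta intro: continuous_on_mult)
  ultimately show ?case by (intro Ck_family_SucI)
qed

lemma Ck_family_sum: "(\<And>i. i \<in> I \<Longrightarrow> Ck_family k (q i)) \<Longrightarrow> Ck_family k (\<lambda>x t. \<Sum>i\<in>I. q i x t)"
proof (induction I rule: infinite_finite_induct)
  case (insert i I)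
  have "Ck_family k (\<lambda>x t. q i x t + (\<Sum>i\<in>I. q i x t))"
    by (intro Ck_family_add insert.IH insert.prems) auto
  then show ?case using insert.hyps by simp
next
  case (infinite A)
  have "Ck_family k (\<lambda>(x::'b) (t::real). 0)" by (rule Ck_family_const) simp
  then show ?case using infinite by simp
next
  case empty
  have "Ck_family k (\<lambda>(x::'b) (t::real). 0)" by (rule Ck_family_const) simp
  then show ?case by simp
qed

lemma Ck_family_ident: "Ck_family k (\<lambda>x t. t)"
proof -
  have "continuous_on (UNIV \<times> {0<..}) (\<lambda>(x::'a, t::real). t)"
    by (simp add: split_beta continuous_on_snd continuous_on_id)
  moreover have "Ck_family j (\<lambda>(x::'a) (t::real). 1)" for j by (rule Ck_family_const) simp
  ultimately show ?thesis by (cases k) (auto intro!: exI[of _ "\<lambda>x t. 1"])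
qed

lemma Ck_family_power: "Ck_family k (\<lambda>x t. t ^ j)"
  by (induction j) (auto intro: Ck_family_const Ck_family_mult Ck_family_ident)

lemma Ck_family_inverse: "Ck_family k (\<lambda>x t. 1 / t)"
proof (induction k)
  case 0
  show ?case by (auto simp: split_beta intro!: continuous_intros)
next
  case (Suc k)
  have "Ck_family k (\<lambda>(x::'a) t. (-1) * ((1 / t) * (1 / t)))"
    by (intro Ck_family_mult Suc Ck_family_const) simp
  moreover have "((\<lambda>t. 1 / t) has_real_derivative (-1) * ((1 / t) * (1 / t))) (at t)" if "t > 0" for t :: real
    using that by (auto intro!: derivative_eq_intros)
  moreover have "continuous_on (UNIV \<times> {0<..}) (\<lambda>(x::'a, t::real). 1 / t)"
    by (auto simp: split_beta intro!: continuous_intros)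
  ultimately show ?case by (intro Ck_family_SucI)
qed

lemma C_k_imp_continuous: "C_k k f \<Longrightarrow> continuous_on UNIV f"
  by (cases k) (auto intro!: continuous_at_imp_continuous_on differentiable_imp_continuous_within)

text \<open>The chain rule differentiates \<open>f\<close> in the direction
  \<open>- \<sigma>\<close>, which is itself a parameter, while \<open>C_k\<close> speaks of
  derivatives in fixed directions. Hence the derivative is expanded over \<open>Basis\<close>, with
  coefficients continuous in the parameter and independent of \<open>t\<close>, and the induction
  hypothesis is applied to each basis direction.\<close>

lemma Ck_family_compose_line:
  fixes f :: "'a::euclidean_space \<Rightarrow> real"
  assumes "C_k k f"
  shows "Ck_family k (\<lambda>(\<theta>, \<sigma>) t. f (\<theta> - t *\<^sub>R \<sigma>))"
  using assms
proof (induction k arbitrary: f)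
  case 0
  have "continuous_on UNIV f" using 0 by simp
  then show ?case by (auto simp: split_beta intro!: continuous_on_compose2[of UNIV f] continuous_intros)
next
  case (Suc k)
  define q' where "q' = (\<lambda>(\<theta>, \<sigma>) t. \<Sum>b\<in>Basis. - (\<sigma> \<bullet> b) * frechet_derivative f (at (\<theta> - t *\<^sub>R \<sigma>)) b)"
  have "((\<lambda>t. f (\<theta> - t *\<^sub>R \<sigma>)) has_real_derivative q' (\<theta>, \<sigma>) t) (at t)" for \<theta> \<sigma> t
  proof -
    let ?F = "frechet_derivative f (at (\<theta> - t *\<^sub>R \<sigma>))"
    have F: "(f has_derivative ?F) (at (\<theta> - t *\<^sub>R \<sigma>))"
      using Suc.prems by (simp add: frechet_derivative_works)
    have lin: "linear ?F" using F by (rule has_derivative_linear)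
    have "((\<lambda>t. f (\<theta> - t *\<^sub>R \<sigma>)) has_derivative (\<lambda>s. ?F (- s *\<^sub>R \<sigma>))) (at t)"
      using F by (intro has_derivative_compose[where g = f and f = "\<lambda>t. \<theta> - t *\<^sub>R \<sigma>"]) (auto intro!: derivative_eq_intros)
    moreover have "?F (- s *\<^sub>R \<sigma>) = q' (\<theta>, \<sigma>) t * s" for s
    proof -
      have "?F (- s *\<^sub>R \<sigma>) = - s * ?F \<sigma>" using linear_scale[OF lin, of "-s" \<sigma>] by simp
      also have "?F \<sigma> = ?F (\<Sum>b\<in>Basis. (\<sigma> \<bullet> b) *\<^sub>R b)" by (simp add: euclidean_representation)
      also have "\<dots> = (\<Sum>b\<in>Basis. (\<sigma> \<bullet> b) * ?F b)"
        by (simp add: linear_sum[OF lin] linear_scale[OF lin])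
      finally show ?thesis by (simp add: q'_def sum_negf mult.commute)
    qed
    ultimately show ?thesis by (simp add: has_field_derivative_def)
  qed
  moreover have "Ck_family k q'"
  proof -
    have "Ck_family k (\<lambda>(x::'a\<times>'a) t. \<Sum>b\<in>Basis. - (snd x \<bullet> b) * frechet_derivative f (at (fst x - t *\<^sub>R snd x)) b)"
    proof (intro Ck_family_sum Ck_family_mult Ck_family_const)
      fix b :: 'a
      show "continuous_on UNIV (\<lambda>x::'a\<times>'a. - (snd x \<bullet> b))" by (intro continuous_intros)
      show "Ck_family k (\<lambda>(x::'a\<times>'a) t. frechet_derivative f (at (fst x - t *\<^sub>R snd x)) b)"
        using Suc.IH[of "\<lambda>x. frechet_derivative f (at x) b"] Suc.prems by (simp add: split_beta)
    qed
    also have "(\<lambda>(x::'a\<times>'a) t. \<Sum>b\<in>Basis. - (snd x \<bullet> b) * frechet_derivative f (at (fst x - t *\<^sub>R snd x)) b) = q'"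
      by (simp add: q'_def fun_eq_iff)
    finally show ?thesis .
  qed
  moreover have "continuous_on UNIV f" using Suc.prems by (rule C_k_imp_continuous)
  then have "continuous_on (UNIV \<times> {0<..}) (\<lambda>(x, t). (case x of (\<theta>, \<sigma>) \<Rightarrow> \<lambda>t. f (\<theta> - t *\<^sub>R \<sigma>)) t)"
    by (auto simp: split_beta intro!: continuous_on_compose2[of UNIV f] continuous_intros)
  ultimately show ?case by (intro Ck_family_SucI[where q' = q']) auto
qed

text \<open>Continuity is local: on a closed ball inside \<open>S\<close> around the point,
  compactness of ball times sphere bounds the integrand, and dominated convergence applies.\<close>

lemma continuous_on_integral_sphere:
  fixes g :: "'z::euclidean_space \<Rightarrow> 'a::euclidean_space \<Rightarrow> real"
  assumes S: "open S" and g: "continuous_on (S \<times> sphere 0 1) (\<lambda>(z, \<sigma>). g z \<sigma>)"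
  shows "continuous_on S (\<lambda>z. \<integral>\<sigma>. g z \<sigma> \<partial>sphere_measure)"
proof (rule continuous_at_imp_continuous_on, rule ballI)
  fix z assume "z \<in> S"
  then obtain e where e: "e > 0" "cball z e \<subseteq> S" using S open_contains_cball by blast
  let ?K = "cball z e \<times> sphere (0::'a) 1"
  have gK: "continuous_on ?K (\<lambda>(z, \<sigma>). g z \<sigma>)"
    using e by (intro continuous_on_subset[OF g]) auto
  have "compact ((\<lambda>(z, \<sigma>). g z \<sigma>) ` ?K)"
    by (intro compact_continuous_image gK compact_Times) auto
  then have "bounded ((\<lambda>(z, \<sigma>). g z \<sigma>) ` ?K)" by (rule compact_imp_bounded)
  then obtain B where "\<forall>x\<in>?K. \<bar>g (fst x) (snd x)\<bar> \<le> B"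
    unfolding bounded_iff by (auto simp: split_beta)
  then have B: "\<And>y \<sigma>. y \<in> cball z e \<Longrightarrow> \<sigma> \<in> sphere 0 1 \<Longrightarrow> \<bar>g y \<sigma>\<bar> \<le> B" by force
  have slice: "continuous_on (sphere 0 1) (g y)" if "y \<in> cball z e" for y
    using that by (intro continuous_on_compose2[OF gK, of _ "\<lambda>\<sigma>. (y, \<sigma>)", simplified]) (auto intro!: continuous_intros)
  have "continuous_on (cball z e) (\<lambda>z. \<integral>\<sigma>. g z \<sigma> \<partial>sphere_measure)"
    unfolding continuous_on_sequentially comp_def
  proof safe
    fix X y assume y: "y \<in> cball z e" "\<forall>n. X n \<in> cball z e" "X \<longlonglongrightarrow> y"
    show "(\<lambda>n. \<integral>\<sigma>. g (X n) \<sigma> \<partial>sphere_measure) \<longlonglongrightarrow> (\<integral>\<sigma>. g y \<sigma> \<partial>sphere_measure)"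
    proof (rule integral_dominated_convergence[where w = "\<lambda>_. B"])
      show "g y \<in> borel_measurable sphere_measure" "\<And>n. g (X n) \<in> borel_measurable sphere_measure"
        using y by (auto intro!: borel_measurable_integrable integrable_sphere_measure_continuous slice)
      show "AE \<sigma> in sphere_measure. (\<lambda>n. g (X n) \<sigma>) \<longlonglongrightarrow> g y \<sigma>"
      proof (rule AE_I2)
        fix \<sigma> :: 'a assume \<sigma>: "\<sigma> \<in> space sphere_measure"
        have "continuous_on (cball z e) (\<lambda>y. g y \<sigma>)"
          using \<sigma> by (intro continuous_on_compose2[OF gK, of _ "\<lambda>y. (y, \<sigma>)", simplified]) (auto intro!: continuous_intros)
        then show "(\<lambda>n. g (X n) \<sigma>) \<longlonglongrightarrow> g y \<sigma>"
          using y unfolding continuous_on_sequentially comp_def by blast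
      qed
      show "AE \<sigma> in sphere_measure. norm (g (X n) \<sigma>) \<le> B" for n
        using y B by (intro AE_I2) auto
    qed auto
  qed
  then show "isCont (\<lambda>z. \<integral>\<sigma>. g z \<sigma> \<partial>sphere_measure) z"
    using e by (intro continuous_on_interior) auto
qed

text \<open>Differentiation under the integral, dominated by the maximum of the next derivative over
  the compact set of all directions and all \<open>t\<close> between t/2 and 2 t.\<close>

lemma Ck_family_integral_sphere:
  fixes q :: "'x::euclidean_space \<times> 'a::euclidean_space \<Rightarrow> real \<Rightarrow> real"
  shows "Ck_family k q \<Longrightarrow> Ck_family k (\<lambda>x t. \<integral>\<sigma>. q (x, \<sigma>) t \<partial>sphere_measure)"
proof (induction k arbitrary: q)
  case 0
  have "continuous_on (UNIV \<times> {0<..}) (\<lambda>z. \<integral>\<sigma>. (\<lambda>z \<sigma>. q (fst z, \<sigma>) (snd z)) z \<sigma> \<partial>(sphere_measure :: 'a measure))"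
    by (rule continuous_on_integral_sphere)
       (use 0 in \<open>auto simp: split_beta open_Times intro!: continuous_on_compose2[of "UNIV \<times> {0<..}" "\<lambda>p. q (fst p) (snd p)" _ "\<lambda>p. ((fst (fst p), snd p), snd (fst p))", simplified] continuous_intros\<close>)
  then show ?case by (simp add: split_beta)
next
  case (Suc k)
  obtain q' where q': "\<And>x t. t > 0 \<Longrightarrow> (q x has_real_derivative q' x t) (at t)" "Ck_family k q'"
    using Suc.prems by auto
  have c: "continuous_on (UNIV \<times> {0<..}) (\<lambda>z. \<integral>\<sigma>. (\<lambda>z \<sigma>. q (fst z, \<sigma>) (snd z)) z \<sigma> \<partial>(sphere_measure :: 'a measure))"
    by (rule continuous_on_integral_sphere)
       (use Suc.prems in \<open>auto simp: split_beta open_Times intro!: continuous_on_compose2[of "UNIV \<times> {0<..}" "\<lambda>p. q (fst p) (snd p)" _ "\<lambda>p. ((fst (fst p), snd p), snd (fst p))", simplified] continuous_intros\<close>)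
  have slice: "continuous_on (sphere 0 1) (\<lambda>\<sigma>. r (x, \<sigma>) t)"
    if "continuous_on (UNIV \<times> {0<..}) (\<lambda>(x, t). r x t)" "t > 0" for r :: "'x \<times> 'a \<Rightarrow> real \<Rightarrow> real" and x t
    using that by (intro continuous_on_compose2[OF that(1), of _ "\<lambda>\<sigma>. ((x, \<sigma>), t)", simplified]) (auto intro!: continuous_intros)
  have "((\<lambda>t. \<integral>\<sigma>. q (x, \<sigma>) t \<partial>sphere_measure) has_real_derivative (\<integral>\<sigma>. q' (x, \<sigma>) t \<partial>sphere_measure)) (at t)"
    if t: "t > 0" for x t
  proof -
    let ?K = "({x} \<times> sphere (0::'a) 1) \<times> {t/2..2*t}"
    have "compact ((\<lambda>(x, t). q' x t) ` ?K)"
      using t by (intro compact_continuous_image continuous_on_subset[OF Ck_family_continuous[OF q'(2)]] compact_Times) auto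
    then have "bounded ((\<lambda>(x, t). q' x t) ` ?K)" by (rule compact_imp_bounded)
    then obtain B where "\<forall>p\<in>?K. \<bar>q' (fst p) (snd p)\<bar> \<le> B"
      unfolding bounded_iff by (auto simp: split_beta)
    then have B: "\<And>\<sigma> s. \<sigma> \<in> sphere 0 1 \<Longrightarrow> t/2 \<le> s \<Longrightarrow> s \<le> 2*t \<Longrightarrow> \<bar>q' (x, \<sigma>) s\<bar> \<le> B" by force
    show ?thesis
    proof (rule has_real_derivative_integral[where a = "t/2" and b = "2*t" and w = "\<lambda>_. B" and q' = "\<lambda>t \<sigma>. q' (x, \<sigma>) t"])
      show "integrable sphere_measure (\<lambda>\<sigma>. q (x, \<sigma>) s)" if "t/2 < s" "s < 2*t" for s
        using t that Suc.prems by (intro integrable_sphere_measure_continuous slice) auto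
      show "(\<lambda>\<sigma>. q' (x, \<sigma>) t) \<in> borel_measurable sphere_measure"
        using t by (intro borel_measurable_integrable integrable_sphere_measure_continuous slice Ck_family_continuous[OF q'(2)])
    qed (use t B q' in auto)
  qed
  moreover have "Ck_family k (\<lambda>x t. \<integral>\<sigma>. q' (x, \<sigma>) t \<partial>sphere_measure)" by (rule Suc.IH[OF q'(2)])
  ultimately show ?case using c
    by (intro Ck_family_SucI[where q' = "\<lambda>x t. \<integral>\<sigma>. q' (x, \<sigma>) t \<partial>sphere_measure"]) (simp_all add: split_beta)
qed

lemma Ck_family_D_op:
  assumes "Ck_family (Suc k) q"
  shows "Ck_family k (\<lambda>x. D_op (q x))"
proof -
  obtain q' where q': "\<And>x t. t > 0 \<Longrightarrow> (q x has_real_derivative q' x t) (at t)" "Ck_family k q'"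
    using assms by auto
  have "Ck_family k (\<lambda>x t. 1/2 * ((1 / t) * q' x t))"
    by (intro Ck_family_mult Ck_family_const Ck_family_inverse q'(2)) simp
  then show ?thesis
    by (rule Ck_family_cong) (simp add: D_op_def DERIV_imp_deriv[OF q'(1)])
qed

lemma Ck_family_D_op_funpow: "Ck_family (k + j) q \<Longrightarrow> Ck_family k (\<lambda>x. (D_op ^^ j) (q x))"
proof (induction j arbitrary: k)
  case (Suc j)
  have "Ck_family (Suc k) (\<lambda>x. (D_op ^^ j) (q x))" by (rule Suc.IH) (use Suc.prems in simp)
  from Ck_family_D_op[OF this] show ?case by simp
qed simp

lemma Ck_family_spherical_mean:
  fixes f :: "'a::euclidean_space \<Rightarrow> real"
  assumes "C_infinity f"
  shows "Ck_family k (\<lambda>\<theta> t. t ^ j * spherical_mean f \<theta> t)"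
proof -
  have "Ck_family k (\<lambda>(\<theta>, \<sigma>) t. f (\<theta> - t *\<^sub>R \<sigma>))"
    using assms by (intro Ck_family_compose_line) (simp add: C_infinity_def)
  from Ck_family_integral_sphere[OF this] show ?thesis
    unfolding spherical_mean_def by (intro Ck_family_mult Ck_family_power Ck_family_const) auto
qed

lemma Ck_family_differentiable:
  assumes "Ck_family (Suc k) q" "t > 0"
  shows "q x differentiable (at t)"
  using assms by (auto simp: real_differentiable_def)

text \<open>This is E_theta(s), with the squared radius as argument and centred coordinates, as the
  polar derivative requires. For \<open>s \<le> 0\<close> the ball is empty, \<open>sqrt\<close>
  being an odd function, so the value is 0.\<close>

definition ball_integral :: "('a::euclidean_space \<Rightarrow> real) \<Rightarrow> 'a \<Rightarrow> real \<Rightarrow> real" where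
  "ball_integral f \<theta> s = (\<integral>z. indicator (ball 0 (sqrt s)) z * f (\<theta> - z) \<partial>lborel)"

lemma has_real_derivative_compose_sqrt:
  assumes "g differentiable (at (sqrt s))" "s > 0"
  shows "((\<lambda>s. g (sqrt s)) has_real_derivative D_op g (sqrt s)) (at s)"
proof -
  have "(g has_real_derivative deriv g (sqrt s)) (at (sqrt s))"
    using assms(1) DERIV_deriv_iff_real_differentiable by blast
  from DERIV_chain2[OF this DERIV_real_sqrt[OF assms(2)]] show ?thesis
    by (simp add: D_op_def field_simps)
qed

lemma ball_integral_has_derivative:
  fixes f :: "'a::euclidean_space \<Rightarrow> real"
  assumes f: "continuous_on UNIV f" and s: "s > 0" and n: "DIM('a) \<ge> 2"
  shows "(ball_integral f \<theta> has_real_derivative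
     sphere_area DIM('a) / 2 * (sqrt s ^ (DIM('a) - 2) * spherical_mean f \<theta> (sqrt s))) (at s)"
proof -
  have "((\<lambda>r. \<integral>z. indicator (ball 0 r) z * f (\<theta> - z) \<partial>lborel) has_real_derivative
      sqrt s ^ (DIM('a) - 1) * (\<integral>\<sigma>. f (\<theta> - sqrt s *\<^sub>R \<sigma>) \<partial>sphere_measure)) (at (sqrt s))"
    using s by (intro has_real_derivative_integral_ball continuous_on_compose2[OF f]) (auto intro!: continuous_intros)
  from DERIV_chain2[OF this DERIV_real_sqrt[OF s]]
  have "(ball_integral f \<theta> has_real_derivative
      sqrt s ^ (DIM('a) - 1) * (\<integral>\<sigma>. f (\<theta> - sqrt s *\<^sub>R \<sigma>) \<partial>sphere_measure) * (inverse (sqrt s) / 2)) (at s)"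
    by (simp add: ball_integral_def[abs_def])
  moreover obtain k where "DIM('a) = k + 2" using n by (metis add.commute le_Suc_ex)
  then have "sqrt s ^ (DIM('a) - 1) = sqrt s * sqrt s ^ (DIM('a) - 2)" by simp
  ultimately show ?thesis
    using s sphere_area_pos[of "DIM('a)"] by (simp add: spherical_mean_def field_simps)
qed

subsection \<open>Backprojection as a Newtonian potential\<close>

text \<open>Cutting the kernel off at the height it has at radius \<open>\<epsilon> i\<close> makes
  it continuous, so its integral over a ball can be differentiated in the radius. Beyond the cut-off
  the derivative is t^(n-1) s / t^(n-2) = s t, which bounds the integrals uniformly in
  \<open>i\<close>; monotone convergence removes the cut-off.\<close>

lemma integrable_newton_kernel:
  assumes n: "DIM('a::euclidean_space) \<ge> 3"
  shows "integrable lborel (\<lambda>z::'a. indicator (ball 0 R) z * (1 / norm z ^ (DIM('a) - 2)))"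
proof (cases "R > 0")
  case R: True
  let ?k = "DIM('a) - 2"
  define \<epsilon> where "\<epsilon> = (\<lambda>i::nat. R / (real i + 1))"
  have \<epsilon>: "0 < \<epsilon> i" "\<epsilon> i \<le> R" for i using R by (auto simp: \<epsilon>_def field_simps)
  define g where "g = (\<lambda>i (z::'a). 1 / max (norm z) (\<epsilon> i) ^ ?k)"
  have gc: "continuous_on UNIV (g i)" for i
  proof -
    have "max (norm z) (\<epsilon> i) \<noteq> 0" for z :: 'a using \<epsilon>(1)[of i] by (auto simp: max_def)
    then show ?thesis unfolding g_def by (intro continuous_intros) auto
  qed
  have [measurable]: "g i \<in> borel_measurable borel" for i using gc by (rule borel_measurable_continuous_onI)
  have g_bound: "0 \<le> g i z" "g i z \<le> 1 / \<epsilon> i ^ ?k" for i z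
    using \<epsilon>(1)[of i] by (auto simp: g_def intro!: divide_left_mono power_mono mult_pos_pos)
  have gint: "integrable lborel (\<lambda>z. indicator (ball 0 r) z * g i z)" for i r
    using g_bound[of i] by (intro integrable_bounded_on_ball[where r = r and B = "1 / \<epsilon> i ^ ?k"]) auto
  define J where "J = (\<lambda>i r. \<integral>z. indicator (ball 0 r) z * g i z \<partial>lborel)"
  define s where "s = sphere_area DIM('a)"
  have s: "s \<ge> 0" by (simp add: s_def sphere_area_nonneg)
  define v where "v = unit_ball_vol (real DIM('a))"
  \<comment> \<open>The first term bounds the shell outside the cut-off, the second the core, where
    the kernel is constant.\<close>
  have J_bound: "J i R \<le> s * R\<^sup>2 / 2 + v * R\<^sup>2" for i
  proof -
    have dJ: "(J i has_real_derivative t ^ (DIM('a) - 1) * (s / max t (\<epsilon> i) ^ ?k)) (at t)" if "t > 0" for t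
    proof -
      have "(\<integral>\<sigma>. g i (t *\<^sub>R \<sigma>) \<partial>(sphere_measure :: 'a measure)) = (\<integral>\<sigma>. 1 / max t (\<epsilon> i) ^ ?k \<partial>(sphere_measure :: 'a measure))"
        using that by (intro Bochner_Integration.integral_cong) (auto simp: g_def)
      also have "\<dots> = s / max t (\<epsilon> i) ^ ?k" by (simp add: s_def measure_sphere_measure_space)
      finally show ?thesis
        using has_real_derivative_integral_ball[OF gc that, of i] by (simp add: J_def[abs_def])
    qed
    have "J i R - s * R\<^sup>2 / 2 \<le> J i (\<epsilon> i) - s * (\<epsilon> i)\<^sup>2 / 2"
    proof (rule DERIV_nonpos_imp_nonincreasing[OF \<epsilon>(2)])
      fix t assume t: "\<epsilon> i \<le> t" "t \<le> R"
      then have t0: "t > 0" using \<epsilon>(1)[of i] by linarith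
      have "DIM('a) - 1 = Suc ?k" using n by simp
      then have "t ^ (DIM('a) - 1) = t * t ^ ?k" by simp
      then have "t ^ (DIM('a) - 1) * (s / max t (\<epsilon> i) ^ ?k) = t * s"
        using t t0 by (simp add: max_def)
      then have "((\<lambda>t. J i t - s * t\<^sup>2 / 2) has_real_derivative 0) (at t)"
        using dJ[OF t0] by (auto intro!: derivative_eq_intros)
      then show "\<exists>y. ((\<lambda>t. J i t - s * t\<^sup>2 / 2) has_real_derivative y) (at t) \<and> y \<le> 0" by blast
    qed
    moreover have "J i (\<epsilon> i) \<le> v * (\<epsilon> i)\<^sup>2"
    proof -
      have "J i (\<epsilon> i) \<le> (\<integral>z. indicator (ball (0::'a) (\<epsilon> i)) z * (1 / \<epsilon> i ^ ?k) \<partial>lborel)"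
        unfolding J_def using g_bound[of i]
        by (intro integral_mono gint integrable_mult_left integrable_real_indicator)
           (auto simp: emeasure_lborel_ball_finite[unfolded infinity_ennreal_def] indicator_def)
      also have "\<dots> = v * \<epsilon> i ^ DIM('a) * (1 / \<epsilon> i ^ ?k)"
        using \<epsilon>(1)[of i] by (simp add: content_ball v_def)
      also have "\<epsilon> i ^ DIM('a) = (\<epsilon> i)\<^sup>2 * \<epsilon> i ^ ?k"
      proof -
        have "DIM('a) = 2 + ?k" using n by simp
        then show ?thesis by (metis power_add)
      qed
      finally show ?thesis using \<epsilon>(1)[of i] by simp
    qed
    moreover have "v * (\<epsilon> i)\<^sup>2 \<le> v * R\<^sup>2"
      using \<epsilon>[of i] by (intro mult_left_mono power_mono) (auto simp: v_def)
    moreover have "s * (\<epsilon> i)\<^sup>2 / 2 \<ge> 0" using s by simp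
    ultimately show ?thesis by linarith
  qed
  have \<epsilon>_dec: "\<epsilon> j \<le> \<epsilon> i" if "i \<le> j" for i j
    using that R by (simp add: \<epsilon>_def frac_le)
  have g_mono: "g i z \<le> g j z" if "i \<le> j" for i j z
    unfolding g_def using \<epsilon>[of i] \<epsilon>[of j] \<epsilon>_dec[OF that]
    by (intro divide_left_mono power_mono mult_pos_pos zero_less_power) (auto simp: max_def)
  have J_inc: "incseq (\<lambda>i. J i R)"
    unfolding J_def by (intro incseq_SucI integral_mono gint mult_left_mono g_mono) auto
  obtain L where L: "(\<lambda>i. J i R) \<longlonglongrightarrow> L"
    using incseq_convergent[OF J_inc, of "s * R\<^sup>2 / 2 + v * R\<^sup>2"] J_bound by metis
  show ?thesis
  proof (rule integrable_monotone_convergence[where f = "\<lambda>i z. indicator (ball 0 R) z * g i z"])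
    show "AE z in lborel. mono (\<lambda>i. indicator (ball 0 R) z * g i z)"
      by (intro AE_I2 monoI mult_left_mono g_mono) auto
    have "AE z in lborel. z \<noteq> (0::'a)" by (rule AE_lborel_singleton)
    then show "AE z::'a in lborel. (\<lambda>i. indicator (ball 0 R) z * g i z) \<longlonglongrightarrow> indicator (ball 0 R) z * (1 / norm z ^ ?k)"
    proof eventually_elim
      case (elim z)
      have "(\<lambda>i. R * inverse (real (Suc i))) \<longlonglongrightarrow> R * 0" by (intro tendsto_mult LIMSEQ_inverse_real_of_nat tendsto_const)
      then have "\<epsilon> \<longlonglongrightarrow> 0" by (simp add: \<epsilon>_def[abs_def] divide_inverse add.commute)
      then have "(\<lambda>i. g i z) \<longlonglongrightarrow> 1 / max (norm z) 0 ^ ?k"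
        unfolding g_def using elim by (intro tendsto_intros) auto
      then show ?case by (intro tendsto_mult tendsto_const) simp
    qed
    show "(\<lambda>i. \<integral>z. indicator (ball 0 R) z * g i z \<partial>lborel) \<longlonglongrightarrow> L" using L by (simp add: J_def)
    show "(\<lambda>z. indicator (ball 0 R) z * (1 / norm z ^ ?k)) \<in> borel_measurable (lborel :: 'a measure)"
      by (intro borel_measurable_times borel_measurable_indicator) simp_all
  qed (rule gint)
qed (simp add: ball_empty)

section \<open>Differences of the cap area and the exchange of integrals\<close>

text \<open>As many derivatives as the degree leave only the leading coefficient (-1)^m, times a
  factorial.\<close>

lemma higher_pderiv_one_minus_square_power:
  "poly ((pderiv ^^ (2 * m)) ([:1, 0, -1:] ^ m)) (p::real) = (-1) ^ m * fact (2 * m)"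
proof -
  let ?P = "[:1, 0, -1::real:] ^ m"
  have deg: "degree ?P = 2 * m" by (simp add: degree_power_eq)
  have "coeff ?P (2 * m) = lead_coeff ?P" by (simp only: deg)
  then have lead: "coeff ?P (2 * m) = (-1) ^ m" by (simp add: lead_coeff_power)
  have "(pderiv ^^ (2 * m)) ?P = [:(-1) ^ m * fact (2 * m):]"
  proof (rule poly_eqI)
    fix k
    show "coeff ((pderiv ^^ (2 * m)) ?P) k = coeff [:(-1) ^ m * fact (2 * m):] k"
    proof (cases k)
      case 0
      then show ?thesis by (simp add: coeff_higher_pderiv lead pochhammer_fact[symmetric])
    next
      case (Suc j)
      then have "coeff ?P (k + 2 * m) = 0" using deg by (intro coeff_eq_0) simp
      then show ?thesis using Suc by (simp add: coeff_higher_pderiv)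
    qed
  qed
  then show ?thesis by simp
qed

text \<open>The hypothesis keeps all sampled heights inside (-1, 1), where the cap area and its
  derivatives form the chain \<open>C\<close>. Its member of index 2 m + 1 is constant, so the
  unknown intermediate point is irrelevant and the difference is exact; the affine height
  contributes one factor \<open>- 1 / (2 * d)\<close> per derivative, and \<open>c\<close> drops
  out.\<close>

lemma cap_forward_diff:
  assumes n: "DIM('a::euclidean_space) = 2 * m + 3" and a: "a > 0" and d: "d > 0"
    and lo: "\<And>\<tau>. 0 \<le> \<tau> \<Longrightarrow> \<tau> \<le> (2 * m + 1) * a \<Longrightarrow> -1 < (c - \<tau>) / (2 * d) \<and> (c - \<tau>) / (2 * d) < 1"
  shows "(forward_diff a ^^ (2 * m + 1)) (\<lambda>\<tau>. cap_measure TYPE('a) ((c - \<tau>) / (2 * d))) 0 =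
           a ^ (2 * m + 1) * (sphere_area (2 * m + 2) * fact (2 * m) * (-1) ^ m / 2 ^ (2 * m + 1) / d ^ (2 * m + 1))"
proof -
  define P :: "real poly" where "P = [:1, 0, -1:] ^ m"
  define C where "C = (\<lambda>i p. case i of 0 \<Rightarrow> cap_measure TYPE('a) p | Suc j \<Rightarrow> - sphere_area (2 * m + 2) * poly ((pderiv ^^ j) P) p)"
  define g where "g = (\<lambda>i \<tau>. C i ((c - \<tau>) / (2 * d)) * (- 1 / (2 * d)) ^ i)"
  have C: "(C i has_real_derivative C (Suc i) p) (at p)" if "-1 < p" "p < 1" for i p
  proof (cases i)
    case 0
    have "poly P p = (1 - p\<^sup>2) ^ m" by (simp add: P_def poly_power power2_eq_square)
    then show ?thesis using cap_measure_has_derivative[OF n that] 0 by (simp add: C_def)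
  next
    case (Suc j)
    then show ?thesis using DERIV_cmult[OF poly_DERIV[of "(pderiv ^^ j) P" p], of "- sphere_area (2 * m + 2)"]
      by (simp add: C_def)
  qed
  have "\<exists>\<xi>. 0 \<le> \<xi> \<and> \<xi> \<le> 0 + real (2 * m + 1) * a \<and> (forward_diff a ^^ (2 * m + 1)) (g 0) 0 = a ^ (2 * m + 1) * g (2 * m + 1) \<xi>"
  proof (rule forward_diff_mean_value[OF a])
    fix i \<tau> assume \<tau>: "0 \<le> \<tau>" "\<tau> \<le> 0 + real (2 * m + 1) * a"
    have "((\<lambda>\<tau>. (c - \<tau>) / (2 * d)) has_real_derivative - 1 / (2 * d)) (at \<tau>)"
      using d by (auto intro!: derivative_eq_intros)
    moreover have "(C i has_real_derivative C (Suc i) ((c - \<tau>) / (2 * d))) (at ((c - \<tau>) / (2 * d)))"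
      using lo[of \<tau>] \<tau> by (intro C) auto
    ultimately have "((\<lambda>\<tau>. C i ((c - \<tau>) / (2 * d))) has_real_derivative C (Suc i) ((c - \<tau>) / (2 * d)) * (- 1 / (2 * d))) (at \<tau>)"
      by (rule DERIV_chain2[rotated])
    from DERIV_cmult_right[OF this, of "(- 1 / (2 * d)) ^ i"]
    show "(g i has_real_derivative g (Suc i) \<tau>) (at \<tau>)" by (simp add: g_def[abs_def] mult.assoc)
  qed
  moreover have "g (2 * m + 1) \<xi> = sphere_area (2 * m + 2) * fact (2 * m) * (-1) ^ m / 2 ^ (2 * m + 1) / d ^ (2 * m + 1)" for \<xi>
  proof -
    \<comment> \<open>The odd power keeps its sign, which cancels the minus sign of the cap
      derivative.\<close>
    have "(- 1 / (2 * d)) ^ (2 * m + 1) = - 1 / (2 ^ (2 * m + 1) * d ^ (2 * m + 1))"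
      by (simp add: power_divide power_mult_distrib)
    moreover have "C (2 * m + 1) p = - sphere_area (2 * m + 2) * ((-1) ^ m * fact (2 * m))" for p
      using higher_pderiv_one_minus_square_power[of m p] by (simp add: C_def P_def)
    ultimately show ?thesis unfolding g_def by (simp only:) simp
  qed
  moreover have "g 0 = (\<lambda>\<tau>. cap_measure TYPE('a) ((c - \<tau>) / (2 * d)))" by (simp add: g_def C_def)
  ultimately show ?thesis by auto
qed

lemma measurable_sphere_measure_borel:
  "(\<lambda>\<theta>. \<theta>) \<in> (sphere_measure :: 'a::euclidean_space measure) \<rightarrow>\<^sub>M borel"
  by (simp cong: measurable_cong_sets add: sets_sphere_measure measurable_restrict_space1)

lemma ball_integral_eq:
  fixes f :: "'a::euclidean_space \<Rightarrow> real"
  assumes [measurable]: "f \<in> borel_measurable borel"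
  shows "ball_integral f \<theta> s = (\<integral>y. (if (norm (y - \<theta>))\<^sup>2 < s then f y else 0) \<partial>lborel)"
proof -
  \<comment> \<open>Valid for negative \<open>s\<close> too, because \<open>sqrt\<close> is strictly
    increasing on the whole line.\<close>
  have "(norm z < sqrt s) \<longleftrightarrow> (norm z)\<^sup>2 < s" for z :: 'a
    using real_sqrt_less_iff[of "(norm z)\<^sup>2" s] by simp
  then have "ball_integral f \<theta> s = (\<integral>z. (if (norm (\<theta> + (-1) *\<^sub>R z - \<theta>))\<^sup>2 < s then f (\<theta> + (-1) *\<^sub>R z) else 0) \<partial>lborel)"
    unfolding ball_integral_def by (intro Bochner_Integration.integral_cong) (auto simp: indicator_def)
  also have "\<dots> = (\<integral>y. (if (norm (y - \<theta>))\<^sup>2 < s then f y else 0) \<partial>lborel)"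
    by (subst integral_lborel_affine[of "\<lambda>y. if (norm (y - \<theta>))\<^sup>2 < s then f y else 0" "-1" \<theta>]) auto
  finally show ?thesis .
qed

text \<open>Fubini on pairs (theta, y) with
  \<open>(norm (y - \<theta>))\<^sup>2 < \<phi> \<theta>\<close>, dominated by a constant on sphere
  times ball. The squared radius \<open>\<phi>\<close> may vary with theta, as it must when all
  balls are to have the same point on their boundary.\<close>

lemma integral_sphere_ball_integral:
  fixes f :: "'a::euclidean_space \<Rightarrow> real" and \<phi> :: "'a \<Rightarrow> real"
  assumes [measurable]: "f \<in> borel_measurable borel" and f: "\<And>y. \<bar>f y\<bar> \<le> B" "\<And>y. f y \<noteq> 0 \<Longrightarrow> norm y < 1"
    and [measurable]: "\<phi> \<in> borel_measurable borel"
  shows "integrable sphere_measure (\<lambda>\<theta>. ball_integral f \<theta> (\<phi> \<theta>))" (is ?A)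
    and "integrable lborel (\<lambda>y. f y * measure sphere_measure {\<theta> \<in> sphere 0 1. (norm (y - \<theta>))\<^sup>2 < \<phi> \<theta>})" (is ?B)
    and "(\<integral>\<theta>. ball_integral f \<theta> (\<phi> \<theta>) \<partial>sphere_measure) =
      (\<integral>y. f y * measure sphere_measure {\<theta> \<in> sphere 0 1. (norm (y - \<theta>))\<^sup>2 < \<phi> \<theta>} \<partial>lborel)" (is ?C)
proof -
  interpret pair_sigma_finite "sphere_measure :: 'a measure" "lborel :: 'a measure" ..
  note measurable_sphere_measure_borel [measurable]
  let ?H = "\<lambda>(\<theta>::'a) y. if (norm (y - \<theta>))\<^sup>2 < \<phi> \<theta> then f y else 0"
  let ?F = "case_prod ?H"
  have Fm: "?F \<in> borel_measurable (sphere_measure \<Otimes>\<^sub>M lborel)" by measurable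
  have int: "integrable (sphere_measure \<Otimes>\<^sub>M lborel) ?F"
  proof (rule Bochner_Integration.integrable_bound[OF _ Fm, where f = "\<lambda>z. indicator (sphere 0 1 \<times> ball 0 1) z * B"])
    have "emeasure (sphere_measure \<Otimes>\<^sub>M lborel) (sphere (0::'a) 1 \<times> ball (0::'a) 1) =
       emeasure (sphere_measure :: 'a measure) (sphere 0 1) * emeasure lborel (ball (0::'a) 1)"
      by (intro lborel.emeasure_pair_measure_Times) (use sets.top[of "sphere_measure :: 'a measure"] in auto)
    also have "\<dots> < \<infinity>"
    proof -
      have "emeasure sphere_measure (sphere (0::'a) 1) < top"
        by (metis sphere.emeasure_finite less_top infinity_ennreal_def)
      then show ?thesis using emeasure_lborel_ball_finite[of "0::'a" 1] by (simp add: ennreal_mult_less_top)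
    qed
    finally show "integrable (sphere_measure \<Otimes>\<^sub>M lborel) (\<lambda>z::'a\<times>'a. indicator (sphere 0 1 \<times> ball 0 1) z * B)"
      using sets.top[of "sphere_measure :: 'a measure"]
      by (intro integrable_mult_left integrable_real_indicator) auto
    show "AE z in sphere_measure \<Otimes>\<^sub>M lborel. norm (?F z) \<le> norm (indicator (sphere 0 1 \<times> ball (0::'a) 1) z * B)"
      using f by (intro AE_I2) (fastforce simp: space_pair_measure indicator_def intro: order_trans[OF _ abs_ge_self])
  qed
  have F1: "ball_integral f \<theta> (\<phi> \<theta>) = (\<integral>y. ?H \<theta> y \<partial>lborel)" for \<theta>
    by (simp add: ball_integral_eq)
  have F2: "(\<integral>\<theta>. ?H \<theta> y \<partial>sphere_measure) = f y * measure sphere_measure {\<theta> \<in> sphere 0 1. (norm (y - \<theta>))\<^sup>2 < \<phi> \<theta>}" for y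
  proof -
    have "(\<integral>\<theta>. ?H \<theta> y \<partial>sphere_measure) = (\<integral>\<theta>. f y * indicator {\<theta> \<in> sphere 0 1. (norm (y - \<theta>))\<^sup>2 < \<phi> \<theta>} \<theta> \<partial>sphere_measure)"
      by (intro Bochner_Integration.integral_cong) (auto simp: indicator_def)
    also have "\<dots> = f y * measure sphere_measure ({\<theta> \<in> sphere 0 1. (norm (y - \<theta>))\<^sup>2 < \<phi> \<theta>} \<inter> space sphere_measure)"
      by simp
    also have "{\<theta> \<in> sphere 0 1. (norm (y - \<theta>))\<^sup>2 < \<phi> \<theta>} \<inter> space sphere_measure = {\<theta> \<in> sphere 0 1. (norm (y - \<theta>))\<^sup>2 < \<phi> \<theta>}"
      by auto
    finally show ?thesis .
  qed
  show ?A using integrable_fst[OF int] by (simp only: F1)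
  show ?B using integrable_snd[OF int] by (simp only: F2)
  show ?C using Fubini_integral[OF int] by (simp only: F1 F2)
qed

text \<open>The two points \<open>x\<close>, \<open>y\<close> see the same sphere point \<open>\<theta>\<close> at distances whose squares differ by an
  affine function of \<open>\<theta>\<close>; hence the cap.\<close>

lemma measure_norm_less_eq_cap:
  fixes x y :: "'a::euclidean_space"
  assumes "x \<noteq> y"
  shows "measure sphere_measure {\<theta> \<in> sphere 0 1. (norm (y - \<theta>))\<^sup>2 < (norm (x - \<theta>))\<^sup>2 + \<tau>} =
     cap_measure TYPE('a) (((norm y)\<^sup>2 - (norm x)\<^sup>2 - \<tau>) / (2 * norm (y - x)))"
proof -
  let ?w = "sgn (y - x)"
  have "(norm (y - \<theta>))\<^sup>2 < (norm (x - \<theta>))\<^sup>2 + \<tau> \<longleftrightarrow> \<theta> \<bullet> ?w > ((norm y)\<^sup>2 - (norm x)\<^sup>2 - \<tau>) / (2 * norm (y - x))" for \<theta>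
  proof -
    have d: "norm (y - x) > 0" using assms by simp
    have "(norm (y - \<theta>))\<^sup>2 - (norm (x - \<theta>))\<^sup>2 = (norm y)\<^sup>2 - (norm x)\<^sup>2 - 2 * (\<theta> \<bullet> (y - x))"
      unfolding power2_norm_eq_inner by (simp add: inner_diff_left inner_diff_right inner_commute)
    moreover have "\<theta> \<bullet> (y - x) = norm (y - x) * (\<theta> \<bullet> ?w)" using d by (simp add: sgn_div_norm)
    ultimately have "(norm (y - \<theta>))\<^sup>2 < (norm (x - \<theta>))\<^sup>2 + \<tau> \<longleftrightarrow> (norm y)\<^sup>2 - (norm x)\<^sup>2 - \<tau> < (\<theta> \<bullet> ?w) * (2 * norm (y - x))"
      by (simp add: algebra_simps) linarith
    then show ?thesis using d by (simp only: divide_less_eq) simp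
  qed
  then show ?thesis using measure_cap[of ?w] assms by (simp add: norm_sgn)
qed

text \<open>With d = |y - x|, the difference of the squared norms is below d (1 + |x|) in absolute
  value, while the limit is 2 d. The slack d (1 - |x|) is the admissible range of
  \<open>\<tau>\<close>; it is positive because \<open>x\<close> is inside the ball.\<close>

lemma cap_range:
  fixes x y :: "'a::euclidean_space"
  assumes "norm x < 1" "norm y < 1" "x \<noteq> y" "0 \<le> \<tau>" "\<tau> < (1 - norm x) * norm (y - x)"
  shows "-1 < ((norm y)\<^sup>2 - (norm x)\<^sup>2 - \<tau>) / (2 * norm (y - x))"
    and "((norm y)\<^sup>2 - (norm x)\<^sup>2 - \<tau>) / (2 * norm (y - x)) < 1"
proof -
  let ?d = "norm (y - x)"
  have d: "?d > 0" using assms by simp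
  have "(norm y)\<^sup>2 - (norm x)\<^sup>2 = (norm y - norm x) * (norm y + norm x)"
    by (simp add: power2_eq_square algebra_simps)
  moreover have "\<bar>norm y - norm x\<bar> \<le> ?d" by (rule norm_triangle_ineq3)
  ultimately have "\<bar>(norm y)\<^sup>2 - (norm x)\<^sup>2\<bar> \<le> ?d * (norm y + norm x)"
    by (simp add: abs_mult mult_right_mono)
  moreover have "?d * (norm y + norm x) < ?d * (1 + norm x)"
    using d assms by (intro mult_strict_left_mono) auto
  moreover have "?d * (1 + norm x) + (1 - norm x) * ?d = 2 * ?d" by (simp add: algebra_simps)
  moreover have "(1 - norm x) * ?d > 0" using d assms by simp
  ultimately have "- (2 * ?d) < (norm y)\<^sup>2 - (norm x)\<^sup>2 - \<tau>" "(norm y)\<^sup>2 - (norm x)\<^sup>2 - \<tau> < 2 * ?d"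
    using assms by linarith+
  then show "-1 < ((norm y)\<^sup>2 - (norm x)\<^sup>2 - \<tau>) / (2 * ?d)"
    and "((norm y)\<^sup>2 - (norm x)\<^sup>2 - \<tau>) / (2 * ?d) < 1"
    using d by (simp_all only: less_divide_eq divide_less_eq) simp_all
qed

lemma forward_diff_funpow_cmult: "(forward_diff a ^^ k) (\<lambda>\<tau>. c * g \<tau>) s = c * (forward_diff a ^^ k) g s"
  by (induction k arbitrary: s) (simp_all add: forward_diff_def right_diff_distrib)

text \<open>Both sides are limits of one sequence: the difference quotients of \<open>q\<close>
  integrated over the sphere equal those of \<open>G\<close> integrated against \<open>f\<close>.
  Smoothness enters only as an abstract chain \<open>e\<close> of derivatives of the ball integral
  whose last member is jointly continuous.\<close>

lemma integral_sphere_higher_derivative: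
  fixes f :: "'a::euclidean_space \<Rightarrow> real" and e :: "nat \<Rightarrow> 'a \<Rightarrow> real \<Rightarrow> real"
  assumes n: "DIM('a) = 2 * m + 3"
    and f[measurable]: "f \<in> borel_measurable borel" and fB: "\<And>y. \<bar>f y\<bar> \<le> B" "\<And>y. f y \<noteq> 0 \<Longrightarrow> norm y < 1"
    and e0: "e 0 = ball_integral f"
    and e: "\<And>i \<theta> s. i \<le> 2 * m \<Longrightarrow> s > 0 \<Longrightarrow> (e i \<theta> has_real_derivative e (Suc i) \<theta> s) (at s)"
    and econt: "continuous_on (UNIV \<times> {0<..}) (\<lambda>(\<theta>, s). e (2 * m + 1) \<theta> s)"
    and x: "norm x < 1"
  shows "(\<integral>\<theta>. e (2 * m + 1) \<theta> ((norm (x - \<theta>))\<^sup>2) \<partial>sphere_measure) =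
    sphere_area (2 * m + 2) * fact (2 * m) * (-1) ^ m / 2 ^ (2 * m + 1) * (\<integral>y. f y / norm (y - x) ^ (2 * m + 1) \<partial>lborel)"
proof -
  define N where "N = 2 * m + 1"
  define \<kappa> :: real where "\<kappa> = sphere_area (2 * m + 2) * fact (2 * m) * (-1) ^ m / 2 ^ (2 * m + 1)"
  define a where "a = (\<lambda>i. inverse (real (Suc i)))"
  have a: "a i > 0" "a i \<le> 1" for i by (auto simp: a_def field_simps)
  have alim: "a \<longlonglongrightarrow> 0" unfolding a_def by (rule LIMSEQ_inverse_real_of_nat)
  define s where "s = (\<lambda>\<theta>. (norm (x - \<theta>))\<^sup>2)"
  define G where "G = (\<lambda>y \<tau>. measure sphere_measure {\<theta> \<in> sphere 0 1. (norm (y - \<theta>))\<^sup>2 < s \<theta> + \<tau>})"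
  have smeas: "(\<lambda>\<theta>. s \<theta> + \<tau>) \<in> borel_measurable borel" for \<tau> unfolding s_def by measurable
  have swap: "integrable sphere_measure (\<lambda>\<theta>. ball_integral f \<theta> (s \<theta> + \<tau>))"
    "integrable lborel (\<lambda>y. f y * G y \<tau>)"
    "(\<integral>\<theta>. ball_integral f \<theta> (s \<theta> + \<tau>) \<partial>sphere_measure) = (\<integral>y. f y * G y \<tau> \<partial>lborel)" for \<tau>
    unfolding G_def using integral_sphere_ball_integral[OF f fB smeas, of \<tau>] by simp_all
  define q where "q = (\<lambda>\<theta> \<tau>. ball_integral f \<theta> (s \<theta> + \<tau>))"
  \<comment> \<open>Differences are finite sums, so Fubini passes through them without any
    smoothness of the cap area in \<open>\<tau>\<close>.\<close>
  have key: "(\<integral>\<theta>. (forward_diff (a i) ^^ N) (q \<theta>) 0 / a i ^ N \<partial>sphere_measure) =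
      (\<integral>y. f y * ((forward_diff (a i) ^^ N) (G y) 0 / a i ^ N) \<partial>lborel)" for i
  proof -
    have "(\<integral>\<theta>. (forward_diff (a i) ^^ N) (q \<theta>) 0 \<partial>sphere_measure) =
       (forward_diff (a i) ^^ N) (\<lambda>\<tau>. \<integral>\<theta>. q \<theta> \<tau> \<partial>sphere_measure) 0"
      using swap(1) by (intro integral_forward_diff_funpow) (simp add: q_def)
    also have "(\<lambda>\<tau>. \<integral>\<theta>. q \<theta> \<tau> \<partial>sphere_measure) = (\<lambda>\<tau>. \<integral>y. f y * G y \<tau> \<partial>lborel)"
      unfolding q_def swap(3) ..
    also have "(forward_diff (a i) ^^ N) \<dots> 0 = (\<integral>y. (forward_diff (a i) ^^ N) (\<lambda>\<tau>. f y * G y \<tau>) 0 \<partial>lborel)"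
      using swap(2) by (intro integral_forward_diff_funpow(2)[symmetric]) (simp add: G_def)
    also have "\<dots> = (\<integral>y. f y * (forward_diff (a i) ^^ N) (G y) 0 \<partial>lborel)"
      by (simp add: forward_diff_funpow_cmult)
    finally show ?thesis by simp
  qed
  \<comment> \<open>As \<open>x\<close> is inside the ball, squared distances to the sphere stay
    away from 0, beyond which the chain \<open>e\<close> is not differentiable by
    hypothesis.\<close>
  have s_range: "(1 - norm x)\<^sup>2 \<le> s \<theta>" "s \<theta> \<le> 4" if "\<theta> \<in> sphere 0 1" for \<theta>
  proof -
    have "1 - norm x \<le> norm (x - \<theta>)"
      using norm_triangle_ineq3[of \<theta> x] that by (simp add: norm_minus_commute)
    then show "(1 - norm x)\<^sup>2 \<le> s \<theta>" using x by (simp add: s_def power_mono)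
    have "norm (x - \<theta>) \<le> 2" using norm_triangle_ineq4[of x \<theta>] that x by simp
    then show "s \<theta> \<le> 4" using power_mono[of "norm (x - \<theta>)" 2 2] by (simp add: s_def)
  qed
  have s0: "(1 - norm x)\<^sup>2 > 0" using x by simp
  \<comment> \<open>A compact set containing every sampled point: \<open>N\<close> steps of length
    at most 1 raise the squared distance, itself at most 4, by at most \<open>N\<close>.\<close>
  define K where "K = sphere (0::'a) 1 \<times> {(1 - norm x)\<^sup>2..4 + real N}"
  have "0 < b" if "(1 - norm x)\<^sup>2 \<le> b" for b using less_le_trans[OF s0 that] .
  then have eK: "continuous_on K (\<lambda>(\<theta>, s). e N \<theta> s)"
    unfolding N_def K_def by (intro continuous_on_subset[OF econt]) auto
  have "compact ((\<lambda>(\<theta>, s). e N \<theta> s) ` K)"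
    by (intro compact_continuous_image eK) (auto simp: K_def compact_Times)
  then have "bounded ((\<lambda>(\<theta>, s). e N \<theta> s) ` K)" by (rule compact_imp_bounded)
  then obtain M where M: "\<forall>p\<in>K. \<bar>e N (fst p) (snd p)\<bar> \<le> M"
    unfolding bounded_iff by (auto simp: split_beta)
  have mv: "\<exists>\<xi>. 0 \<le> \<xi> \<and> \<xi> \<le> N * a i \<and> (forward_diff (a i) ^^ N) (q \<theta>) 0 = a i ^ N * e N \<theta> (s \<theta> + \<xi>)"
    if \<theta>: "\<theta> \<in> sphere 0 1" for i \<theta>
  proof -
    have "\<exists>\<xi>. 0 \<le> \<xi> \<and> \<xi> \<le> 0 + real N * a i \<and> (forward_diff (a i) ^^ N) ((\<lambda>j \<tau>. e j \<theta> (s \<theta> + \<tau>)) 0) 0 = a i ^ N * (\<lambda>j \<tau>. e j \<theta> (s \<theta> + \<tau>)) N \<xi>"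
    proof (rule forward_diff_mean_value[OF a(1)])
      fix j and \<tau> :: real assume j: "j < N" "0 \<le> \<tau>"
      have "s \<theta> + \<tau> > 0" using s_range(1)[OF \<theta>] s0 j by linarith
      then have "(e j \<theta> has_real_derivative e (Suc j) \<theta> (s \<theta> + \<tau>)) (at (s \<theta> + \<tau>))"
        using j by (intro e) (auto simp: N_def)
      then show "((\<lambda>\<tau>. e j \<theta> (s \<theta> + \<tau>)) has_real_derivative e (Suc j) \<theta> (s \<theta> + \<tau>)) (at \<tau>)"
        by (simp add: DERIV_shift add.commute)
    qed
    then show ?thesis by (simp add: e0 q_def)
  qed
  have inK: "(\<theta>, s \<theta> + \<xi>) \<in> K" if "\<theta> \<in> sphere 0 1" "0 \<le> \<xi>" "\<xi> \<le> N * a i" for \<theta> \<xi> i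
  proof -
    have "N * a i \<le> N" using a(2)[of i] by (simp add: mult_left_le)
    then show ?thesis using s_range[OF that(1)] that by (auto simp: K_def)
  qed
  have inK0: "(\<theta>, s \<theta>) \<in> K" if "\<theta> \<in> sphere 0 1" for \<theta>
    using inK[OF that, of 0 0] a(1)[of 0] by simp
  have "(\<lambda>i. \<integral>\<theta>. (forward_diff (a i) ^^ N) (q \<theta>) 0 / a i ^ N \<partial>sphere_measure) \<longlonglongrightarrow> (\<integral>\<theta>. e N \<theta> (s \<theta>) \<partial>sphere_measure)"
  proof (rule integral_dominated_convergence[where w = "\<lambda>_. M"])
    show "(\<lambda>\<theta>. e N \<theta> (s \<theta>)) \<in> borel_measurable sphere_measure"
      using inK0
      by (intro borel_measurable_integrable integrable_sphere_measure_continuous continuous_on_compose2[OF eK, of _ "\<lambda>\<theta>. (\<theta>, s \<theta>)", simplified])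
         (auto intro!: continuous_intros simp: s_def[abs_def])
    show "(\<lambda>\<theta>. (forward_diff (a i) ^^ N) (q \<theta>) 0 / a i ^ N) \<in> borel_measurable sphere_measure" for i
      using swap(1) by (intro borel_measurable_integrable integrable_divide integral_forward_diff_funpow(1)) (simp add: q_def)
    show "AE \<theta> in sphere_measure. (\<lambda>i. (forward_diff (a i) ^^ N) (q \<theta>) 0 / a i ^ N) \<longlonglongrightarrow> e N \<theta> (s \<theta>)"
    proof (rule AE_I2)
      fix \<theta> :: 'a assume "\<theta> \<in> space sphere_measure"
      then have \<theta>: "\<theta> \<in> sphere 0 1" by simp
      obtain \<xi> where \<xi>: "\<And>i. 0 \<le> \<xi> i" "\<And>i. \<xi> i \<le> N * a i" "\<And>i. (forward_diff (a i) ^^ N) (q \<theta>) 0 = a i ^ N * e N \<theta> (s \<theta> + \<xi> i)"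
        using mv[OF \<theta>] by metis
      have "(\<lambda>i. N * a i) \<longlonglongrightarrow> real N * 0" by (intro tendsto_intros alim)
      then have "\<xi> \<longlonglongrightarrow> 0" using \<xi>(1,2) by (intro tendsto_sandwich[of "\<lambda>_. 0" \<xi> _ "\<lambda>i. N * a i" 0]) auto
      then have "(\<lambda>i. (\<theta>, s \<theta> + \<xi> i)) \<longlonglongrightarrow> (\<theta>, s \<theta> + 0)" by (intro tendsto_intros)
      moreover have "\<forall>i. (\<theta>, s \<theta> + \<xi> i) \<in> K" using inK[OF \<theta>] \<xi> by blast
      moreover have "(\<theta>, s \<theta> + 0) \<in> K" using inK0[OF \<theta>] by simp
      ultimately have "(\<lambda>i. e N \<theta> (s \<theta> + \<xi> i)) \<longlonglongrightarrow> e N \<theta> (s \<theta> + 0)"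
        using continuous_on_tendsto_compose[OF eK, of "\<lambda>i. (\<theta>, s \<theta> + \<xi> i)" "(\<theta>, s \<theta> + 0)" sequentially] by simp
      then show "(\<lambda>i. (forward_diff (a i) ^^ N) (q \<theta>) 0 / a i ^ N) \<longlonglongrightarrow> e N \<theta> (s \<theta>)"
        using a(1) less_imp_neq[OF a(1)] by (simp add: \<xi>(3))
    qed
    show "AE \<theta> in sphere_measure. norm ((forward_diff (a i) ^^ N) (q \<theta>) 0 / a i ^ N) \<le> M" for i
    proof (rule AE_I2)
      fix \<theta> :: 'a assume "\<theta> \<in> space sphere_measure"
      then have \<theta>: "\<theta> \<in> sphere 0 1" by simp
      obtain \<xi> where \<xi>: "0 \<le> \<xi>" "\<xi> \<le> N * a i" "(forward_diff (a i) ^^ N) (q \<theta>) 0 = a i ^ N * e N \<theta> (s \<theta> + \<xi>)"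
        using mv[OF \<theta>] by metis
      show "norm ((forward_diff (a i) ^^ N) (q \<theta>) 0 / a i ^ N) \<le> M"
        using M inK[OF \<theta> \<xi>(1,2)] a(1)[of i] by (force simp: \<xi>(3))
    qed
  qed auto
  moreover have "(\<lambda>i. \<integral>y. f y * ((forward_diff (a i) ^^ N) (G y) 0 / a i ^ N) \<partial>lborel) \<longlonglongrightarrow> (\<integral>y. \<kappa> * (f y / norm (y - x) ^ N) \<partial>lborel)"
  proof -
    define A where "A = sphere_area DIM('a)"
    have A: "A \<ge> 0" by (simp add: A_def sphere_area_nonneg)
    \<comment> \<open>The first summand serves steps that are small compared with |y - x|, where the
      quotient is exact. The second serves all other steps, where each of the 2^N sampled cap areas
      is estimated by the total area \<open>A\<close>.\<close>
    define C where "C = \<bar>\<kappa>\<bar> + 2 ^ N * A * (N / (1 - norm x)) ^ N"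
    have Cpos: "2 ^ N * A * (N / (1 - norm x)) ^ N \<ge> 0" using A x by (intro mult_nonneg_nonneg) auto
    have exact: "(forward_diff (a i) ^^ N) (G y) 0 / a i ^ N = \<kappa> / norm (y - x) ^ N"
      if y: "norm y < 1" "y \<noteq> x" "N * a i < (1 - norm x) * norm (y - x)" for y i
    proof -
      have "(forward_diff (a i) ^^ N) (\<lambda>\<tau>. cap_measure TYPE('a) (((norm y)\<^sup>2 - (norm x)\<^sup>2 - \<tau>) / (2 * norm (y - x)))) 0
          = a i ^ N * (\<kappa> / norm (y - x) ^ N)"
        unfolding N_def \<kappa>_def
      proof (rule cap_forward_diff[OF n a(1)])
        fix \<tau> assume "0 \<le> \<tau>" "\<tau> \<le> real (2 * m + 1) * a i"
        then show "-1 < ((norm y)\<^sup>2 - (norm x)\<^sup>2 - \<tau>) / (2 * norm (y - x)) \<and> ((norm y)\<^sup>2 - (norm x)\<^sup>2 - \<tau>) / (2 * norm (y - x)) < 1"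
          using cap_range[of x y \<tau>] x y by (auto simp: N_def)
      qed (use y in auto)
      moreover have "G y = (\<lambda>\<tau>. cap_measure TYPE('a) (((norm y)\<^sup>2 - (norm x)\<^sup>2 - \<tau>) / (2 * norm (y - x))))"
        using y measure_norm_less_eq_cap[of x y] by (simp add: G_def s_def)
      ultimately show ?thesis using less_imp_neq[OF a(1)[of i]] by simp
    qed
    have bound: "\<bar>(forward_diff (a i) ^^ N) (G y) 0 / a i ^ N\<bar> \<le> C / norm (y - x) ^ N"
      if y: "norm y < 1" "y \<noteq> x" for y i
    proof (cases "N * a i < (1 - norm x) * norm (y - x)")
      case True
      then show ?thesis using Cpos by (simp add: exact[OF y True] C_def abs_divide divide_right_mono)
    next
      case False
      have d: "norm (y - x) > 0" using y by simp
      have "\<bar>(forward_diff (a i) ^^ N) (G y) 0\<bar> \<le> 2 ^ N * A"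
      proof (rule abs_forward_diff_funpow_le)
        show "\<bar>G y \<tau>\<bar> \<le> A" for \<tau>
          using sphere.bounded_measure[of "{\<theta> \<in> sphere 0 1. (norm (y - \<theta>))\<^sup>2 < s \<theta> + \<tau>}"]
          by (simp add: G_def A_def measure_sphere_measure_space)
      qed
      \<comment> \<open>The step is not small: 1 / a \<le> N / ((1 - |x|) |y - x|). The blow-up in
        the step is thus controlled by the kernel itself.\<close>
      moreover have "1 / a i ^ N \<le> (N / (1 - norm x)) ^ N / norm (y - x) ^ N"
      proof -
        have "(1 - norm x) * norm (y - x) \<le> N * a i" using False by simp
        then have "1 / a i \<le> N / (1 - norm x) / norm (y - x)" using x d a(1)[of i] by (simp add: field_simps)
        then have "(1 / a i) ^ N \<le> (N / (1 - norm x) / norm (y - x)) ^ N" using a(1)[of i] by (intro power_mono) auto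
        then show ?thesis by (simp add: power_divide power_mult_distrib)
      qed
      ultimately have "\<bar>(forward_diff (a i) ^^ N) (G y) 0\<bar> * (1 / a i ^ N) \<le> 2 ^ N * A * ((N / (1 - norm x)) ^ N / norm (y - x) ^ N)"
        using A a(1)[of i] by (intro mult_mono) auto
      also have "\<dots> \<le> C / norm (y - x) ^ N" by (simp add: C_def divide_right_mono)
      finally show ?thesis using a(1)[of i] by (simp add: abs_divide)
    qed
    \<comment> \<open>Radius 2 is enough, since \<open>x\<close> and every point where
      \<open>f\<close> is nonzero have norm below 1.\<close>
    have "integrable lborel (\<lambda>z::'a. indicator (ball 0 2) z * (1 / norm z ^ (DIM('a) - 2)))"
      using n by (intro integrable_newton_kernel) simp
    then have "integrable lborel (\<lambda>y::'a. indicator (ball 0 2) (-x + 1 *\<^sub>R y) * (1 / norm (-x + 1 *\<^sub>R y) ^ (DIM('a) - 2)))"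
      by (intro integrable_lborel_affine borel_measurable_times borel_measurable_indicator) simp_all
    then have int: "integrable lborel (\<lambda>y::'a. \<bar>B\<bar> * C * (indicator (ball 0 2) (y - x) * (1 / norm (y - x) ^ N)))"
      using n by (intro integrable_mult_right) (simp add: N_def)
    have bnd: "AE y in lborel. norm (f y * ((forward_diff (a i) ^^ N) (G y) 0 / a i ^ N)) \<le> \<bar>B\<bar> * C * (indicator (ball 0 2) (y - x) * (1 / norm (y - x) ^ N))" for i
    proof -
      have "AE y in lborel. y \<noteq> x" by (rule AE_lborel_singleton)
      then show ?thesis
      proof eventually_elim
        case (elim y)
        show ?case
        proof (cases "f y = 0")
          case False
          then have y: "norm y < 1" using fB by simp
          then have "norm (y - x) < 2" using norm_triangle_ineq4[of y x] x by linarith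
          moreover have "\<bar>f y\<bar> * \<bar>(forward_diff (a i) ^^ N) (G y) 0 / a i ^ N\<bar> \<le> \<bar>B\<bar> * (C / norm (y - x) ^ N)"
            using fB(1)[of y] bound[OF y elim] by (intro mult_mono) auto
          ultimately show ?thesis by (simp add: abs_mult)
        qed (use Cpos in \<open>simp add: C_def\<close>)
      qed
    qed
    show ?thesis
    proof (rule integral_dominated_convergence[OF _ _ int _ bnd])
      show "(\<lambda>y. \<kappa> * (f y / norm (y - x) ^ N)) \<in> borel_measurable lborel" by measurable
      have "integrable lborel (\<lambda>y. (forward_diff (a i) ^^ N) (\<lambda>\<tau>. f y * G y \<tau>) 0)" for i
        using swap(2) by (intro integral_forward_diff_funpow(1)) (simp add: G_def)
      then show "(\<lambda>y. f y * ((forward_diff (a i) ^^ N) (G y) 0 / a i ^ N)) \<in> borel_measurable lborel" for i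
        using borel_measurable_integrable[of lborel "\<lambda>y. f y * (forward_diff (a i) ^^ N) (G y) 0"]
        by (simp add: forward_diff_funpow_cmult)
      have "AE y in lborel. y \<noteq> x" by (rule AE_lborel_singleton)
      then show "AE y in lborel. (\<lambda>i. f y * ((forward_diff (a i) ^^ N) (G y) 0 / a i ^ N)) \<longlonglongrightarrow> \<kappa> * (f y / norm (y - x) ^ N)"
      proof eventually_elim
        case (elim y)
        show ?case
        proof (cases "f y = 0")
          case False
          then have y: "norm y < 1" using fB by simp
          have "(\<lambda>i. N * a i) \<longlonglongrightarrow> real N * 0" by (intro tendsto_intros alim)
          then have "\<forall>\<^sub>F i in sequentially. N * a i < (1 - norm x) * norm (y - x)"
            using x elim by (intro order_tendstoD(2)) auto
          then have "\<forall>\<^sub>F i in sequentially. f y * ((forward_diff (a i) ^^ N) (G y) 0 / a i ^ N) = \<kappa> * (f y / norm (y - x) ^ N)"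
            by eventually_elim (simp add: exact[OF y elim])
          then show ?thesis by (rule tendsto_eventually)
        qed simp
      qed
    qed
  qed
  ultimately have "(\<integral>\<theta>. e N \<theta> (s \<theta>) \<partial>sphere_measure) = (\<integral>y. \<kappa> * (f y / norm (y - x) ^ N) \<partial>lborel)"
    unfolding key by (rule LIMSEQ_unique)
  also have "\<dots> = \<kappa> * (\<integral>y. f y / norm (y - x) ^ N \<partial>lborel)" by (rule integral_mult_right_zero)
  finally show ?thesis unfolding N_def \<kappa>_def s_def .
qed

subsection \<open>The Laplacian of the Newtonian potential\<close>

definition dir_deriv :: "'a::euclidean_space \<Rightarrow> ('a \<Rightarrow> real) \<Rightarrow> 'a \<Rightarrow> real" where
  "dir_deriv b f x = frechet_derivative f (at x) b"

lemma C_infinity_dir_deriv: "C_infinity f \<Longrightarrow> C_infinity (dir_deriv b f)"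
  unfolding C_infinity_def dir_deriv_def[abs_def] by (metis C_k.simps(2))

lemma C_infinity_continuous: "C_infinity f \<Longrightarrow> continuous_on UNIV f"
  unfolding C_infinity_def using C_k_imp_continuous by blast

lemma dir_deriv_works:
  assumes "C_infinity f"
  shows "((\<lambda>s. f (x + s *\<^sub>R b)) has_real_derivative dir_deriv b f (x + s *\<^sub>R b)) (at s)"
proof -
  let ?F = "frechet_derivative f (at (x + s *\<^sub>R b))"
  have "C_k (Suc 0) f" using assms by (simp only: C_infinity_def)
  then have F: "(f has_derivative ?F) (at (x + s *\<^sub>R b))" by (simp add: frechet_derivative_works)
  have "((\<lambda>s. f (x + s *\<^sub>R b)) has_derivative (\<lambda>r. ?F (r *\<^sub>R b))) (at s)"
    using F by (intro has_derivative_compose[where g = f and f = "\<lambda>s. x + s *\<^sub>R b"]) (auto intro!: derivative_eq_intros)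
  moreover have "(\<lambda>r. ?F (r *\<^sub>R b)) = (*) (dir_deriv b f (x + s *\<^sub>R b))"
    by (simp add: fun_eq_iff dir_deriv_def linear_scale[OF has_derivative_linear[OF F]])
  ultimately show ?thesis by (simp add: has_field_derivative_def)
qed

text \<open>Vanishing is demanded on the open set \<open>norm y > 1\<close>, where it is inherited
  by derivatives and can be used again for the second one.\<close>

lemma dir_deriv_support:
  assumes "C_infinity f" "\<And>y. norm y > 1 \<Longrightarrow> f y = 0" "norm x > 1"
  shows "dir_deriv b f x = 0"
proof -
  have "\<forall>\<^sub>F s in nhds 0. 0 = f (x + s *\<^sub>R b)"
  proof -
    have "open ((\<lambda>s. x + s *\<^sub>R b) -` {y. norm y > 1})"
      by (intro open_vimage continuous_intros) (simp add: open_Collect_less continuous_intros)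
    from eventually_nhds_in_open[OF this, of 0] show ?thesis
      using assms by (auto elim!: eventually_mono)
  qed
  moreover have "((\<lambda>s::real. 0::real) has_real_derivative 0) (at 0)" by simp
  ultimately have "((\<lambda>s. f (x + s *\<^sub>R b)) has_real_derivative 0) (at 0)"
    by (rule has_real_derivative_eventually_cong[rotated])
  with dir_deriv_works[OF assms(1), of x b 0] show ?thesis by (auto dest: DERIV_unique)
qed

lemma continuous_compact_support_bounded:
  fixes f :: "'a::euclidean_space \<Rightarrow> real"
  assumes "continuous_on UNIV f" "\<And>y. norm y > r \<Longrightarrow> f y = 0"
  obtains B where "B \<ge> 0" "\<And>y. \<bar>f y\<bar> \<le> B"
proof -
  have "compact (f ` cball 0 r)"
    by (intro compact_continuous_image continuous_on_subset[OF assms(1)]) auto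
  then have "bounded (f ` cball 0 r)" by (rule compact_imp_bounded)
  then obtain B where B: "\<forall>y\<in>cball 0 r. \<bar>f y\<bar> \<le> B" unfolding bounded_iff by auto
  have "\<bar>f y\<bar> \<le> max B 0" for y
    using B assms(2)[of y] by (cases "norm y > r") (auto intro: le_max_iff_disj[THEN iffD2])
  then show ?thesis by (intro that[of "max B 0"]) auto
qed

lemma integrable_continuous_compact_support:
  fixes f :: "'a::euclidean_space \<Rightarrow> real"
  assumes "continuous_on UNIV f" "\<And>y. norm y > r \<Longrightarrow> f y = 0"
  shows "integrable lborel f"
proof -
  obtain B where B: "B \<ge> 0" "\<And>y. \<bar>f y\<bar> \<le> B" using continuous_compact_support_bounded[OF assms] by blast
  have [measurable]: "f \<in> borel_measurable borel" using assms(1) by (rule borel_measurable_continuous_onI)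
  have "integrable lborel (\<lambda>z. indicator (cball 0 r) z * f z)"
    using B by (intro integrable_bounded_on_ball) auto
  moreover have "(\<lambda>z. indicator (cball 0 r) z * f z) = f"
    using assms(2) by (auto simp: indicator_def fun_eq_iff not_le)
  ultimately show ?thesis by simp
qed

text \<open>The variable \<open>x\<close> sits in \<open>f\<close> and the singularity stays at
  \<open>z = 0\<close>, so that differentiation in \<open>x\<close> never meets the kernel.\<close>

definition newton_potential :: "('a::euclidean_space \<Rightarrow> real) \<Rightarrow> 'a \<Rightarrow> real" where
  "newton_potential f x = (\<integral>z. f (x - z) * (1 / norm z ^ (DIM('a) - 2)) \<partial>lborel)"

lemma newton_integrand_integrable:
  fixes f :: "'a::euclidean_space \<Rightarrow> real"
  assumes n: "DIM('a) \<ge> 3" and f: "continuous_on UNIV f" "\<And>y. norm y > 1 \<Longrightarrow> f y = 0"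
  shows "integrable lborel (\<lambda>z. f (x - z) * (1 / norm z ^ (DIM('a) - 2)))"
proof -
  obtain B where B: "B \<ge> 0" "\<And>y. \<bar>f y\<bar> \<le> B" using continuous_compact_support_bounded[OF f] by blast
  have [measurable]: "f \<in> borel_measurable borel" using f(1) by (rule borel_measurable_continuous_onI)
  show ?thesis
  proof (rule Bochner_Integration.integrable_bound[where f = "\<lambda>z. B * (indicator (ball 0 (norm x + 2)) z * (1 / norm z ^ (DIM('a) - 2)))"])
    show "AE z in lborel. norm (f (x - z) * (1 / norm z ^ (DIM('a) - 2))) \<le> norm (B * (indicator (ball 0 (norm x + 2)) z * (1 / norm z ^ (DIM('a) - 2))))"
    proof (rule AE_I2)
      fix z :: 'a
      show "norm (f (x - z) * (1 / norm z ^ (DIM('a) - 2))) \<le> norm (B * (indicator (ball 0 (norm x + 2)) z * (1 / norm z ^ (DIM('a) - 2))))"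
      proof (cases "norm z < norm x + 2")
        case True
        then show ?thesis using B(1) B(2)[of "x - z"] by (simp add: abs_mult divide_right_mono)
      next
        case False
        then have "norm (x - z) > 1" using norm_triangle_ineq2[of z x] by (simp add: norm_minus_commute)
        then show ?thesis using f(2) by simp
      qed
    qed
    show "integrable lborel (\<lambda>z::'a. B * (indicator (ball 0 (norm x + 2)) z * (1 / norm z ^ (DIM('a) - 2))))"
      by (intro integrable_mult_right integrable_newton_kernel[OF n])
  qed simp
qed

text \<open>The derivative falls on \<open>f\<close>. The radius in the dominating function is large
  enough for the supports of all translates with -1 < s < 1.\<close>

lemma newton_potential_deriv:
  fixes f :: "'a::euclidean_space \<Rightarrow> real"
  assumes n: "DIM('a) \<ge> 3" and f: "C_infinity f" "\<And>y. norm y > 1 \<Longrightarrow> f y = 0"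
  shows "((\<lambda>s. newton_potential f (x + s *\<^sub>R b)) has_real_derivative newton_potential (dir_deriv b f) x) (at 0)"
proof -
  let ?K = "\<lambda>z::'a. 1 / norm z ^ (DIM('a) - 2)"
  note f' = C_infinity_continuous[OF C_infinity_dir_deriv[OF f(1)]] dir_deriv_support[OF f]
  obtain B where B: "B \<ge> 0" "\<And>y. \<bar>dir_deriv b f y\<bar> \<le> B"
    using continuous_compact_support_bounded[OF f'(1), of 1 b] f'(2) by blast
  have "((\<lambda>s. \<integral>z. f (x + s *\<^sub>R b - z) * ?K z \<partial>lborel) has_real_derivative (\<integral>z. dir_deriv b f (x + 0 *\<^sub>R b - z) * ?K z \<partial>lborel)) (at 0)"
  proof (rule has_real_derivative_integral[where a = "-1" and b = 1 and w = "\<lambda>z. B * (indicator (ball 0 (norm x + norm b + 2)) z * ?K z)"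
      and q' = "\<lambda>s z. dir_deriv b f (x + s *\<^sub>R b - z) * ?K z"])
    show "integrable lborel (\<lambda>z. f (x + s *\<^sub>R b - z) * ?K z)" for s
      by (rule newton_integrand_integrable[OF n C_infinity_continuous[OF f(1)] f(2)])
    show "((\<lambda>s. f (x + s *\<^sub>R b - z) * ?K z) has_real_derivative dir_deriv b f (x + s *\<^sub>R b - z) * ?K z) (at s)" for s z
      using DERIV_cmult_right[OF dir_deriv_works[OF f(1), of "x - z" b s], of "?K z"] by (simp add: algebra_simps)
    have "integrable lborel (\<lambda>z. dir_deriv b f (x + 0 *\<^sub>R b - z) * ?K z)"
      by (rule newton_integrand_integrable[OF n f'(1)]) (rule f'(2))
    then show "(\<lambda>z. dir_deriv b f (x + 0 *\<^sub>R b - z) * ?K z) \<in> borel_measurable lborel" by (rule borel_measurable_integrable)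
    show "\<bar>dir_deriv b f (x + s *\<^sub>R b - z) * ?K z\<bar> \<le> B * (indicator (ball 0 (norm x + norm b + 2)) z * ?K z)"
      if s: "-1 < s" "s < 1" for s z
    proof (cases "norm z < norm x + norm b + 2")
      case True
      then show ?thesis using B(2)[of "x + s *\<^sub>R b - z"] by (simp add: abs_mult divide_right_mono)
    next
      case False
      have "\<bar>s\<bar> \<le> 1" using s by auto
      then have "norm (x + s *\<^sub>R b) \<le> norm x + norm b"
        using norm_triangle_ineq[of x "s *\<^sub>R b"] mult_right_mono[of "\<bar>s\<bar>" 1 "norm b"] by simp
      then have "norm (x + s *\<^sub>R b - z) > 1" using False norm_triangle_ineq2[of z "x + s *\<^sub>R b"] by (simp add: norm_minus_commute)
      then show ?thesis using f'(2) False by simp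
    qed
    show "integrable lborel (\<lambda>z. B * (indicator (ball 0 (norm x + norm b + 2)) z * ?K z))"
      by (intro integrable_mult_right integrable_newton_kernel[OF n])
  qed auto
  then show ?thesis by (simp add: newton_potential_def[abs_def])
qed

text \<open>By translation invariance \<open>\<integral>F (z + s *\<^sub>R b)\<close> does not depend on \<open>s\<close>.\<close>

lemma integral_dir_deriv_eq_0:
  fixes F F' :: "'a::euclidean_space \<Rightarrow> real"
  assumes F: "continuous_on UNIV F" "\<And>z. norm z > r \<Longrightarrow> F z = 0"
    and F': "continuous_on UNIV F'" "\<And>z. norm z > r \<Longrightarrow> F' z = 0"
    and der: "\<And>z. ((\<lambda>s. F (z + s *\<^sub>R b)) has_real_derivative F' z) (at 0)"
  shows "(\<integral>z. F' z \<partial>lborel) = 0"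
proof -
  obtain B' where B': "B' \<ge> 0" "\<And>y. \<bar>F' y\<bar> \<le> B'" using continuous_compact_support_bounded[OF F'] by blast
  have [measurable]: "F \<in> borel_measurable borel" "F' \<in> borel_measurable borel"
    using F(1) F'(1) by (auto intro: borel_measurable_continuous_onI)
  have int: "integrable lborel F" using F by (rule integrable_continuous_compact_support)
  have "((\<lambda>s. \<integral>z. F (z + s *\<^sub>R b) \<partial>lborel) has_real_derivative (\<integral>z. F' (z + 0 *\<^sub>R b) \<partial>lborel)) (at 0)"
  proof (rule has_real_derivative_integral[where a = "-1" and b = 1 and q' = "\<lambda>s z. F' (z + s *\<^sub>R b)"
        and w = "\<lambda>z. indicator (cball 0 (r + norm b)) z * B'"])
    show "integrable lborel (\<lambda>z. F (z + s *\<^sub>R b))" for s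
      using integrable_lborel_affine[OF _ _ int, of 1 "s *\<^sub>R b"] by (simp add: add.commute)
    show "((\<lambda>s. F (z + s *\<^sub>R b)) has_real_derivative F' (z + s *\<^sub>R b)) (at s)" for s z
    proof -
      have "((\<lambda>t. F (z + (s + t) *\<^sub>R b)) has_real_derivative F' (z + s *\<^sub>R b)) (at 0)"
        using der[of "z + s *\<^sub>R b"] by (simp add: algebra_simps)
      then show ?thesis using DERIV_shift[of "\<lambda>s. F (z + s *\<^sub>R b)" _ 0 s] by (simp add: add.commute)
    qed
    show "\<bar>F' (z + s *\<^sub>R b)\<bar> \<le> indicator (cball 0 (r + norm b)) z * B'" if s: "-1 < s" "s < 1" for s z
    proof (cases "norm z \<le> r + norm b")
      case False
      have "\<bar>s\<bar> \<le> 1" using s by auto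
      then have "norm (s *\<^sub>R b) \<le> norm b" using mult_right_mono[of "\<bar>s\<bar>" 1 "norm b"] by simp
      then have "norm (z + s *\<^sub>R b) > r" using False norm_triangle_ineq2[of z "- (s *\<^sub>R b)"] by simp
      then show ?thesis using F'(2) False by simp
    qed (use B' in auto)
    show "integrable lborel (\<lambda>z. indicator (cball 0 (r + norm b)) z * B')"
      by (intro integrable_mult_left integrable_real_indicator) (auto simp: emeasure_lborel_cball_finite[unfolded infinity_ennreal_def])
  qed auto
  moreover have "(\<integral>z. F (z + s *\<^sub>R b) \<partial>lborel) = (\<integral>z. F z \<partial>lborel)" for s
    using integral_lborel_affine[of F 1 "s *\<^sub>R b"] by (simp add: add.commute)
  ultimately have "((\<lambda>s::real. \<integral>z. F z \<partial>lborel) has_real_derivative (\<integral>z. F' z \<partial>lborel)) (at 0)" by simp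
  then show ?thesis using DERIV_const DERIV_unique by blast
qed

section \<open>The regularised kernel and its approximate identity\<close>

text \<open>For \<open>\<epsilon> > 0\<close> this is the Euclidean norm of (z, eps) in one more
  dimension: never 0, hence smooth in \<open>z\<close>, and decreasing to \<open>norm z\<close> with
  eps.\<close>

definition reg_norm :: "real \<Rightarrow> 'a::euclidean_space \<Rightarrow> real" where
  "reg_norm \<epsilon> z = sqrt ((norm z)\<^sup>2 + \<epsilon>\<^sup>2)"

lemma reg_norm_pos: "\<epsilon> > 0 \<Longrightarrow> reg_norm \<epsilon> z > 0"
  by (simp add: reg_norm_def add_nonneg_pos)

lemma reg_norm_power2: "(reg_norm \<epsilon> z)\<^sup>2 = (norm z)\<^sup>2 + \<epsilon>\<^sup>2"
  by (simp add: reg_norm_def)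

lemma continuous_on_reg_norm [continuous_intros]: "continuous_on S f \<Longrightarrow> continuous_on S (\<lambda>x. reg_norm \<epsilon> (f x))"
  unfolding reg_norm_def by (intro continuous_intros)

lemma reg_norm_deriv:
  assumes "\<epsilon> > 0"
  shows "((\<lambda>s. 1 / reg_norm \<epsilon> (z + s *\<^sub>R b) ^ j) has_real_derivative - real j * (z \<bullet> b) / reg_norm \<epsilon> z ^ (j + 2)) (at 0)"
proof -
  have R: "reg_norm \<epsilon> z > 0" using reg_norm_pos[OF assms] .
  have "((\<lambda>s. (norm (z + s *\<^sub>R b))\<^sup>2 + \<epsilon>\<^sup>2) has_real_derivative 2 * (z \<bullet> b)) (at 0)"
  proof -
    have "(norm (z + s *\<^sub>R b))\<^sup>2 = z \<bullet> z + 2 * s * (z \<bullet> b) + s\<^sup>2 * (b \<bullet> b)" for s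
      unfolding power2_norm_eq_inner
      by (simp add: inner_add_left inner_add_right inner_commute power2_eq_square algebra_simps)
    then show ?thesis by (auto intro!: derivative_eq_intros)
  qed
  moreover have "0 < (norm (z + 0 *\<^sub>R b))\<^sup>2 + \<epsilon>\<^sup>2" using assms by (simp add: add_nonneg_pos)
  ultimately have "((\<lambda>s. sqrt ((norm (z + s *\<^sub>R b))\<^sup>2 + \<epsilon>\<^sup>2)) has_real_derivative
      inverse (sqrt ((norm (z + 0 *\<^sub>R b))\<^sup>2 + \<epsilon>\<^sup>2)) / 2 * (2 * (z \<bullet> b))) (at 0)"
    by (intro DERIV_chain2[OF DERIV_real_sqrt])
  then have "((\<lambda>s. reg_norm \<epsilon> (z + s *\<^sub>R b)) has_real_derivative inverse (reg_norm \<epsilon> z) / 2 * (2 * (z \<bullet> b))) (at 0)"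
    unfolding reg_norm_def scaleR_zero_left add_0_right .
  moreover have "inverse (reg_norm \<epsilon> z) / 2 * (2 * (z \<bullet> b)) = (z \<bullet> b) / reg_norm \<epsilon> z"
    using R by (simp add: field_simps)
  ultimately have d: "((\<lambda>s. reg_norm \<epsilon> (z + s *\<^sub>R b)) has_real_derivative (z \<bullet> b) / reg_norm \<epsilon> z) (at 0)"
    by (simp only:)
  have "((\<lambda>y. 1 / y ^ j) has_real_derivative - real j / reg_norm \<epsilon> z ^ (j + 1)) (at (reg_norm \<epsilon> z))"
  proof (cases j)
    case (Suc i)
    have "((\<lambda>y. inverse y ^ j) has_real_derivative real j * (- (inverse (reg_norm \<epsilon> z) ^ Suc (Suc 0)) * inverse (reg_norm \<epsilon> z) ^ (j - Suc 0))) (at (reg_norm \<epsilon> z))"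
      using R by (intro DERIV_power DERIV_inverse) simp
    moreover have "real j * (- (inverse (reg_norm \<epsilon> z) ^ Suc (Suc 0)) * inverse (reg_norm \<epsilon> z) ^ (j - Suc 0)) = - real j / reg_norm \<epsilon> z ^ (j + 1)"
      unfolding mult_minus_left mult_minus_right minus_divide_left[symmetric] using R Suc by (simp add: field_simps)
    moreover have "(\<lambda>y. inverse y ^ j) = (\<lambda>y::real. 1 / y ^ j)" by (simp add: fun_eq_iff divide_inverse power_inverse)
    ultimately show ?thesis by (simp only:)
  qed simp
  then have "((\<lambda>y. 1 / y ^ j) has_real_derivative - real j / reg_norm \<epsilon> z ^ (j + 1)) (at (reg_norm \<epsilon> (z + 0 *\<^sub>R b)))" by simp
  from DERIV_chain2[OF this d] show ?thesis by (simp add: mult_ac)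
qed

lemma reg_norm_ge: "norm z \<le> reg_norm \<epsilon> z"
  unfolding reg_norm_def by (rule real_le_rsqrt) simp

text \<open>The integral over the ball of radius \<open>r\<close> has the closed form
  \<open>T r\<close>, found by comparing derivatives in \<open>r\<close>; letting \<open>r\<close>
  tend to infinity gives both integrability and the value.\<close>

lemma integral_bubble:
  shows "integrable lborel (\<lambda>z::'a::euclidean_space. DIM('a) / reg_norm 1 z ^ (DIM('a) + 2))"
    and "(\<integral>z. DIM('a) / reg_norm 1 (z::'a) ^ (DIM('a) + 2) \<partial>lborel) = sphere_area DIM('a)"
proof -
  let ?n = "DIM('a)"
  define \<sigma> where "\<sigma> = sphere_area ?n"
  define g where "g = (\<lambda>z::'a. ?n / reg_norm 1 z ^ (?n + 2))"
  have R1: "reg_norm 1 z \<ge> 1" for z :: 'a by (simp add: reg_norm_def)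
  have R0: "reg_norm 1 z > 0" for z :: 'a by (simp add: reg_norm_pos)
  have gc: "continuous_on UNIV g"
    unfolding g_def using less_imp_neq[OF R0] by (intro continuous_intros) (metis power_eq_0_iff)
  have [measurable]: "g \<in> borel_measurable borel" using gc by (rule borel_measurable_continuous_onI)
  have g: "0 \<le> g z" "g z \<le> ?n" for z
    using R1[of z] R0[of z] one_le_power[OF R1[of z], of "?n + 2"] by (auto simp: g_def divide_le_eq simp del: power_Suc power_add)
  have gint: "integrable lborel (\<lambda>z. indicator (ball 0 r) z * g z)" for r
    using g by (intro integrable_bounded_on_ball[where r = r and B = ?n]) auto
  define J where "J = (\<lambda>r. \<integral>z. indicator (ball 0 r) z * g z \<partial>lborel)"
  define Q where "Q = (\<lambda>r::real. sqrt (r\<^sup>2 + 1))"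
  have Q: "Q r > 0" "(Q r)\<^sup>2 = r\<^sup>2 + 1" for r by (auto simp: Q_def add_nonneg_pos)
  \<comment> \<open>The integrand is the divergence of z / R^n with R = \<open>reg_norm 1 z\<close>,
    and \<open>T r\<close> is the flux of this field through the sphere of radius
    \<open>r\<close>.\<close>
  define T where "T = (\<lambda>r. \<sigma> * (r / Q r) ^ ?n)"
  have dJ: "(J has_real_derivative r ^ (?n - 1) * (?n * \<sigma> / Q r ^ (?n + 2))) (at r)" if "r > 0" for r
  proof -
    have "(\<integral>s. g (r *\<^sub>R s) \<partial>sphere_measure) = (\<integral>s. ?n / Q r ^ (?n + 2) \<partial>(sphere_measure :: 'a measure))"
      using that by (intro Bochner_Integration.integral_cong) (auto simp: g_def Q_def reg_norm_def)
    also have "\<dots> = ?n * \<sigma> / Q r ^ (?n + 2)" by (simp add: \<sigma>_def measure_sphere_measure_space)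
    finally show ?thesis
      using has_real_derivative_integral_ball[OF gc that] by (simp add: J_def[abs_def])
  qed
  have dT: "(T has_real_derivative r ^ (?n - 1) * (?n * \<sigma> / Q r ^ (?n + 2))) (at r)" for r
  proof -
    have "(Q has_real_derivative r / Q r) (at r)"
      unfolding Q_def using add_nonneg_pos[OF zero_le_power2[of r] zero_less_one]
      by (auto intro!: derivative_eq_intros simp: field_simps)
    then have "((\<lambda>r. r / Q r) has_real_derivative (1 * Q r - r * (r / Q r)) / (Q r * Q r)) (at r)"
      using Q(1)[of r] by (intro DERIV_divide DERIV_ident) auto
    moreover have "(1 * Q r - r * (r / Q r)) / (Q r * Q r) = 1 / Q r ^ 3"
      using Q[of r] by (simp add: divide_simps power2_eq_square power3_eq_cube)
    ultimately have "((\<lambda>r. r / Q r) has_real_derivative 1 / Q r ^ 3) (at r)" by simp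
    from DERIV_cmult[OF DERIV_power[OF this, of ?n], of \<sigma>]
    have "(T has_real_derivative \<sigma> * (?n * (1 / Q r ^ 3 * (r / Q r) ^ (?n - Suc 0)))) (at r)"
      unfolding T_def .
    moreover have "Q r ^ (?n + 2) = Q r ^ 3 * Q r ^ (?n - Suc 0)"
      unfolding power_add[symmetric] using DIM_positive[where 'a = 'a] by (intro arg_cong[where f = "power (Q r)"]) simp
    ultimately show ?thesis by (simp add: power_divide mult_ac)
  qed
  have "\<exists>c. \<forall>r\<in>{0<..}. J r - T r = c"
  proof (rule has_field_derivative_zero_constant)
    fix r :: real assume "r \<in> {0<..}"
    then have "((\<lambda>r. J r - T r) has_real_derivative 0) (at r)"
      using DERIV_diff[OF dJ dT] by simp
    then show "((\<lambda>r. J r - T r) has_real_derivative 0) (at r within {0<..})"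
      by (rule has_field_derivative_at_within)
  qed simp
  then obtain c where c: "\<And>r. r > 0 \<Longrightarrow> J r - T r = c" by auto
  have inv: "(\<lambda>i. inverse (real (Suc i))) \<longlonglongrightarrow> 0" by (rule LIMSEQ_inverse_real_of_nat)
  \<comment> \<open>The constant is read off as \<open>r\<close> tends to 0: \<open>T 0 = 0\<close>,
    and the ball integral is at most of order r^n.\<close>
  have "c = 0"
  proof -
    let ?r = "\<lambda>i. inverse (real (Suc i))"
    define v where "v = unit_ball_vol (real ?n)"
    have Jb: "0 \<le> J r \<and> J r \<le> ?n * (v * r ^ ?n)" if "r > 0" for r
    proof
      show "0 \<le> J r" unfolding J_def using g by (intro Bochner_Integration.integral_nonneg) auto
      have "J r \<le> (\<integral>z. indicator (ball (0::'a) r) z * real ?n \<partial>lborel)"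
        unfolding J_def using g
        by (intro integral_mono gint integrable_mult_left integrable_real_indicator)
           (auto simp: emeasure_lborel_ball_finite[unfolded infinity_ennreal_def] indicator_def)
      also have "\<dots> = ?n * (v * r ^ ?n)" using that by (simp add: content_ball v_def)
      finally show "J r \<le> ?n * (v * r ^ ?n)" .
    qed
    have "(\<lambda>i. ?n * (v * ?r i ^ ?n)) \<longlonglongrightarrow> ?n * (v * 0 ^ ?n)" by (intro tendsto_intros inv)
    then have "(\<lambda>i. ?n * (v * ?r i ^ ?n)) \<longlonglongrightarrow> 0" by (simp add: zero_power)
    moreover have "0 \<le> J (?r i) \<and> J (?r i) \<le> ?n * (v * ?r i ^ ?n)" for i by (rule Jb) simp
    ultimately have "(\<lambda>i. J (?r i)) \<longlonglongrightarrow> 0"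
      by (intro tendsto_sandwich[of "\<lambda>_. 0" "\<lambda>i. J (?r i)" sequentially "\<lambda>i. ?n * (v * ?r i ^ ?n)" 0]) simp_all
    moreover have "(\<lambda>i. T (?r i)) \<longlonglongrightarrow> T 0"
      using isCont_tendsto_compose[OF DERIV_isCont[OF dT] inv] .
    ultimately have "(\<lambda>i. J (?r i) - T (?r i)) \<longlonglongrightarrow> 0 - T 0" by (intro tendsto_diff)
    moreover have "(\<lambda>i. J (?r i) - T (?r i)) = (\<lambda>_. c)" using c by (simp add: fun_eq_iff)
    ultimately have "c = 0 - T 0" using LIMSEQ_unique[OF tendsto_const] by metis
    then show ?thesis by (simp add: T_def)
  qed
  then have JT: "J r = T r" if "r > 0" for r using c[OF that] by simp
  have Jlim: "(\<lambda>i. J (real (Suc i))) \<longlonglongrightarrow> \<sigma>"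
  proof -
    \<comment> \<open>Dividing numerator and denominator by the radius makes the limit at infinity
      visible.\<close>
    have "J (real (Suc i)) = \<sigma> * (1 / sqrt (1 + (inverse (real (Suc i)))\<^sup>2)) ^ ?n" for i
    proof -
      let ?r = "real (Suc i)"
      have "?r\<^sup>2 + 1 = ?r\<^sup>2 * (1 + (inverse ?r)\<^sup>2)" by (simp add: distrib_left power_mult_distrib[symmetric])
      then have "Q ?r = ?r * sqrt (1 + (inverse ?r)\<^sup>2)" unfolding Q_def by (simp only: real_sqrt_mult real_sqrt_abs abs_of_nat)
      then have "?r / Q ?r = 1 / sqrt (1 + (inverse ?r)\<^sup>2)" by simp
      then show ?thesis using JT[of ?r] by (simp add: T_def)
    qed
    moreover have "(\<lambda>i. \<sigma> * (1 / sqrt (1 + (inverse (real (Suc i)))\<^sup>2)) ^ ?n) \<longlonglongrightarrow> \<sigma> * (1 / sqrt (1 + 0\<^sup>2)) ^ ?n"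
      by (intro tendsto_intros inv) simp
    ultimately show ?thesis by simp
  qed
  have mono: "AE z in lborel. mono (\<lambda>i. indicator (ball 0 (real (Suc i))) z * g z)"
    using g by (intro AE_I2 monoI mult_right_mono) (auto simp: indicator_def)
  have lim: "AE z in lborel. (\<lambda>i. indicator (ball 0 (real (Suc i))) z * g z) \<longlonglongrightarrow> g z"
  proof (rule AE_I2)
    fix z :: 'a
    obtain N :: nat where N: "norm z < N" using reals_Archimedean2 by blast
    have "indicator (ball 0 (real (Suc i))) z * g z = g z" if "i \<ge> N" for i
      using that N by (auto simp: indicator_def)
    then have "\<forall>\<^sub>F i in sequentially. indicator (ball 0 (real (Suc i))) z * g z = g z"
      by (auto simp: eventually_sequentially)
    then show "(\<lambda>i. indicator (ball 0 (real (Suc i))) z * g z) \<longlonglongrightarrow> g z" by (rule tendsto_eventually)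
  qed
  have Jlim': "(\<lambda>i. \<integral>z. indicator (ball 0 (real (Suc i))) z * g z \<partial>lborel) \<longlonglongrightarrow> \<sigma>"
    using Jlim by (simp add: J_def)
  have gm: "g \<in> borel_measurable lborel" by simp
  show "integrable lborel (\<lambda>z::'a. DIM('a) / reg_norm 1 z ^ (DIM('a) + 2))"
    using integrable_monotone_convergence[OF gint mono lim Jlim' gm] by (simp add: g_def)
  show "(\<integral>z. DIM('a) / reg_norm 1 (z::'a) ^ (DIM('a) + 2) \<partial>lborel) = sphere_area DIM('a)"
    using integral_monotone_convergence[OF gint mono lim Jlim' gm] by (simp add: g_def \<sigma>_def)
qed

text \<open>\<open>n * \<epsilon>\<^sup>2 / reg_norm \<epsilon> z ^ (n + 2)\<close> is, up to the factor \<open>2 - n\<close>, the Laplacian of the regularised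
  kernel \<open>1 / reg_norm \<epsilon> z ^ (n - 2)\<close>.\<close>

lemma bubble_approximate_identity:
  fixes f :: "'a::euclidean_space \<Rightarrow> real" and \<epsilon> :: "nat \<Rightarrow> real"
  assumes f: "continuous_on UNIV f" "\<And>y. \<bar>f y\<bar> \<le> B" and \<epsilon>: "\<And>i. \<epsilon> i > 0" "\<epsilon> \<longlonglongrightarrow> 0"
  shows "(\<lambda>i. \<integral>z. f (x - z) * (DIM('a) * (\<epsilon> i)\<^sup>2 / reg_norm (\<epsilon> i) z ^ (DIM('a) + 2)) \<partial>lborel)
     \<longlonglongrightarrow> f x * sphere_area DIM('a)"
proof -
  let ?n = "DIM('a)"
  let ?g = "\<lambda>z::'a. ?n / reg_norm 1 z ^ (?n + 2)"
  have [measurable]: "f \<in> borel_measurable borel" using f(1) by (rule borel_measurable_continuous_onI)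
  have [measurable]: "reg_norm e \<in> borel_measurable (borel :: 'a measure)" for e
    unfolding reg_norm_def[abs_def] by measurable
  have "(\<integral>z. f (x - z) * (?n * (\<epsilon> i)\<^sup>2 / reg_norm (\<epsilon> i) z ^ (?n + 2)) \<partial>lborel) = (\<integral>w. f (x - \<epsilon> i *\<^sub>R w) * ?g w \<partial>lborel)" for i
  proof -
    \<comment> \<open>\<open>reg_norm\<close> is homogeneous jointly in \<open>z\<close> and eps, so
      the substitution z = eps w reduces to eps = 1. The powers eps^n from the volume, eps^2 and
      eps^(-n-2) cancel.\<close>
    have R: "reg_norm (\<epsilon> i) (\<epsilon> i *\<^sub>R w) = \<epsilon> i * reg_norm 1 w" for w :: 'a
    proof -
      have "(norm (\<epsilon> i *\<^sub>R w))\<^sup>2 + (\<epsilon> i)\<^sup>2 = (\<epsilon> i)\<^sup>2 * ((norm w)\<^sup>2 + 1\<^sup>2)"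
        by (simp add: power_mult_distrib distrib_left)
      then show ?thesis using \<epsilon>(1)[of i] unfolding reg_norm_def by (simp only: real_sqrt_mult real_sqrt_abs abs_of_pos)
    qed
    have "(\<integral>z. f (x - z) * (?n * (\<epsilon> i)\<^sup>2 / reg_norm (\<epsilon> i) z ^ (?n + 2)) \<partial>lborel) =
       \<bar>\<epsilon> i\<bar> ^ ?n * (\<integral>w. f (x - (0 + \<epsilon> i *\<^sub>R w)) * (?n * (\<epsilon> i)\<^sup>2 / reg_norm (\<epsilon> i) (0 + \<epsilon> i *\<^sub>R w) ^ (?n + 2)) \<partial>lborel)"
      using \<epsilon>(1)[of i] by (intro integral_lborel_affine) auto
    also have "\<dots> = (\<integral>w. \<bar>\<epsilon> i\<bar> ^ ?n * (f (x - (0 + \<epsilon> i *\<^sub>R w)) * (?n * (\<epsilon> i)\<^sup>2 / reg_norm (\<epsilon> i) (0 + \<epsilon> i *\<^sub>R w) ^ (?n + 2))) \<partial>lborel)"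
      by (rule integral_mult_right_zero[symmetric])
    also have "\<dots> = (\<integral>w. f (x - \<epsilon> i *\<^sub>R w) * ?g w \<partial>lborel)"
    proof (rule Bochner_Integration.integral_cong[OF refl])
      fix w :: 'a
      have "\<bar>\<epsilon> i\<bar> ^ ?n * (?n * (\<epsilon> i)\<^sup>2 / reg_norm (\<epsilon> i) (0 + \<epsilon> i *\<^sub>R w) ^ (?n + 2)) = ?g w"
        using \<epsilon>(1)[of i] by (simp add: R power_mult_distrib power_add power2_eq_square)
      then show "\<bar>\<epsilon> i\<bar> ^ ?n * (f (x - (0 + \<epsilon> i *\<^sub>R w)) * (?n * (\<epsilon> i)\<^sup>2 / reg_norm (\<epsilon> i) (0 + \<epsilon> i *\<^sub>R w) ^ (?n + 2))) = f (x - \<epsilon> i *\<^sub>R w) * ?g w"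
        by (simp only: mult.left_commute[of "\<bar>\<epsilon> i\<bar> ^ ?n" "f (x - (0 + \<epsilon> i *\<^sub>R w))"]) (simp only: add_0_left)
    qed
    finally show ?thesis .
  qed
  moreover have "(\<lambda>i. \<integral>w. f (x - \<epsilon> i *\<^sub>R w) * ?g w \<partial>lborel) \<longlonglongrightarrow> (\<integral>w. f x * ?g w \<partial>lborel)"
  proof (rule integral_dominated_convergence[where w = "\<lambda>w. B * ?g w"])
    show "integrable lborel (\<lambda>w. B * ?g w)" by (intro integrable_mult_right integral_bubble)
    show "AE w in lborel. (\<lambda>i. f (x - \<epsilon> i *\<^sub>R w) * ?g w) \<longlonglongrightarrow> f x * ?g w"
    proof (rule AE_I2)
      fix w :: 'a
      have "(\<lambda>i. x - \<epsilon> i *\<^sub>R w) \<longlonglongrightarrow> x - 0 *\<^sub>R w" by (intro tendsto_intros \<epsilon>)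
      then have "(\<lambda>i. f (x - \<epsilon> i *\<^sub>R w)) \<longlonglongrightarrow> f x"
        using continuous_on_tendsto_compose[OF f(1), of "\<lambda>i. x - \<epsilon> i *\<^sub>R w" x sequentially] by simp
      then show "(\<lambda>i. f (x - \<epsilon> i *\<^sub>R w) * ?g w) \<longlonglongrightarrow> f x * ?g w" by (rule tendsto_mult_right)
    qed
    show "AE w in lborel. norm (f (x - \<epsilon> i *\<^sub>R w) * ?g w) \<le> B * ?g w" for i
    proof (rule AE_I2)
      fix w :: 'a
      have "?g w \<ge> 0" using reg_norm_pos[of 1 w] by simp
      then show "norm (f (x - \<epsilon> i *\<^sub>R w) * ?g w) \<le> B * ?g w"
        unfolding real_norm_def abs_mult using f(2) by (simp only: abs_of_nonneg) (intro mult_right_mono)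
    qed
  qed auto
  moreover have "(\<integral>w. f x * ?g w \<partial>lborel) = f x * sphere_area ?n"
    by (subst integral_mult_right_zero) (simp only: integral_bubble(2))
  ultimately show ?thesis by simp
qed

text \<open>Two integrations by parts along \<open>b\<close> in one step. \<open>F\<close> is the
  one-directional Green expression: in its derivative the two mixed terms cancel, because
  \<open>f\<close> is reflected in \<open>f (x - z)\<close>, and the difference of the two
  integrands remains.\<close>

lemma integral_dir_deriv2_reg_kernel:
  fixes f :: "'a::euclidean_space \<Rightarrow> real"
  assumes f: "C_infinity f" "\<And>y. norm y > 1 \<Longrightarrow> f y = 0" and \<epsilon>: "\<epsilon> > 0" and b: "norm b = 1"
  shows "(\<integral>z. dir_deriv b (dir_deriv b f) (x - z) * (1 / reg_norm \<epsilon> z ^ k) \<partial>lborel) =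
     (\<integral>z. f (x - z) * (real k * (real (k + 2) * (z \<bullet> b)\<^sup>2 / reg_norm \<epsilon> z ^ (k + 4) - 1 / reg_norm \<epsilon> z ^ (k + 2))) \<partial>lborel)"
proof -
  let ?D = "dir_deriv b f" and ?D2 = "dir_deriv b (dir_deriv b f)"
  note D = C_infinity_dir_deriv[OF f(1), of b] 
  note D0 = dir_deriv_support[OF f, of _ b]
  have D2: "C_infinity ?D2" using D by (rule C_infinity_dir_deriv)
  have D20: "norm y > 1 \<Longrightarrow> ?D2 y = 0" for y using D D0 by (rule dir_deriv_support)
  define g where "g = (\<lambda>z::'a. 1 / reg_norm \<epsilon> z ^ k)"
  define g1 where "g1 = (\<lambda>z. - real k * (z \<bullet> b) / reg_norm \<epsilon> z ^ (k + 2))"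
  define g2 where "g2 = (\<lambda>z. real k * (real (k + 2) * (z \<bullet> b)\<^sup>2 / reg_norm \<epsilon> z ^ (k + 4) - 1 / reg_norm \<epsilon> z ^ (k + 2)))"
  have R: "reg_norm \<epsilon> z ^ j \<noteq> 0" for z :: 'a and j using reg_norm_pos[OF \<epsilon>, of z] by simp
  have c: "continuous_on UNIV g" "continuous_on UNIV g1" "continuous_on UNIV g2"
    unfolding g_def g1_def g2_def using R by (intro continuous_intros; blast)+
  have cf: "continuous_on UNIV (\<lambda>z. h (x - z))" if "C_infinity h" for h :: "'a \<Rightarrow> real"
    using C_infinity_continuous[OF that] by (rule continuous_on_compose2) (auto intro!: continuous_intros)
  have far: "norm (x - z) > 1" if "norm z > norm x + 1" for z
    using that norm_triangle_ineq2[of z x] by (simp add: norm_minus_commute)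
  have dg: "((\<lambda>s. g (z + s *\<^sub>R b)) has_real_derivative g1 z) (at 0)" for z
    unfolding g_def g1_def by (rule reg_norm_deriv[OF \<epsilon>])
  have dg1: "((\<lambda>s. g1 (z + s *\<^sub>R b)) has_real_derivative g2 z) (at 0)" for z
  proof -
    have "((\<lambda>s. - real k * ((z + s *\<^sub>R b) \<bullet> b)) has_real_derivative - real k) (at 0)"
      using b by (auto intro!: derivative_eq_intros simp: inner_add_left dot_square_norm)
    note d = DERIV_mult[OF this reg_norm_deriv[OF \<epsilon>, of z b "k + 2"]]
    have "k + 2 + 2 = k + 4" by simp
    note d = d[unfolded this scaleR_zero_left add_0_right]
    then have "((\<lambda>s. - real k * ((z + s *\<^sub>R b) \<bullet> b) * (1 / reg_norm \<epsilon> (z + s *\<^sub>R b) ^ (k + 2))) has_real_derivative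
       - real k * (1 / reg_norm \<epsilon> z ^ (k + 2)) + - real (k + 2) * (z \<bullet> b) / reg_norm \<epsilon> z ^ (k + 4) * (- real k * (z \<bullet> b))) (at 0)"
      using d by blast
    moreover have "- real k * (1 / reg_norm \<epsilon> z ^ (k + 2)) + - real (k + 2) * (z \<bullet> b) / reg_norm \<epsilon> z ^ (k + 4) * (- real k * (z \<bullet> b)) = g2 z"
      unfolding g2_def by (simp add: algebra_simps power2_eq_square)
    moreover have "(\<lambda>s. - real k * ((z + s *\<^sub>R b) \<bullet> b) * (1 / reg_norm \<epsilon> (z + s *\<^sub>R b) ^ (k + 2))) = (\<lambda>s. g1 (z + s *\<^sub>R b))"
      by (simp add: g1_def fun_eq_iff)
    ultimately show ?thesis by (simp only:)
  qed
  have df: "((\<lambda>s. h (x - (z + s *\<^sub>R b))) has_real_derivative - dir_deriv b h (x - z)) (at 0)" if "C_infinity h" for h z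
  proof -
    have "((\<lambda>s. h (x - z + s *\<^sub>R b)) has_real_derivative dir_deriv b h (x - z)) (at (- 0))"
      using dir_deriv_works[OF that, of "x - z" b 0] by simp
    from DERIV_chain2[OF this DERIV_minus[OF DERIV_ident]] show ?thesis by (simp add: algebra_simps)
  qed
  define F where "F = (\<lambda>z. ?D (x - z) * g z + f (x - z) * g1 z)"
  define F' where "F' = (\<lambda>z. f (x - z) * g2 z - ?D2 (x - z) * g z)"
  have "(\<integral>z. F' z \<partial>lborel) = 0"
  proof (rule integral_dir_deriv_eq_0[where F = F and r = "norm x + 1" and b = b])
    show "continuous_on UNIV F" "continuous_on UNIV F'"
      unfolding F_def F'_def by (intro continuous_intros c cf f D D2)+
    show "F z = 0" "F' z = 0" if "norm z > norm x + 1" for z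
      using far[OF that] f(2) D0 D20 by (auto simp: F_def F'_def)
    show "((\<lambda>s. F (z + s *\<^sub>R b)) has_real_derivative F' z) (at 0)" for z
    proof -
      have "((\<lambda>s. ?D (x - (z + s *\<^sub>R b)) * g (z + s *\<^sub>R b) + f (x - (z + s *\<^sub>R b)) * g1 (z + s *\<^sub>R b)) has_real_derivative
         (- ?D2 (x - z) * g (z + 0 *\<^sub>R b) + g1 z * ?D (x - (z + 0 *\<^sub>R b))) + (- ?D (x - z) * g1 (z + 0 *\<^sub>R b) + g2 z * f (x - (z + 0 *\<^sub>R b)))) (at 0)"
        by (intro DERIV_add DERIV_mult df dg dg1 f D)
      then show ?thesis by (simp add: F_def F'_def algebra_simps)
    qed
  qed
  moreover have "integrable lborel (\<lambda>z. f (x - z) * g2 z)" "integrable lborel (\<lambda>z. ?D2 (x - z) * g z)"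
    by (rule integrable_continuous_compact_support[where r = "norm x + 1"];
        use far f(2) D20 in \<open>auto intro!: continuous_intros c cf f D2\<close>)+
  ultimately have "(\<integral>z. f (x - z) * g2 z \<partial>lborel) = (\<integral>z. ?D2 (x - z) * g z \<partial>lborel)"
    unfolding F'_def by simp
  then show ?thesis unfolding g_def g2_def by simp
qed

text \<open>Two limits of one sequence as eps tends to 0. With the derivatives on \<open>f\<close>,
  the regularised integrals tend to the left side; with the derivatives moved to the kernel and
  summed over the basis, they are \<open>- (n - 2)\<close> times the approximate identity applied to
  \<open>f\<close>.\<close>

lemma laplacian_newton_potential:
  fixes f :: "'a::euclidean_space \<Rightarrow> real"
  assumes n: "DIM('a) \<ge> 3" and f: "C_infinity f" "\<And>y. norm y > 1 \<Longrightarrow> f y = 0"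
  shows "(\<Sum>b\<in>Basis. newton_potential (dir_deriv b (dir_deriv b f)) x) = - (real DIM('a) - 2) * sphere_area DIM('a) * f x"
proof -
  let ?n = "DIM('a)"
  define k where "k = ?n - 2"
  have k: "?n = k + 2" "real k = real ?n - 2" using n by (auto simp: k_def)
  define \<epsilon> where "\<epsilon> = (\<lambda>i. inverse (real (Suc i)))"
  have \<epsilon>: "\<epsilon> i > 0" "\<epsilon> \<longlonglongrightarrow> 0" for i
    unfolding \<epsilon>_def by (simp, rule LIMSEQ_inverse_real_of_nat)
  have [measurable]: "reg_norm e \<in> borel_measurable (borel :: 'a measure)" for e
    unfolding reg_norm_def[abs_def] by measurable
  let ?D2 = "\<lambda>b. dir_deriv b (dir_deriv b f)"
  have D2: "C_infinity (?D2 b)" for b using f(1) by (intro C_infinity_dir_deriv)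
  have D20: "?D2 b y = 0" if "norm y > 1" for b y
    using that f by (intro dir_deriv_support C_infinity_dir_deriv)
  have [measurable]: "?D2 b \<in> borel_measurable borel" for b
    by (intro borel_measurable_continuous_onI C_infinity_continuous D2)
  have "(\<lambda>i. \<integral>z. ?D2 b (x - z) * (1 / reg_norm (\<epsilon> i) z ^ k) \<partial>lborel) \<longlonglongrightarrow> newton_potential (?D2 b) x" for b
    unfolding newton_potential_def k_def[symmetric]
  \<comment> \<open>The singular kernel dominates all regularised ones, since
    \<open>norm z \<le> reg_norm (\<epsilon> i) z\<close>.\<close>
  proof (rule integral_dominated_convergence[where w = "\<lambda>z. \<bar>?D2 b (x - z) * (1 / norm z ^ k)\<bar>"])
    show "integrable lborel (\<lambda>z. \<bar>?D2 b (x - z) * (1 / norm z ^ k)\<bar>)"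
      using newton_integrand_integrable[OF n C_infinity_continuous[OF D2, of b] D20, of x]
      unfolding k_def by (intro integrable_abs) simp
    have ae: "AE z in lborel. z \<noteq> (0::'a)" by (rule AE_lborel_singleton)
    then show "AE z in lborel. (\<lambda>i. ?D2 b (x - z) * (1 / reg_norm (\<epsilon> i) z ^ k)) \<longlonglongrightarrow> ?D2 b (x - z) * (1 / norm z ^ k)"
    proof eventually_elim
      case (elim z)
      have "(\<lambda>i. reg_norm (\<epsilon> i) z) \<longlonglongrightarrow> sqrt ((norm z)\<^sup>2 + 0\<^sup>2)"
        unfolding reg_norm_def by (intro tendsto_intros \<epsilon>)
      then have "(\<lambda>i. reg_norm (\<epsilon> i) z) \<longlonglongrightarrow> norm z" by simp
      then show ?case using elim by (intro tendsto_intros) auto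
    qed
    show "AE z in lborel. norm (?D2 b (x - z) * (1 / reg_norm (\<epsilon> i) z ^ k)) \<le> \<bar>?D2 b (x - z) * (1 / norm z ^ k)\<bar>" for i
      using ae
    proof eventually_elim
      case (elim z)
      have "1 / reg_norm (\<epsilon> i) z ^ k \<le> 1 / norm z ^ k"
        using elim reg_norm_ge[of z "\<epsilon> i"] reg_norm_pos[OF \<epsilon>(1)[of i], of z]
        by (intro divide_left_mono power_mono mult_pos_pos zero_less_power) auto
      then have "\<bar>?D2 b (x - z)\<bar> * (1 / reg_norm (\<epsilon> i) z ^ k) \<le> \<bar>?D2 b (x - z)\<bar> * (1 / norm z ^ k)"
        by (intro mult_left_mono) auto
      then show ?case using reg_norm_pos[OF \<epsilon>(1)[of i], of z] by (simp add: abs_mult)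
    qed
  qed auto
  then have "(\<lambda>i. \<Sum>b\<in>Basis. \<integral>z. ?D2 b (x - z) * (1 / reg_norm (\<epsilon> i) z ^ k) \<partial>lborel) \<longlonglongrightarrow> (\<Sum>b\<in>Basis. newton_potential (?D2 b) x)"
    by (intro tendsto_sum)
  moreover have "(\<Sum>b\<in>Basis. \<integral>z. ?D2 b (x - z) * (1 / reg_norm (\<epsilon> i) z ^ k) \<partial>lborel) =
      - real k * (\<integral>z. f (x - z) * (?n * (\<epsilon> i)\<^sup>2 / reg_norm (\<epsilon> i) z ^ (?n + 2)) \<partial>lborel)" for i
  proof -
    let ?R = "reg_norm (\<epsilon> i) :: 'a \<Rightarrow> real"
    let ?g2 = "\<lambda>b z. real k * (real (k + 2) * (z \<bullet> b)\<^sup>2 / ?R z ^ (k + 4) - 1 / ?R z ^ (k + 2))"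
    have R: "?R z > 0" for z by (rule reg_norm_pos[OF \<epsilon>(1)])
    have "(\<Sum>b\<in>Basis. \<integral>z. ?D2 b (x - z) * (1 / ?R z ^ k) \<partial>lborel) = (\<Sum>b\<in>Basis. \<integral>z. f (x - z) * ?g2 b z \<partial>lborel)"
      by (intro sum.cong refl integral_dir_deriv2_reg_kernel f \<epsilon>) simp_all
    also have "\<dots> = (\<integral>z. (\<Sum>b\<in>Basis. f (x - z) * ?g2 b z) \<partial>lborel)"
    proof (intro Bochner_Integration.integral_sum[symmetric] integrable_continuous_compact_support[where r = "norm x + 1"])
      fix b :: 'a
      have R': "?R z ^ j \<noteq> 0" for z j using R[of z] by simp
      show "continuous_on UNIV (\<lambda>z. f (x - z) * ?g2 b z)"
        by (intro continuous_on_mult continuous_on_compose2[OF C_infinity_continuous[OF f(1)]] continuous_intros) (use R' in auto)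
      show "f (x - z) * ?g2 b z = 0" if "norm z > norm x + 1" for z
      proof -
        have "norm (x - z) > 1" using that norm_triangle_ineq2[of z x] by (simp add: norm_minus_commute)
        then show ?thesis using f(2) by simp
      qed
    qed
    also have "\<dots> = (\<integral>z. - real k * (f (x - z) * (?n * (\<epsilon> i)\<^sup>2 / ?R z ^ (?n + 2))) \<partial>lborel)"
    proof (rule Bochner_Integration.integral_cong[OF refl])
      fix z :: 'a
      have "(\<Sum>b\<in>Basis. (z \<bullet> b)\<^sup>2) = (norm z)\<^sup>2"
        unfolding power2_norm_eq_inner by (subst euclidean_inner) (simp add: power2_eq_square)
      then have "(\<Sum>b\<in>Basis. ?g2 b z) = real k * (real (k + 2) * (norm z)\<^sup>2 / ?R z ^ (k + 4) - ?n / ?R z ^ (k + 2))"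
        by (simp add: sum_distrib_left[symmetric] sum_subtractf sum_divide_distrib[symmetric])
      \<comment> \<open>Here k + 2 = n, so over the common power k + 4 the numerator is n times
        |z|^2 - R^2 = - eps^2.\<close>
      also have "\<dots> = real k * (?n * ((norm z)\<^sup>2 - (?R z)\<^sup>2) / ?R z ^ (k + 4))"
      proof -
        have "?n / ?R z ^ (k + 2) = ?n * (?R z)\<^sup>2 / ?R z ^ (k + 4)"
          using R[of z] by (simp add: power_add power2_eq_square numeral_eq_Suc)
        then show ?thesis by (simp add: k(1) right_diff_distrib diff_divide_distrib)
      qed
      also have "\<dots> = - real k * (?n * (\<epsilon> i)\<^sup>2 / ?R z ^ (?n + 2))"
      proof -
        have "(norm z)\<^sup>2 - (?R z)\<^sup>2 = - (\<epsilon> i)\<^sup>2" by (simp add: reg_norm_power2)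
        moreover have "k + 4 = ?n + 2" using k by simp
        ultimately show ?thesis
          by (simp only: mult_minus_right mult_minus_left minus_divide_left[symmetric])
      qed
      finally show "(\<Sum>b\<in>Basis. f (x - z) * ?g2 b z) = - real k * (f (x - z) * (?n * (\<epsilon> i)\<^sup>2 / ?R z ^ (?n + 2)))"
        by (simp only: sum_distrib_left[symmetric]) (simp only: mult.left_commute)
    qed
    also have "\<dots> = - real k * (\<integral>z. f (x - z) * (?n * (\<epsilon> i)\<^sup>2 / ?R z ^ (?n + 2)) \<partial>lborel)"
      by (rule integral_mult_right_zero)
    finally show ?thesis .
  qed
  moreover obtain B where B: "\<And>y. \<bar>f y\<bar> \<le> B"
    using continuous_compact_support_bounded[OF C_infinity_continuous[OF f(1)] f(2)] by blast
  have "(\<lambda>i. - real k * (\<integral>z. f (x - z) * (?n * (\<epsilon> i)\<^sup>2 / reg_norm (\<epsilon> i) z ^ (?n + 2)) \<partial>lborel)) \<longlonglongrightarrow> - real k * (f x * sphere_area ?n)"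
    by (intro tendsto_mult tendsto_const bubble_approximate_identity[OF C_infinity_continuous[OF f(1)] B] \<epsilon>)
  ultimately have "(\<Sum>b\<in>Basis. newton_potential (?D2 b) x) = - real k * (f x * sphere_area ?n)"
    using LIMSEQ_unique by auto
  then show ?thesis by (simp add: k(2) mult.assoc mult.commute)
qed

subsection \<open>The inversion formula\<close>

text \<open>The duplication formula at half-integers, cleared of denominators; it follows from the
  recursion of Gamma and the value at 1/2.\<close>

lemma Gamma_half_odd: "Gamma (real m + 3 / 2) * (2 ^ (2 * m + 1) * fact m) = sqrt pi * fact (2 * m + 1)"
proof (induction m)
  case 0
  have "Gamma (1 / 2 + 1 :: real) = 1 / 2 * Gamma (1 / 2)" using nonpos_Ints_nonpos[of "1 / 2 :: real"] by (intro Gamma_plus1) auto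
  then show ?case by (simp add: Gamma_one_half_real)
next
  case (Suc m)
  have "real m + 3 / 2 \<notin> \<int>\<^sub>\<le>\<^sub>0" using nonpos_Ints_nonpos[of "real m + 3 / 2"] by auto
  then have "Gamma (real m + 3 / 2 + 1) = (real m + 3 / 2) * Gamma (real m + 3 / 2)" by (rule Gamma_plus1)
  then have "Gamma (real (Suc m) + 3 / 2) * (2 ^ (2 * Suc m + 1) * fact (Suc m)) =
     (real m + 3 / 2) * 4 * (real m + 1) * (Gamma (real m + 3 / 2) * (2 ^ (2 * m + 1) * fact m))"
    by (simp add: algebra_simps)
  also have "\<dots> = sqrt pi * ((2 * real m + 3) * (2 * real m + 2) * fact (2 * m + 1))"
    unfolding Suc.IH by (simp add: algebra_simps)
  also have "(2 * real m + 3) * (2 * real m + 2) * fact (2 * m + 1) = fact (2 * Suc m + 1)"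
  proof -
    have "fact (2 * Suc m + 1) = real (2 * m + 3) * (real (2 * m + 2) * fact (2 * m + 1))"
      using fact_Suc[of "2 * m + 2"] fact_Suc[of "2 * m + 1"] by (simp add: numeral_eq_Suc)
    then show ?thesis by (simp add: add.commute)
  qed
  finally show ?case .
qed

text \<open>The first factor is c_n with n/2 = m + 3/2. The second collects twice the constant of
  the cap derivative, from the backprojection, and -(n - 2), from the Laplacian; the total area of
  the sphere, present in both with opposite powers, has already cancelled.\<close>

lemma inversion_constant:
  "(-1) ^ (m + 1) / (4 * pi powr (real m + 1 / 2) * Gamma (real m + 3 / 2)) *
    (2 * (sphere_area (2 * m + 2) * fact (2 * m) * (-1) ^ m / 2 ^ (2 * m + 1)) * (- (2 * real m + 1))) = 1"
proof -
  have G: "Gamma (real m + 3 / 2) > 0" by (rule Gamma_real_pos) simp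
  have A: "sphere_area (2 * m + 2) = 2 * pi powr (real m + 1) / fact m"
  proof -
    have "real (2 * m + 2) / 2 = real m + 1" by simp
    moreover have "Gamma (real m + 1) = fact m" using Gamma_fact[of m, where 'a = real] by (simp add: add.commute)
    ultimately show ?thesis unfolding sphere_area_def by (simp only:)
  qed
  have P: "pi powr (real m + 1) = pi powr (real m + 1 / 2) * sqrt pi"
    by (simp add: powr_half_sqrt[symmetric] powr_add[symmetric] add.commute)
  have s: "(-1) ^ (m + 1) * (-1) ^ m = (-1 :: real)" by (simp add: power_add[symmetric] mult_2[symmetric])
  have "(2 * real m + 1) * fact (2 * m) = fact (2 * m + 1)" by simp
  then have Gm: "Gamma (real m + 3 / 2) * (2 ^ (2 * m + 1) * fact m) = sqrt pi * ((2 * real m + 1) * fact (2 * m))"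
    using Gamma_half_odd[of m] by simp
  let ?p = "pi powr (real m + 1 / 2)"
  have "(-1) ^ (m + 1) / (4 * ?p * Gamma (real m + 3 / 2)) *
    (2 * (sphere_area (2 * m + 2) * fact (2 * m) * (-1) ^ m / 2 ^ (2 * m + 1)) * (- (2 * real m + 1))) =
    - ((-1) ^ (m + 1) * (-1) ^ m) * (4 * ?p * (sqrt pi * ((2 * real m + 1) * fact (2 * m)))) /
      (4 * ?p * (Gamma (real m + 3 / 2) * (2 ^ (2 * m + 1) * fact m)))"
    unfolding A P by (simp only: divide_inverse inverse_mult_distrib mult_minus_left mult_minus_right) (simp only: mult_ac)
  also have "\<dots> = 1" unfolding s Gm using G by (simp add: fact_nonzero)
  finally show ?thesis .
qed

lemma has_derivative_eq_on_open:
  fixes u v :: "'a::euclidean_space \<Rightarrow> real"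
  assumes U: "open U" "x \<in> U" and eq: "\<And>y. y \<in> U \<Longrightarrow> u y = A * v y"
    and v: "((\<lambda>s. v (x + s *\<^sub>R b)) has_real_derivative D) (at 0)"
  shows "((\<lambda>s. u (x + s *\<^sub>R b)) has_real_derivative A * D) (at 0)"
proof (rule has_real_derivative_eventually_cong[OF DERIV_cmult[OF v]])
  have "open ((\<lambda>s. x + s *\<^sub>R b) -` U)" by (intro open_vimage U continuous_intros)
  from eventually_nhds_in_open[OF this, of 0]
  show "\<forall>\<^sub>F s in nhds 0. A * v (x + s *\<^sub>R b) = u (x + s *\<^sub>R b)"
    using U by (auto elim!: eventually_mono simp: eq)
qed

text \<open>\<open>u\<close> is known only on the open set \<open>U\<close>. Openness transfers
  derivatives along lines from the potential to \<open>u\<close>, and the resulting first partial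
  derivative is again a multiple of a potential on \<open>U\<close>, so the same argument gives the
  second one.\<close>

lemma laplacian_eq_newton_potential:
  fixes f u :: "'a::euclidean_space \<Rightarrow> real"
  assumes n: "DIM('a) \<ge> 3" and f: "C_infinity f" "\<And>y. norm y > 1 \<Longrightarrow> f y = 0"
    and U: "open U" and u: "\<And>y. y \<in> U \<Longrightarrow> u y = A * newton_potential f y"
  shows "has_laplacian_on U u"
    and "x \<in> U \<Longrightarrow> laplacian u x = A * (- (real DIM('a) - 2) * sphere_area DIM('a) * f x)"
proof -
  have d1: "((\<lambda>s. u (y + s *\<^sub>R b)) has_real_derivative A * newton_potential (dir_deriv b f) y) (at 0)" if "y \<in> U" for y b
    by (rule has_derivative_eq_on_open[OF U that u newton_potential_deriv[OF n f]])
  have p1: "partial_deriv b u y = A * newton_potential (dir_deriv b f) y" if "y \<in> U" for y b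
    unfolding partial_deriv_def by (rule DERIV_imp_deriv[OF d1[OF that]])
  have d2: "((\<lambda>s. partial_deriv b u (y + s *\<^sub>R b)) has_real_derivative A * newton_potential (dir_deriv b (dir_deriv b f)) y) (at 0)" if "y \<in> U" for y b
    using n C_infinity_dir_deriv[OF f(1)] dir_deriv_support[OF f]
    by (intro has_derivative_eq_on_open[OF U that p1] newton_potential_deriv)
  show "has_laplacian_on U u"
    unfolding has_laplacian_on_def has_partial_deriv_def real_differentiable_def using d1 d2 by blast
  show "laplacian u x = A * (- (real DIM('a) - 2) * sphere_area DIM('a) * f x)" if "x \<in> U"
  proof -
    have "laplacian u x = (\<Sum>b\<in>Basis. A * newton_potential (dir_deriv b (dir_deriv b f)) x)"
      unfolding laplacian_def
      by (intro sum.cong refl) (simp only: partial_deriv_def[of _ "partial_deriv _ u"] DERIV_imp_deriv[OF d2[OF that]])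
    then show ?thesis
      by (simp only: sum_distrib_left[symmetric] laplacian_newton_potential[OF n f])
  qed
qed

text \<open>The smoothness of spherical means supplies the chain of derivatives that the exchange of
  limits takes as a hypothesis.\<close>

lemma integral_sphere_backprojection:
  fixes f :: "'a::euclidean_space \<Rightarrow> real"
  assumes n: "DIM('a) = 2 * m + 3" and f: "C_infinity f" "\<And>y. f y \<noteq> 0 \<Longrightarrow> norm y < 1" and x: "norm x < 1"
  defines "w \<equiv> \<lambda>\<theta>. (D_op ^^ (2 * m)) (\<lambda>t. t ^ (2 * m + 1) * spherical_mean f \<theta> t)"
  shows "integrable sphere_measure (\<lambda>\<theta>. w \<theta> (norm (x - \<theta>)))"
    and "(\<integral>\<theta>. w \<theta> (norm (x - \<theta>)) \<partial>sphere_measure) =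
      2 * (sphere_area (2 * m + 2) * fact (2 * m) * (-1) ^ m / 2 ^ (2 * m + 1)) / sphere_area DIM('a) * newton_potential f x"
proof -
  define h where "h = (\<lambda>\<theta> t. t ^ (2 * m + 1) * spherical_mean f \<theta> t)"
  have Ck: "Ck_family k (\<lambda>\<theta>. (D_op ^^ j) (h \<theta>))" for k j
    unfolding h_def by (intro Ck_family_D_op_funpow Ck_family_spherical_mean f)
  have w: "w = (\<lambda>\<theta>. (D_op ^^ (2 * m)) (h \<theta>))" by (simp add: w_def h_def)
  have wc: "continuous_on (UNIV \<times> {0<..}) (\<lambda>(\<theta>, t). w \<theta> t)"
    unfolding w by (rule Ck_family_continuous[OF Ck])
  have pos: "norm (x - \<theta>) > 0" if "\<theta> \<in> sphere 0 1" for \<theta> using that x by auto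
  show "integrable sphere_measure (\<lambda>\<theta>. w \<theta> (norm (x - \<theta>)))"
    using pos by (intro integrable_sphere_measure_continuous
      continuous_on_compose2[OF wc, of _ "\<lambda>\<theta>. (\<theta>, norm (x - \<theta>))", simplified]) (auto intro!: continuous_intros)
  define S where "S = sphere_area DIM('a)"
  have S: "S > 0" by (simp add: S_def sphere_area_pos)
  \<comment> \<open>The first derivative of the ball integral brings in the factor
    \<open>S / 2\<close> and the function \<open>h\<close>; each further derivative in the squared
    radius applies \<open>D_op\<close> once. Index 2 m + 1 therefore carries exactly 2 m = n - 3
    applications.\<close>
  define e where "e = (\<lambda>i \<theta> s. case i of 0 \<Rightarrow> ball_integral f \<theta> s | Suc j \<Rightarrow> S / 2 * (D_op ^^ j) (h \<theta>) (sqrt s))"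
  have fc: "continuous_on UNIV f" using f(1) by (rule C_infinity_continuous)
  have f1: "f y = 0" if "norm y > 1" for y using f(2)[of y] that by force
  obtain B where B: "\<And>y. \<bar>f y\<bar> \<le> B" using continuous_compact_support_bounded[OF fc f1] by blast
  have ed: "(e i \<theta> has_real_derivative e (Suc i) \<theta> s) (at s)" if s: "s > 0" for i \<theta> s
  proof (cases i)
    case 0
    have "(ball_integral f \<theta> has_real_derivative S / 2 * (sqrt s ^ (DIM('a) - 2) * spherical_mean f \<theta> (sqrt s))) (at s)"
      unfolding S_def using n by (intro ball_integral_has_derivative fc s) simp
    moreover have "DIM('a) - 2 = 2 * m + 1" using n by simp
    ultimately show ?thesis using 0 by (simp add: e_def h_def)
  next
    case (Suc j)
    have "(D_op ^^ j) (h \<theta>) differentiable (at (sqrt s))"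
      using s by (intro Ck_family_differentiable[OF Ck]) simp
    from DERIV_cmult[OF has_real_derivative_compose_sqrt[OF this s], of "S / 2"] show ?thesis
      using Suc by (simp add: e_def)
  qed
  have "(\<integral>\<theta>. e (2 * m + 1) \<theta> ((norm (x - \<theta>))\<^sup>2) \<partial>sphere_measure) =
      sphere_area (2 * m + 2) * fact (2 * m) * (-1) ^ m / 2 ^ (2 * m + 1) * (\<integral>y. f y / norm (y - x) ^ (2 * m + 1) \<partial>lborel)"
  proof (rule integral_sphere_higher_derivative[OF n _ B f(2)])
    show "f \<in> borel_measurable borel" using fc by (rule borel_measurable_continuous_onI)
    show "e 0 = ball_integral f" by (simp add: e_def fun_eq_iff)
    have "continuous_on (UNIV \<times> {0<..}) (\<lambda>p. (\<lambda>(\<theta>, t). w \<theta> t) (fst p, sqrt (snd p)))"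
      by (intro continuous_on_compose2[OF wc] continuous_intros) auto
    then have "continuous_on (UNIV \<times> {0<..}) (\<lambda>p. S / 2 * (\<lambda>(\<theta>, t). w \<theta> t) (fst p, sqrt (snd p)))"
      by (intro continuous_intros)
    then show "continuous_on (UNIV \<times> {0<..}) (\<lambda>(\<theta>, s). e (2 * m + 1) \<theta> s)"
      by (simp add: e_def w split_beta)
  qed (use ed x in auto)
  moreover have "e (2 * m + 1) \<theta> ((norm (x - \<theta>))\<^sup>2) = S / 2 * w \<theta> (norm (x - \<theta>))" for \<theta>
    by (simp add: e_def w)
  moreover have "(\<integral>y. f y / norm (y - x) ^ (2 * m + 1) \<partial>lborel) = newton_potential f x"
  proof -
    have [measurable]: "f \<in> borel_measurable borel" using fc by (rule borel_measurable_continuous_onI)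
    have "(\<integral>y. f y / norm (y - x) ^ (2 * m + 1) \<partial>lborel) =
       \<bar>- 1\<bar> ^ DIM('a) * (\<integral>z. f (x + (-1) *\<^sub>R z) / norm (x + (-1) *\<^sub>R z - x) ^ (2 * m + 1) \<partial>lborel)"
      by (rule integral_lborel_affine) auto
    moreover have "DIM('a) - 2 = 2 * m + 1" using n by simp
    ultimately show ?thesis by (simp add: newton_potential_def)
  qed
  ultimately have "(\<integral>\<theta>. S / 2 * w \<theta> (norm (x - \<theta>)) \<partial>sphere_measure) =
      sphere_area (2 * m + 2) * fact (2 * m) * (-1) ^ m / 2 ^ (2 * m + 1) * newton_potential f x"
    by (simp only:)
  then show "(\<integral>\<theta>. w \<theta> (norm (x - \<theta>)) \<partial>sphere_measure) =
      2 * (sphere_area (2 * m + 2) * fact (2 * m) * (-1) ^ m / 2 ^ (2 * m + 1)) / sphere_area DIM('a) * newton_potential f x"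
    using S unfolding S_def[symmetric] integral_mult_right_zero by (simp add: field_simps)
qed

theorem mainTheorem1:
  fixes f :: "real ^ 'n \<Rightarrow> real"
  assumes "odd CARD('n)" and "CARD('n) \<ge> 3"
    and "C_infinity f" and "closure {x. f x \<noteq> 0} \<subseteq> ball 0 1"
  shows "let n = CARD('n);
             c = (-1) ^ ((n - 1) div 2) / (4 * pi powr (real n / 2 - 1) * Gamma (real n / 2));
             h = (\<lambda>\<theta> t. t ^ (n - 2) * spherical_mean f \<theta> t);
             w = (\<lambda>\<theta>. (D_op ^^ (n - 3)) (h \<theta>));
             u = (\<lambda>x. \<integral>\<theta>. w \<theta> (norm (x - \<theta>)) \<partial>sphere_measure)
         in (\<forall>\<theta>\<in>sphere 0 1. D_iterable_on {0<..} (n - 3) (h \<theta>)) \<and>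
            (\<forall>x\<in>ball 0 1. integrable sphere_measure (\<lambda>\<theta>. w \<theta> (norm (x - \<theta>)))) \<and>
            has_laplacian_on (ball 0 1) u \<and>
            (\<forall>x\<in>ball 0 1. f x = c * laplacian u x)"
proof -
  obtain m where m: "CARD('n) = 2 * m + 3"
  proof -
    obtain k where "CARD('n) = 2 * k + 1" using assms(1) by (auto elim: oddE)
    then show ?thesis using assms(2) that[of "k - 1"] by simp
  qed
  have n: "DIM(real ^ 'n) = 2 * m + 3" using m by simp
  have supp: "norm y < 1" if "f y \<noteq> 0" for y
    using assms(4) closure_subset[of "{x. f x \<noteq> 0}"] that by auto
  have f1: "f y = 0" if "norm y > 1" for y using supp[of y] that by force
  define w where "w = (\<lambda>\<theta>. (D_op ^^ (2 * m)) (\<lambda>t. t ^ (2 * m + 1) * spherical_mean f \<theta> t))"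
  define u where "u = (\<lambda>x. \<integral>\<theta>. w \<theta> (norm (x - \<theta>)) \<partial>sphere_measure)"
  define \<kappa> where "\<kappa> = sphere_area (2 * m + 2) * fact (2 * m) * (-1) ^ m / 2 ^ (2 * m + 1)"
  define S where "S = sphere_area DIM(real ^ 'n)"
  have S: "S > 0" unfolding S_def by (rule sphere_area_pos) (rule DIM_positive)
  have bp: "integrable sphere_measure (\<lambda>\<theta>. w \<theta> (norm (x - \<theta>)))" "u x = 2 * \<kappa> / S * newton_potential f x"
    if "x \<in> ball 0 1" for x
    using integral_sphere_backprojection[OF n assms(3) supp, of x] that
    unfolding w_def u_def \<kappa>_def S_def by simp_all
  have n3: "DIM(real ^ 'n) \<ge> 3" using n by simp
  have lap1: "has_laplacian_on (ball 0 1) u"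
    by (rule laplacian_eq_newton_potential(1)[OF n3 assms(3) f1 open_ball bp(2)])
  have lap2: "laplacian u x = 2 * \<kappa> / S * (- (real DIM(real ^ 'n) - 2) * S * f x)" if "x \<in> ball 0 1" for x
    using laplacian_eq_newton_potential(2)[OF n3 assms(3) f1 open_ball bp(2) that] by (simp only: S_def)
  have iter: "D_iterable_on {0<..} (2 * m) (\<lambda>t. t ^ (2 * m + 1) * spherical_mean f \<theta> t)" for \<theta>
    unfolding D_iterable_on_def
    using Ck_family_differentiable[OF Ck_family_D_op_funpow[OF Ck_family_spherical_mean[OF assms(3)]]] by blast
  have inv: "f x = (-1) ^ (m + 1) / (4 * pi powr (real m + 1 / 2) * Gamma (real m + 3 / 2)) * laplacian u x"
    if "x \<in> ball 0 1" for x
  proof -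
    have "2 * \<kappa> / S * (- (real DIM(real ^ 'n) - 2) * S * f x) = 2 * \<kappa> * (- (2 * real m + 1)) * f x"
      using S unfolding n by simp
    then show ?thesis
      unfolding lap2[OF that] using inversion_constant[of m] unfolding \<kappa>_def[symmetric]
      by (simp only: mult.assoc[symmetric])
  qed
  have e: "real CARD('n) / 2 - 1 = real m + 1 / 2" "real CARD('n) / 2 = real m + 3 / 2"
    "(CARD('n) - 1) div 2 = m + 1" "CARD('n) - 2 = 2 * m + 1" "CARD('n) - 3 = 2 * m"
    unfolding m by (simp_all add: field_simps)
  show ?thesis
    \<comment> \<open>The rule \<open>e(1)\<close> has to come first, because the left side of
      \<open>e(2)\<close> is a subterm of its left side.\<close>
    unfolding Let_def e(1) unfolding e(2-5) using iter bp(1) lap1 inv unfolding u_def w_def by blast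
qed

end
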